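(* Let $\mathcal{W}$ be a standard sequence of generating words with cutting parameters $(q_n)_{n\ge0}$ and bounded spacers such that the minimal Ferenczi subshift $(X_{\mathcal{W}}, S)$ is aperiodic. The dimension group $K^0(X_{\mathcal{W}}, S)$ is unital order isomorphic to $(\mathcal{G}_{\mathcal{W}}, \mathcal{G}_{\mathcal{W}}^+, u_{\mathcal{W}})$, where $$\mathcal{G}_{\mathcal{W}} = \mathbb{Z}^{\mathcal{B}_{\mathcal{W}}} \times \mathbb{Z}[(q_n+1)_{n \ge n_0-1}], \qquad \mathcal{G}_{\mathcal{W}}^+ = \{x \in \mathcal{G}_{\mathcal{W}} : x \cdot \boldsymbol{z} > 0\} \cup \{0\},$$ and $u_{\mathcal{W}}$ is given by $u_{\mathcal{W}}(b) = b - a'$ for $b \in \mathcal{B}_{\mathcal{W}}$ and $u_{\mathcal{W}}(a') = a' + |w_{n_0-1}|$.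
   Context: $S$ is the shift; a subshift is aperiodic if it is nonempty and contains no shift-periodic point. Ferenczi subshifts. Given nonnegative integers $(q_n)_{n \ge 0}$ (cutting parameters) and $(a_{n,i} : n \ge 0, 0 \le i < q_n)$ (spacer parameters), the sequence of generating words $\mathcal{W} = (w_n)_{n \ge 0}$ over $\{0,1\}$ is $w_0 = 0$, $w_{n+1} = w_n 1^{a_{n,0}} w_n 1^{a_{n,1}} \cdots w_n 1^{a_{n,q_n-1}} w_n$. $X_{\mathcal{W}}$ is the set of $x \in \{0,1\}^{\mathbb{Z}}$ every finite factor of which is a factor of some $w_n$. $\mathcal{W}$ is standard if $q_n \ge 2$ for all $n$. If the spacers are bounded, $(X_{\mathcal{W}},S)$ is minimal. Directive sequence. $\mathcal{A}_0=\{0,1\}$ and $\mathcal{A}_n = \{a_{N,i} : N \ge n-1, 0 \le i < q_N\}$ for $n \ge 1$; $\tau_0(a)=01^a$ for $a \in \mathcal{A}_1$ and $\tau_n(a) = a_{n-1,1} \cdots a_{n-1,q_{n-1}-1}\, a\, a_{n-1,0}$ for $n \ge 1$, $a \in \mathcal{A}_{n+1}$. $n_0 \ge 1$ is an integer with $\mathcal{A}_n = \mathcal{A}_{n_0}$ for all $n \ge n_0$, and $\mathcal{A}_{\mathcal{W}} = \mathcal{A}_{n_0}$. Let $a' = \min \mathcal{A}_{\mathcal{W}}$ and $\mathcal{B}_{\mathcal{W}} = \mathcal{A}_{\mathcal{W}} \setminus \{a'\}$. Vectors in $\mathbb{R}^{\mathcal{A}_{\mathcal{W}}}$ are viewed in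 $\mathbb{R}^{\mathcal{B}_{\mathcal{W}}} \times \mathbb{R}$, the last coordinate being the one indexed by $a'$. The vector $\boldsymbol{z}$. Let $\widehat{\boldsymbol{\tau}}_{\mathcal{W}} = (\tau_{n+n_0} : \mathcal{A}_{\mathcal{W}}^* \to \mathcal{A}_{\mathcal{W}}^* )_{n \ge 0}$; the subshift $X_{\widehat{\boldsymbol{\tau}}_{\mathcal{W}}}$ it generates (the $x \in \mathcal{A}_{\mathcal{W}}^{\mathbb{Z}}$ all of whose finite factors occur in $\tau_{n_0} \circ \cdots \circ \tau_{N-1}(a)$ for some $N > n_0$, $a \in \mathcal{A}_{\mathcal{W}}$) is uniquely ergodic with invariant probability measure $\widehat\mu$. Put $\widehat{\boldsymbol{\mu}}(a) = \widehat\mu([a])$, where $[a] = \{x : x_0 = a\}$; explicitly $\widehat{\boldsymbol{\mu}}(a) = \sum_{k=n_0}^\infty \frac{f_k(a)}{Q_{n_0-1,k}}$, with $f_k(a) = \#\{0 \le i < q_{k-1} : a_{k-1,i} = a\}$ and $Q_{m,n} = \prod_{j=m}^{n-1}(q_j+1)$. Then $\boldsymbol{z}(b) = \widehat{\boldsymbol{\mu}}(b)$ for $b \in \mathcal{B}_{\mathcal{W}}$ and $\boldsymbol{z}(a') = 1$. For a sequence of positive integers $(a_n)_{n \ge N}$, $\mathbb{Z}[(a_n)_{n \ge N}] = \{ m/(a_N a_{N+1} \cdots a_n) : m \in \mathbb{Z}, n \ge N\} \subseteq \mathbb{Q}$. Dimension group. For a minimal Cantor system $(X,T)$, $K^0(X,T)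 = (H(X,T), H^+(X,T), [\mathbf{1}_X])$, where $H(X,T) = C(X,\mathbb{Z})/\{f\circ T - f : f \in C(X,\mathbb{Z})\}$, $H^+(X,T)$ is the image of $C(X,\mathbb{N})$ ($\mathbb{N}\ni 0$) and $[\mathbf{1}_X]$ is the class of the constant function $1$. Two triples (group, positive cone, unit) are unital order isomorphic if there is a group isomorphism mapping positive cone onto positive cone and unit to unit. *)

theory Defs
  imports
    "HOL-Probability.Probability"
    "HOL-Algebra.Coset"
    "HOL-Algebra.Product_Groups"
    "HOL-Algebra.Elementary_Groups"
    "HOL-Library.Sublist"
begin

text \<open>
  Letters are natural numbers; two-sided sequences are functions of type
  \<^typ>\<open>int \<Rightarrow> nat\<close>, carrying the product topology of the discrete
  topology (the instance from \<open>HOL-Analysis.Function_Topology\<close>).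
\<close>

definition shift :: "(int \<Rightarrow> nat) \<Rightarrow> int \<Rightarrow> nat" where
  "shift x = (\<lambda>i. x (i + 1))"

definition factor_of :: "nat list \<Rightarrow> (int \<Rightarrow> nat) \<Rightarrow> bool" where
  "factor_of u x \<longleftrightarrow> (\<exists>i j. u = map x [i..j])"

definition aperiodic_subshift :: "(int \<Rightarrow> nat) set \<Rightarrow> bool" where
  "aperiodic_subshift X \<longleftrightarrow>
     X \<noteq> {} \<and> (\<forall>x\<in>X. \<forall>p>0. (shift ^^ p) x \<noteq> x)"

section \<open>Ferenczi subshifts\<close>

text \<open>
  \<open>q n\<close> are the cutting and \<open>a n i\<close> the spacer parameters.  Only the values
  \<open>a n i\<close> with \<open>i < q n\<close> are meaningful; no definition looks at the others
  when \<open>q n \<ge> 2\<close>.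
\<close>

fun gen_word :: "(nat \<Rightarrow> nat) \<Rightarrow> (nat \<Rightarrow> nat \<Rightarrow> nat) \<Rightarrow> nat \<Rightarrow> nat list" where
  "gen_word q a 0 = [0]"
| "gen_word q a (Suc n) =
     concat (map (\<lambda>i. gen_word q a n @ replicate (a n i) 1) [0..<q n]) @ gen_word q a n"

definition ferenczi_subshift ::
    "(nat \<Rightarrow> nat) \<Rightarrow> (nat \<Rightarrow> nat \<Rightarrow> nat) \<Rightarrow> (int \<Rightarrow> nat) set" where
  "ferenczi_subshift q a =
     {x. range x \<subseteq> {0, 1} \<and> (\<forall>u. factor_of u x \<longrightarrow> (\<exists>n. sublist u (gen_word q a n)))}"

definition standard_params :: "(nat \<Rightarrow> nat) \<Rightarrow> bool" where
  "standard_params q \<longleftrightarrow> (\<forall>n. q n \<ge> 2)"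

definition bounded_spacers :: "(nat \<Rightarrow> nat) \<Rightarrow> (nat \<Rightarrow> nat \<Rightarrow> nat) \<Rightarrow> bool" where
  "bounded_spacers q a \<longleftrightarrow> (\<exists>K. \<forall>n. \<forall>i<q n. a n i \<le> K)"

section \<open>The directive sequence\<close>

definition alph :: "(nat \<Rightarrow> nat) \<Rightarrow> (nat \<Rightarrow> nat \<Rightarrow> nat) \<Rightarrow> nat \<Rightarrow> nat set" where
  "alph q a n = (if n = 0 then {0, 1} else {a N i | N i. N \<ge> n - 1 \<and> i < q N})"

definition tau :: "(nat \<Rightarrow> nat) \<Rightarrow> (nat \<Rightarrow> nat \<Rightarrow> nat) \<Rightarrow> nat \<Rightarrow> nat \<Rightarrow> nat list" where
  "tau q a n c =
     (if n = 0 then 0 # replicate c 1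
      else map (a (n - 1)) [1..<q (n - 1)] @ [c, a (n - 1) 0])"

definition extend_morphism :: "(nat \<Rightarrow> nat list) \<Rightarrow> nat list \<Rightarrow> nat list" where
  "extend_morphism \<sigma> u = concat (map \<sigma> u)"

text \<open>
  \<open>tau_comp q a m N\<close> is the composition of the (extended) morphisms
  \<open>tau q a m\<close>, ..., \<open>tau q a (N - 1)\<close>, the last one being applied first.
\<close>

definition tau_comp ::
    "(nat \<Rightarrow> nat) \<Rightarrow> (nat \<Rightarrow> nat \<Rightarrow> nat) \<Rightarrow> nat \<Rightarrow> nat \<Rightarrow> nat list \<Rightarrow> nat list" where
  "tau_comp q a m N = foldr (\<lambda>n. extend_morphism (tau q a n)) [m..<N]"

definition stable_level :: "(nat \<Rightarrow> nat) \<Rightarrow> (nat \<Rightarrow> nat \<Rightarrow> nat) \<Rightarrow> nat \<Rightarrow> bool" where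
  "stable_level q a n0 \<longleftrightarrow> n0 \<ge> 1 \<and> (\<forall>n\<ge>n0. alph q a n = alph q a n0)"

definition min_letter :: "(nat \<Rightarrow> nat) \<Rightarrow> (nat \<Rightarrow> nat \<Rightarrow> nat) \<Rightarrow> nat \<Rightarrow> nat" where
  "min_letter q a n0 = Min (alph q a n0)"

definition alphB :: "(nat \<Rightarrow> nat) \<Rightarrow> (nat \<Rightarrow> nat \<Rightarrow> nat) \<Rightarrow> nat \<Rightarrow> nat set" where
  "alphB q a n0 = alph q a n0 - {min_letter q a n0}"

definition tau_hat_subshift ::
    "(nat \<Rightarrow> nat) \<Rightarrow> (nat \<Rightarrow> nat \<Rightarrow> nat) \<Rightarrow> nat \<Rightarrow> (int \<Rightarrow> nat) set" where
  "tau_hat_subshift q a n0 =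
     {x. range x \<subseteq> alph q a n0 \<and>
         (\<forall>u. factor_of u x \<longrightarrow>
            (\<exists>N>n0. \<exists>c\<in>alph q a n0. sublist u (tau_comp q a n0 N [c])))}"

section \<open>Invariant measures and the vector \<open>z\<close>\<close>

definition invariant_probability ::
    "'a::topological_space set \<Rightarrow> ('a \<Rightarrow> 'a) \<Rightarrow> 'a measure \<Rightarrow> bool" where
  "invariant_probability X T M \<longleftrightarrow>
     prob_space M \<and> sets M = sets (restrict_space borel X) \<and>
     T \<in> measurable M M \<and> distr M M T = M"

text \<open>
  Elements of \<open>\<real>\<^sup>B \<times> \<real>\<close> are pairs, the second component being the coordinate
  of the minimal letter.
\<close>

definition z_vec ::
    "(nat \<Rightarrow> nat) \<Rightarrow> (nat \<Rightarrow> nat \<Rightarrow> nat) \<Rightarrow> nat \<Rightarrow> (int \<Rightarrow> nat) measure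
      \<Rightarrow> (nat \<Rightarrow> real) \<times> real" where
  "z_vec q a n0 M =
     (\<lambda>b\<in>alphB q a n0. measure M {x \<in> tau_hat_subshift q a n0. x 0 = b}, 1)"

section \<open>Dimension groups\<close>

text \<open>
  \<open>C(X, \<int>)\<close>: continuous functions on \<open>X\<close>, represented as extensional functions
  so that equality is equality on \<open>X\<close>.  Abelian groups are written
  multiplicatively, following \<open>HOL-Algebra\<close>.
\<close>

definition cont_int :: "'a::topological_space set \<Rightarrow> ('a \<Rightarrow> int) monoid" where
  "cont_int X =
     \<lparr>carrier = {f \<in> extensional X. continuous_on X f},
      monoid.mult = (\<lambda>f g. \<lambda>x\<in>X. f x + g x),
      one = (\<lambda>x\<in>X. 0)\<rparr>"

definition coboundaries :: "'a::topological_space set \<Rightarrow> ('a \<Rightarrow> 'a) \<Rightarrow> ('a \<Rightarrow> int) set" where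
  "coboundaries X T = {(\<lambda>x\<in>X. f (T x) - f x) | f. f \<in> carrier (cont_int X)}"

definition cohom_class ::
    "'a::topological_space set \<Rightarrow> ('a \<Rightarrow> 'a) \<Rightarrow> ('a \<Rightarrow> int) \<Rightarrow> ('a \<Rightarrow> int) set" where
  "cohom_class X T f = coboundaries X T #>\<^bsub>cont_int X\<^esub> f"

definition K0 ::
    "'a::topological_space set \<Rightarrow> ('a \<Rightarrow> 'a)
      \<Rightarrow> ('a \<Rightarrow> int) set monoid \<times> ('a \<Rightarrow> int) set set \<times> ('a \<Rightarrow> int) set" where
  "K0 X T =
     (cont_int X Mod coboundaries X T,
      cohom_class X T ` {f \<in> carrier (cont_int X). \<forall>x\<in>X. f x \<ge> 0},
      cohom_class X T (\<lambda>x\<in>X. 1))"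

definition unital_order_isomorphic ::
    "'a monoid \<times> 'a set \<times> 'a \<Rightarrow> 'b monoid \<times> 'b set \<times> 'b \<Rightarrow> bool" where
  "unital_order_isomorphic = (\<lambda>(G, P, u) (G', P', u').
     \<exists>h \<in> iso G G'. h ` P = P' \<and> h u = u')"

section \<open>The triple attached to the parameters\<close>

definition frac_group :: "(nat \<Rightarrow> nat) \<Rightarrow> nat \<Rightarrow> rat monoid" where
  "frac_group s N =
     \<lparr>carrier = {of_int m / of_nat (\<Prod>j=N..n. s j) | m n. n \<ge> N},
      monoid.mult = (+), one = 0\<rparr>"

definition GW :: "(nat \<Rightarrow> nat) \<Rightarrow> (nat \<Rightarrow> nat \<Rightarrow> nat) \<Rightarrow> nat \<Rightarrow> ((nat \<Rightarrow> int) \<times> rat) monoid" where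
  "GW q a n0 =
     product_group (alphB q a n0) (\<lambda>_. integer_group) \<times>\<times>
     frac_group (\<lambda>n. q n + 1) (n0 - 1)"

definition dot :: "nat set \<Rightarrow> (nat \<Rightarrow> int) \<times> rat \<Rightarrow> (nat \<Rightarrow> real) \<times> real \<Rightarrow> real" where
  "dot B x z = (\<Sum>b\<in>B. of_int (fst x b) * fst z b) + of_rat (snd x) * snd z"

definition GW_pos ::
    "(nat \<Rightarrow> nat) \<Rightarrow> (nat \<Rightarrow> nat \<Rightarrow> nat) \<Rightarrow> nat \<Rightarrow> (int \<Rightarrow> nat) measure
      \<Rightarrow> ((nat \<Rightarrow> int) \<times> rat) set" where
  "GW_pos q a n0 M =
     {x \<in> carrier (GW q a n0). dot (alphB q a n0) x (z_vec q a n0 M) > 0}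
     \<union> {\<one>\<^bsub>GW q a n0\<^esub>}"

definition uW :: "(nat \<Rightarrow> nat) \<Rightarrow> (nat \<Rightarrow> nat \<Rightarrow> nat) \<Rightarrow> nat \<Rightarrow> (nat \<Rightarrow> int) \<times> rat" where
  "uW q a n0 =
     (\<lambda>b\<in>alphB q a n0. int b - int (min_letter q a n0),
      of_nat (min_letter q a n0 + length (gen_word q a (n0 - 1))))"

end

theory Submission
  imports Defs
begin

text \<open>
  Counting the zeros of a point of the subshift turns it into a Toeplitz sequence of spacers: on
  level \<open>n\<close> all positions outside one residue class modulo \<open>\<Prod>\<^bsub>j<n\<^esub> (q\<^sub>j + 1)\<close> carry prescribed
  spacers. Two different phases would leave no hole and make the point periodic, so by
  aperiodicity every point is uniquely a concatenation of blocks \<open>w\<^sub>n 1\<^sup>c\<close>. These blocks give a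
  Kakutani-Rokhlin partition with one tower for each spacer \<open>c\<close>, and a continuous function is, up to
  coboundaries, its vector \<open>v\<close> of tower sums on a high level. Passing from level \<open>n\<close> to level \<open>n + 1\<close>
  adds \<open>\<Sum>\<^bsub>i<q\<^sub>n\<^esub> v(a\<^bsub>n,i\<^esub>)\<close> to all entries of \<open>v\<close>. Hence the differences \<open>v(b) - v(a')\<close> do not
  depend on the level, and \<open>v(a')\<close>, corrected by an integer combination of these differences and
  divided by \<open>\<Prod>\<^bsub>m\<le>j<n\<^esub> (q\<^sub>j + 1)\<close> with \<open>m = n\<^sub>0 - 1\<close>, does not either; these are the coordinates in \<open>GW\<close>. The
  coefficients of the correction are letter counts of the directive sequence, so up to a bounded
  error \<open>v(a')\<close> is \<open>\<Prod>\<^bsub>m\<le>j<n\<^esub> (q\<^sub>j + 1)\<close> times the scalar product with \<open>z\<close>, which gives the order.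
\<close>

section \<open>Locally constant functions on a set of two-sided sequences\<close>

text \<open>The direct limit behind the dimension group is never formed. The relation
  \<open>rel\<close> reads the coordinates of a function from the tower sums of any cohomologous
  function on any level from \<open>m\<close> on, and its uniqueness replaces the limit. This works
  because \<open>push n\<close> is the identity plus a matrix of rank one: differences of entries
  are fixed, and the recursion for \<open>block_count\<close> is exactly what makes
  \<open>num\<close> a functional that is multiplied by \<open>q n + 1\<close>. Two obstacles shape
  the geometric part. Factors of a point are only known to occur in some
  \<open>gen_word q a N\<close>, so a phase is first found on finite windows and a finiteness
  argument gives one for the whole point. And the spacer in front of a tower is unknown, so the
  tower sums of a function that looks to the left may depend on more than the spacer of the tower;
  such a function is shifted until it sees the future alone, which costs a coboundary. For the
  order, the error between \<open>v a'\<close> and \<open>Qn n\<close> times the scalar product is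
  bounded by \<open>vnorm\<close>, which depends on the group element but not on the level, so the
  growth of \<open>Qn\<close> outweighs it.\<close>

definition sh :: "int \<Rightarrow> (int \<Rightarrow> nat) \<Rightarrow> int \<Rightarrow> nat" where
  "sh k x = (\<lambda>i. x (i + k))"

definition agree :: "nat \<Rightarrow> (int \<Rightarrow> nat) \<Rightarrow> (int \<Rightarrow> nat) \<Rightarrow> bool" where
  "agree r x y \<longleftrightarrow> (\<forall>i. \<bar>i\<bar> \<le> int r \<longrightarrow> x i = y i)"

text \<open>Continuity into a discrete space, expressed through symmetric windows. The codomain is
  arbitrary, so that predicates and natural numbers depending on the point are covered as
  well.\<close>

definition loc_const :: "(int \<Rightarrow> nat) set \<Rightarrow> ((int \<Rightarrow> nat) \<Rightarrow> 'b) \<Rightarrow> bool" where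
  "loc_const X f \<longleftrightarrow> (\<forall>x\<in>X. \<exists>r. \<forall>y\<in>X. agree r x y \<longrightarrow> f y = f x)"

lemma sh_sh [simp]: "sh j (sh k x) = sh (j + k) x"
  by (simp add: sh_def add.assoc)

lemma sh_0 [simp]: "sh 0 x = x"
  by (simp add: sh_def)

lemma sh_apply: "sh k x i = x (i + k)"
  by (simp add: sh_def)

lemma shift_eq_sh: "shift x = sh 1 x"
  by (simp add: shift_def sh_def)

lemma shift_funpow: "(shift ^^ n) x = sh (int n) x"
proof (induction n)
  case (Suc n)
  then show ?case by (simp add: shift_eq_sh add.commute)
qed simp

lemma agree_refl [simp]: "agree r x x"
  by (simp add: agree_def)

lemma agree_trans: "agree r x y \<Longrightarrow> agree r y z \<Longrightarrow> agree r x z"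
  by (simp add: agree_def)

lemma agree_mono: "agree r x y \<Longrightarrow> s \<le> r \<Longrightarrow> agree s x y"
  by (auto simp: agree_def)

lemma agree_sh: "agree r x y \<Longrightarrow> s + nat \<bar>k\<bar> \<le> r \<Longrightarrow> agree s (sh k x) (sh k y)"
  by (auto simp: agree_def sh_def)

lemma open_agree: "open {y. agree r x y}"
proof -
  have "{y. agree r x y} = PiE UNIV (\<lambda>i. if \<bar>i\<bar> \<le> int r then {x i} else UNIV)"
    by (auto simp: agree_def PiE_def Pi_def split: if_splits)
  moreover have "open (PiE UNIV (\<lambda>i. if \<bar>i\<bar> \<le> int r then {x i} else UNIV))"
  proof (rule open_PiE)
    have "{i. (if \<bar>i\<bar> \<le> int r then {x i} else UNIV) \<noteq> UNIV} \<subseteq> {-int r..int r}"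
      by (auto split: if_splits)
    then show "finite {i. (if \<bar>i\<bar> \<le> int r then {x i} else UNIV) \<noteq> UNIV}"
      using finite_subset by blast
  qed (auto simp: discrete_topology_class.open_discrete)
  ultimately show ?thesis by simp
qed

lemma open_contains_agree:
  assumes "open U" "x \<in> U"
  obtains r where "\<And>y. agree r x y \<Longrightarrow> y \<in> U"
proof -
  have "openin (product_topology (\<lambda>i::int. euclidean::nat topology) UNIV) U"
    using assms(1) open_fun_def by blast
  from product_topology_open_contains_basis[OF this assms(2)]
  obtain V where V: "x \<in> PiE UNIV V" "finite {i. V i \<noteq> UNIV}" "PiE UNIV V \<subseteq> U"
    by auto
  \<comment> \<open>A basic open set restricts only finitely many coordinates; \<open>r\<close>
    bounds their absolute values.\<close>
  obtain r where r: "\<And>i. V i \<noteq> UNIV \<Longrightarrow> nat \<bar>i\<bar> \<le> r"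
    using finite_nat_set_iff_bounded_le[of "(\<lambda>i. nat \<bar>i\<bar>) ` {i. V i \<noteq> UNIV}"] V(2) by auto
  show thesis
  proof (rule that[of r])
    fix y assume y: "agree r x y"
    have "y i \<in> V i" for i
    proof (cases "V i = UNIV")
      case False
      from r[OF False] have "x i = y i" using y by (auto simp: agree_def)
      then show ?thesis using V(1) by (auto simp: PiE_def Pi_def dest: spec[of _ i])
    qed simp
    then show "y \<in> U" using V(3) by auto
  qed
qed

lemma continuous_on_iff_loc_const:
  fixes f :: "(int \<Rightarrow> nat) \<Rightarrow> 'b::discrete_topology"
  shows "continuous_on X f \<longleftrightarrow> loc_const X f"
proof
  assume c: "continuous_on X f"
  show "loc_const X f" unfolding loc_const_def
  proof
    fix x assume x: "x \<in> X"
    have "open {f x}" by (rule discrete_topology_class.open_discrete)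
    with c x obtain A where A: "open A" "x \<in> A" "\<forall>y\<in>X. y \<in> A \<longrightarrow> f y \<in> {f x}"
      unfolding continuous_on_topological by blast
    from open_contains_agree[OF A(1,2)] obtain r where "\<And>y. agree r x y \<Longrightarrow> y \<in> A" by blast
    with A(3) show "\<exists>r. \<forall>y\<in>X. agree r x y \<longrightarrow> f y = f x" by blast
  qed
next
  assume l: "loc_const X f"
  show "continuous_on X f" unfolding continuous_on_topological
  proof (intro ballI allI impI)
    fix x B assume x: "x \<in> X" and B: "open B" "f x \<in> B"
    from l x obtain r where "\<forall>y\<in>X. agree r x y \<longrightarrow> f y = f x" unfolding loc_const_def by blast
    then show "\<exists>A. open A \<and> x \<in> A \<and> (\<forall>y\<in>X. y \<in> A \<longrightarrow> f y \<in> B)"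
      using B by (intro exI[of _ "{y. agree r x y}"]) (auto simp: open_agree)
  qed
qed

text \<open>Compactness leaves finitely many centres. Agreement on a window is transitive, so if
  \<open>x\<close> agrees with a centre, every \<open>y\<close> that agrees with \<open>x\<close> on
  the largest window agrees with the same centre.\<close>

lemma loc_const_uniform:
  assumes "compact X" "loc_const X f"
  obtains r where "\<And>x y. x \<in> X \<Longrightarrow> y \<in> X \<Longrightarrow> agree r x y \<Longrightarrow> f x = f y"
proof -
  from assms(2) have "\<forall>x\<in>X. \<exists>r. \<forall>y\<in>X. agree r x y \<longrightarrow> f y = f x"
    unfolding loc_const_def .
  then obtain \<rho> where "\<forall>x\<in>X. \<forall>y\<in>X. agree (\<rho> x) x y \<longrightarrow> f y = f x"
    by (rule bchoice[THEN exE])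
  then have \<rho>: "\<And>x y. x \<in> X \<Longrightarrow> y \<in> X \<Longrightarrow> agree (\<rho> x) x y \<Longrightarrow> f y = f x"
    by blast
  have "X \<subseteq> (\<Union>x\<in>X. {y. agree (\<rho> x) x y})" by auto
  then obtain C where C: "C \<subseteq> X" "finite C" "X \<subseteq> (\<Union>x\<in>C. {y. agree (\<rho> x) x y})"
    using compactE_image[OF assms(1), of X "\<lambda>x. {y. agree (\<rho> x) x y}"] open_agree by blast
  obtain r where r: "\<And>x. x \<in> C \<Longrightarrow> \<rho> x \<le> r"
    using finite_nat_set_iff_bounded_le[of "\<rho> ` C"] C(2) by auto
  show thesis
  proof (rule that[of r])
    fix x y assume x: "x \<in> X" and y: "y \<in> X" and xy: "agree r x y"
    from x C(3) obtain z where z: "z \<in> C" "agree (\<rho> z) z x" by blast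
    then have "agree (\<rho> z) z y"
      using agree_trans agree_mono xy r by blast
    then show "f x = f y" using \<rho>[of z x] \<rho>[of z y] z C(1) x y by auto
  qed
qed

lemma compact_binary_sequences: "compact {x :: int \<Rightarrow> nat. range x \<subseteq> {0, 1}}"
proof -
  have "compactin (product_topology (\<lambda>i::int. euclidean) UNIV) (PiE UNIV (\<lambda>i. {0, 1::nat}))"
    unfolding compactin_PiE by (auto simp: finite_imp_compact)
  moreover have "{x :: int \<Rightarrow> nat. range x \<subseteq> {0, 1}} = PiE UNIV (\<lambda>i. {0, 1::nat})"
    by (simp add: PiE_def Pi_def image_subset_iff)
  ultimately show ?thesis
    by (simp add: euclidean_product_topology)
qed

lemma closed_if_agree:
  assumes "\<And>x. x \<notin> X \<Longrightarrow> \<exists>r. \<forall>y. agree r x y \<longrightarrow> y \<notin> X"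
  shows "closed X"
  unfolding closed_def
proof (subst open_subopen, intro ballI)
  fix x assume "x \<in> - X"
  with assms obtain r where r: "\<forall>y. agree r x y \<longrightarrow> y \<notin> X" by blast
  show "\<exists>T. open T \<and> x \<in> T \<and> T \<subseteq> - X"
    by (rule exI[of _ "{y. agree r x y}"]) (use r in \<open>auto simp: open_agree\<close>)
qed

text \<open>A letter other than 0 and 1, or a factor that no generating word contains, is visible in
  a finite window, so the set is closed.\<close>

lemma compact_ferenczi: "compact (ferenczi_subshift q a)"
proof -
  have "closed (ferenczi_subshift q a)"
  proof (rule closed_if_agree)
    fix x assume x: "x \<notin> ferenczi_subshift q a"
    show "\<exists>r. \<forall>y. agree r x y \<longrightarrow> y \<notin> ferenczi_subshift q a"
    proof (cases "range x \<subseteq> {0, 1}")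
      case False
      then obtain i where i: "x i \<notin> {0, 1}" by auto
      have "y \<notin> ferenczi_subshift q a" if "agree (nat \<bar>i\<bar>) x y" for y
      proof -
        have "y i = x i" using that by (auto simp: agree_def)
        then show ?thesis using i by (auto simp: ferenczi_subshift_def dest: range_subsetD[of _ _ i])
      qed
      then show ?thesis by blast
    next
      case True
      then obtain i j where ij: "\<And>n. \<not> sublist (map x [i..j]) (gen_word q a n)"
        using x by (auto simp: ferenczi_subshift_def factor_of_def)
      have "y \<notin> ferenczi_subshift q a" if y: "agree (nat (\<bar>i\<bar> + \<bar>j\<bar>)) x y" for y
      proof -
        have "map x [i..j] = map y [i..j]" using y by (auto simp: agree_def)
        then have "factor_of (map x [i..j]) y" unfolding factor_of_def by blast
        then show ?thesis using ij unfolding ferenczi_subshift_def by blast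
      qed
      then show ?thesis by blast
    qed
  qed
  moreover have "ferenczi_subshift q a = ferenczi_subshift q a \<inter> {x. range x \<subseteq> {0, 1}}"
    by (auto simp: ferenczi_subshift_def)
  ultimately show ?thesis
    using closed_Int_compact[OF _ compact_binary_sequences] by metis
qed

lemma sh_ferenczi: "x \<in> ferenczi_subshift q a \<Longrightarrow> sh k x \<in> ferenczi_subshift q a"
proof -
  assume x: "x \<in> ferenczi_subshift q a"
  have "map (sh k x) [i..j] = map x [i+k..j+k]" for i j
  proof (rule nth_equalityI)
    fix n assume "n < length (map (sh k x) [i..j])"
    then show "map (sh k x) [i..j] ! n = map x [i+k..j+k] ! n"
      by (simp add: sh_def algebra_simps)
  qed simp
  then have fac: "factor_of u x" if "factor_of u (sh k x)" for u
    using that by (auto simp: factor_of_def)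
  have "range (sh k x) \<subseteq> range x" by (auto simp: sh_def)
  moreover have "range x \<subseteq> {0, 1}" using x by (auto simp: ferenczi_subshift_def)
  ultimately have "range (sh k x) \<subseteq> {0, 1}" by (rule subset_trans)
  then show ?thesis using x fac by (simp add: ferenczi_subshift_def)
qed

section \<open>Closure properties of locally constant functions\<close>

lemma loc_const_const [simp]: "loc_const X (\<lambda>x. c)"
  by (simp add: loc_const_def)

text \<open>Near \<open>x\<close> the parameter \<open>f x\<close> does not change, so only one
  member of the family \<open>F\<close> matters. This allows sums whose range depends on the
  point.\<close>

lemma loc_const_bind:
  assumes "loc_const X f" "\<And>s. loc_const X (F s)"
  shows "loc_const X (\<lambda>x. F (f x) x)"
  unfolding loc_const_def
proof
  fix x assume x: "x \<in> X"
  from assms(1) x obtain r where r: "\<forall>y\<in>X. agree r x y \<longrightarrow> f y = f x"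
    unfolding loc_const_def by blast
  from assms(2)[of "f x"] x obtain r' where r': "\<forall>y\<in>X. agree r' x y \<longrightarrow> F (f x) y = F (f x) x"
    unfolding loc_const_def by blast
  show "\<exists>r. \<forall>y\<in>X. agree r x y \<longrightarrow> F (f y) y = F (f x) x"
  proof (intro exI ballI impI)
    fix y assume y: "y \<in> X" "agree (max r r') x y"
    then have "agree r x y" "agree r' x y" by (auto intro: agree_mono)
    then show "F (f y) y = F (f x) x" using r r' y by simp
  qed
qed

lemma loc_const_comp: "loc_const X f \<Longrightarrow> loc_const X (\<lambda>x. H (f x))"
  by (rule loc_const_bind[where F = "\<lambda>s x. H s"]) (assumption, rule loc_const_const)

lemma loc_const_comp2: "loc_const X f \<Longrightarrow> loc_const X g \<Longrightarrow> loc_const X (\<lambda>x. H (f x) (g x))"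
  by (rule loc_const_bind[where F = "\<lambda>s x. H s (g x)"], assumption, rule loc_const_comp)

lemma loc_const_sum:
  assumes "finite I" "\<And>i. i \<in> I \<Longrightarrow> loc_const X (f i)"
  shows "loc_const X (\<lambda>x. \<Sum>i\<in>I. f i x)"
  using assms
proof (induction I rule: finite_induct)
  case (insert i I)
  then have "loc_const X (\<lambda>x. f i x + (\<Sum>i\<in>I. f i x))" 
      by (intro loc_const_comp2[where H = "(+)"]) auto
  then show ?case using insert by simp
qed simp

text \<open>The least \<open>n\<close> at \<open>x\<close> is decided by the finitely many
  predicates \<open>Q 0\<close>, ..., \<open>Q n\<close>, so the largest of their windows
  suffices.\<close>

lemma loc_const_Least:
  fixes Q :: "nat \<Rightarrow> (int \<Rightarrow> nat) \<Rightarrow> bool"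
  assumes "\<And>s. loc_const X (Q s)" "\<And>x. x \<in> X \<Longrightarrow> \<exists>s. Q s x"
  shows "loc_const X (\<lambda>x. LEAST s. Q s x)"
  unfolding loc_const_def
proof
  fix x assume x: "x \<in> X"
  define n where "n = (LEAST s. Q s x)"
  have n: "Q n x" unfolding n_def using assms(2)[OF x] by (rule LeastI_ex)
  have "\<forall>s. \<exists>r. \<forall>y\<in>X. agree r x y \<longrightarrow> Q s y = Q s x"
    using assms(1) x unfolding loc_const_def by blast
  then obtain r where r: "\<And>s y. y \<in> X \<Longrightarrow> agree (r s) x y \<Longrightarrow> Q s y = Q s x"
    by metis
  obtain R where R: "\<And>s. s \<le> n \<Longrightarrow> r s \<le> R"
    using finite_nat_set_iff_bounded_le[of "r ` {..n}"] by auto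
  have "(LEAST s. Q s y) = n" if y: "y \<in> X" "agree R x y" for y
  proof -
    have e: "Q s y = Q s x" if "s \<le> n" for s
      by (rule r[OF y(1)]) (rule agree_mono[OF y(2) R[OF that]])
    show ?thesis
    proof (rule Least_equality)
      show "Q n y" using e n by simp
    next
      fix s assume s: "Q s y"
      show "n \<le> s"
      proof (rule ccontr)
        assume a: "\<not> n \<le> s"
        with s e[of s] have "Q s x" by simp
        then have "n \<le> s" unfolding n_def by (rule Least_le)
        with a show False by simp
      qed
    qed
  qed
  then show "\<exists>r. \<forall>y\<in>X. agree r x y \<longrightarrow> (LEAST s. Q s y) = (LEAST s. Q s x)"
    unfolding n_def by blast
qed

lemma loc_const_sh:
  assumes "loc_const X f" "\<And>x. x \<in> X \<Longrightarrow> sh k x \<in> X"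
  shows "loc_const X (\<lambda>x. f (sh k x))"
  unfolding loc_const_def
proof
  fix x assume x: "x \<in> X"
  with assms(1) assms(2)[OF x] obtain r where r: "\<forall>y\<in>X. agree r (sh k x) y \<longrightarrow> f y = f (sh k x)"
    unfolding loc_const_def by blast
  show "\<exists>r. \<forall>y\<in>X. agree r x y \<longrightarrow> f (sh k y) = f (sh k x)"
  proof (intro exI ballI impI)
    fix y assume y: "y \<in> X" "agree (r + nat \<bar>k\<bar>) x y"
    from agree_sh[OF y(2), of r k] have "agree r (sh k x) (sh k y)" by simp
    then show "f (sh k y) = f (sh k x)" using r assms(2)[OF y(1)] by blast
  qed
qed

section \<open>Generating words as codes of spacer sequences\<close>

definition code_word :: "(nat \<Rightarrow> nat) \<Rightarrow> nat \<Rightarrow> nat list" where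
  "code_word c m = concat (map (\<lambda>k. 0 # replicate (c k) 1) [0..<m])"

text \<open>The position of the \<open>t\<close>-th zero, counted from 0, in a long enough
  \<open>code_word c m\<close>.\<close>

definition pos :: "(nat \<Rightarrow> nat) \<Rightarrow> nat \<Rightarrow> nat" where
  "pos c t = (\<Sum>k<t. Suc (c k))"

lemma pos_0 [simp]: "pos c 0 = 0"
  by (simp add: pos_def)

lemma pos_Suc: "pos c (Suc t) = pos c t + Suc (c t)"
  by (simp add: pos_def)

lemma le_pos: "t \<le> pos c t"
  by (induction t) (auto simp: pos_Suc)

lemma pos_strict_mono: "s < t \<Longrightarrow> pos c s < pos c t"
  by (induction t) (auto simp: pos_Suc less_Suc_eq)

lemma pos_mono: "s \<le> t \<Longrightarrow> pos c s \<le> pos c t"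
  by (metis le_less pos_strict_mono less_imp_le)

lemma pos_cover: "i < pos c m \<Longrightarrow> \<exists>t<m. \<exists>d\<le>c t. i = pos c t + d"
proof (induction m)
  case (Suc m)
  show ?case
  proof (cases "i < pos c m")
    case True
    with Suc.IH show ?thesis using less_Suc_eq by blast
  next
    case False
    with Suc.prems have "i - pos c m \<le> c m" "i = pos c m + (i - pos c m)"
      by (auto simp: pos_Suc)
    then show ?thesis by blast
  qed
qed simp

lemma code_word_Suc: "code_word c (Suc m) = code_word c m @ 0 # replicate (c m) 1"
  by (simp add: code_word_def)

lemma length_code_word [simp]: "length (code_word c m) = pos c m"
  by (induction m) (auto simp: code_word_Suc pos_Suc, simp add: code_word_def)

lemma nth_code_word:
  "t < m \<Longrightarrow> d \<le> c t \<Longrightarrow> code_word c m ! (pos c t + d) = (if d = 0 then 0 else 1)"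
proof (induction m)
  case (Suc m)
  show ?case
  proof (cases "t = m")
    case True
    then show ?thesis using Suc.prems by (auto simp: code_word_Suc nth_append nth_Cons')
  next
    case False
    with Suc.prems have t: "t < m" by simp
    then have "pos c t + d < pos c m"
      using pos_mono[of "Suc t" m c] Suc.prems by (simp add: pos_Suc)
    then show ?thesis using Suc t by (simp add: code_word_Suc nth_append)
  qed
qed simp

text \<open>A generating word ends in a zero without spacer. Appending this zero makes
  \<open>pos c m\<close> the position of a zero as well.\<close>

lemma nth_code_word_end:
  assumes "t \<le> m"
  shows "(code_word c m @ [0]) ! pos c t = 0"
proof (cases "t = m")
  case True
  then show ?thesis by (simp add: nth_append)
next
  case False
  with assms have t: "t < m" by simp
  then have "pos c t < pos c m" by (rule pos_strict_mono)
  then show ?thesis using nth_code_word[of t m 0 c] t by (simp add: nth_append)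
qed

lemma nth_code_word_one:
  assumes "t < m" "0 < d" "d \<le> c t"
  shows "(code_word c m @ [0]) ! (pos c t + d) = 1"
proof -
  have "pos c t + d < pos c m"
    using pos_mono[of "Suc t" m c] assms by (simp add: pos_Suc)
  then show ?thesis using nth_code_word[of t m d c] assms by (simp add: nth_append)
qed

lemma code_word_cong: "(\<And>k. k < m \<Longrightarrow> c k = c' k) \<Longrightarrow> code_word c m = code_word c' m"
  unfolding code_word_def by (intro arg_cong[where f = concat] map_cong) auto

lemma code_word_add: "code_word c (m + n) = code_word c m @ code_word (\<lambda>k. c (m + k)) n"
  by (induction n) (auto simp: code_word_Suc, simp add: code_word_def)

text \<open>The number of zeros in \<open>gen_word q a n\<close>; the prescribed spacers of level
  \<open>n\<close> repeat modulo this number.\<close>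

definition zeros :: "(nat \<Rightarrow> nat) \<Rightarrow> nat \<Rightarrow> nat" where
  "zeros q n = (\<Prod>j<n. Suc (q j))"

text \<open>\<open>spacers q a n k\<close>, for \<open>k < zeros q n - 1\<close>, is the number of ones following the
  \<open>k\<close>-th zero of the \<open>n\<close>-th generating word.\<close>

primrec spacers :: "(nat \<Rightarrow> nat) \<Rightarrow> (nat \<Rightarrow> nat \<Rightarrow> nat) \<Rightarrow> nat \<Rightarrow> nat \<Rightarrow> nat" where
  "spacers q a 0 k = 0"
| "spacers q a (Suc n) k =
     (if Suc k mod zeros q n = 0 then a n (k div zeros q n) else spacers q a n (k mod zeros q n))"

lemma zeros_pos: "0 < zeros q n"
  by (simp add: zeros_def prod_pos)

lemma zeros_Suc: "zeros q (Suc n) = zeros q n * Suc (q n)"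
  by (simp add: zeros_def)

lemma zeros_dvd: "n \<le> N \<Longrightarrow> zeros q n dvd zeros q N"
  by (induction N rule: dec_induct) (auto simp: zeros_Suc)

lemma gen_word_eq_code_word:
  "gen_word q a n = code_word (spacers q a n) (zeros q n - 1) @ [0]"
proof (induction n)
  case 0
  then show ?case by (simp add: code_word_def zeros_def)
next
  case (Suc n)
  let ?Z = "zeros q n" and ?s = "spacers q a (Suc n)"
  obtain M where M: "?Z = Suc M" using zeros_pos[of q n] by (cases ?Z) auto
  have s1: "?s (t * ?Z + k) = spacers q a n k" if "k < M" for t k
  proof -
    have "Suc (t * ?Z + k) mod ?Z = Suc k"
      using that M by (metis Suc_less_eq add_Suc_right mod_less mod_mult_self3)
    moreover have "(t * ?Z + k) mod ?Z = k"
      by (simp only: mod_mult_self3) (simp add: M that less_SucI)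
    ultimately show ?thesis by simp
  qed
  have s2: "?s (t * ?Z + M) = a n t" for t
  proof -
    have "Suc (t * ?Z + M) = (t + 1) * ?Z" using M by simp
    then have "Suc (t * ?Z + M) mod ?Z = 0" by (metis mod_mult_self2_is_0)
    moreover have "(t * ?Z + M) div ?Z = t" by (subst div_mult_self3) (simp_all add: M)
    ultimately show ?thesis by simp
  qed
  have w: "gen_word q a n = code_word (spacers q a n) M @ [0]" using Suc.IH M by simp
  have c: "code_word (\<lambda>k. ?s (t * ?Z + k)) M = code_word (spacers q a n) M" for t
    by (rule code_word_cong) (rule s1)
  \<comment> \<open>The zeros are grouped in runs of \<open>?Z\<close>: the first \<open>M\<close>
    spacers of a run are those of level \<open>n\<close>, the last one is
    \<open>a n t\<close>.\<close>
  have step: "code_word ?s (t * ?Z) = concat (map (\<lambda>i. gen_word q a n @ replicate (a n i) 1) [0..<t])" for t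
  proof (induction t)
    case 0
    then show ?case by (simp add: code_word_def)
  next
    case (Suc t)
    have "Suc t * ?Z = Suc (t * ?Z + M)" using M by simp
    then have "code_word ?s (Suc t * ?Z) = code_word ?s (t * ?Z + M) @ 0 # replicate (a n t) 1"
      by (simp only: code_word_Suc s2)
    also have "\<dots> = code_word ?s (t * ?Z) @ gen_word q a n @ replicate (a n t) 1"
      by (simp only: code_word_add c w) simp
    finally show ?case using Suc.IH by (simp del: spacers.simps mult_Suc)
  qed
  have "zeros q (Suc n) - 1 = q n * ?Z + M" using M by (simp add: zeros_Suc)
  then have "code_word ?s (zeros q (Suc n) - 1) @ [0] = code_word ?s (q n * ?Z) @ gen_word q a n"
    by (simp only: code_word_add c w) simp
  then show ?case by (simp only: step gen_word.simps)
qed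

lemma length_gen_word: "length (gen_word q a n) = Suc (pos (spacers q a n) (zeros q n - 1))"
  by (simp add: gen_word_eq_code_word)

lemma sublist_gen_word: "n \<le> N \<Longrightarrow> sublist (gen_word q a n) (gen_word q a N)"
proof (induction N rule: dec_induct)
  case (step N)
  have "sublist (gen_word q a N) (gen_word q a (Suc N))" by simp
  with step show ?case using sublist_order.order.trans by blast
qed simp

lemma mod_eq_last_iff:
  assumes "0 < (z::nat)"
  shows "k mod z = z - 1 \<longleftrightarrow> Suc k mod z = 0"
  using assms by (simp add: mod_Suc) linarith

text \<open>The Toeplitz pattern of level \<open>n\<close>: every residue \<open>t\<close> modulo
  \<open>zeros q n\<close> prescribes its spacer, except the last, which is a hole open to all
  letters of \<open>alph q a (Suc n)\<close>.\<close>

definition good :: "(nat \<Rightarrow> nat) \<Rightarrow> (nat \<Rightarrow> nat \<Rightarrow> nat) \<Rightarrow> nat \<Rightarrow> nat \<Rightarrow> nat \<Rightarrow> bool" where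
  "good q a n t v \<longleftrightarrow> (if t = zeros q n - 1 then v \<in> alph q a (Suc n) else v = spacers q a n t)"

lemma alph_Suc: "alph q a (Suc n) = {a N i | N i. N \<ge> n \<and> i < q N}"
  by (simp add: alph_def)

lemma div_less_q:
  assumes "t < zeros q (Suc n) - 1"
  shows "Suc t mod zeros q n = 0 \<Longrightarrow> t div zeros q n < q n"
proof -
  assume "Suc t mod zeros q n = 0"
  then obtain j where j: "Suc t = zeros q n * j" by auto
  with assms have "zeros q n * j < zeros q n * Suc (q n)" by (simp add: zeros_Suc)
  then have "j < Suc (q n)" by (simp only: nat_mult_less_cancel1[OF zeros_pos])
  then have "j \<le> q n" by simp
  have "t < zeros q n * j" using j by simp
  then have "t div zeros q n < j" by (simp add: less_mult_imp_div_less mult.commute)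
  with \<open>j \<le> q n\<close> show ?thesis by simp
qed

lemma good_spacers:
  assumes "n \<le> N" "t < zeros q N - 1"
  shows "good q a n (t mod zeros q n) (spacers q a N t)"
  using assms
proof (induction N arbitrary: t rule: dec_induct)
  case base
  then show ?case by (simp add: good_def)
next
  case (step N)
  have d: "zeros q n dvd zeros q N" using step zeros_dvd by simp
  show ?case
  proof (cases "Suc t mod zeros q N = 0")
    case True
    then have "Suc t mod zeros q n = 0" using d by (meson dvd_trans mod_eq_0_iff_dvd)
    then have "t mod zeros q n = zeros q n - 1" using mod_eq_last_iff[OF zeros_pos[of q n], of t] by simp
    moreover have "a N (t div zeros q N) \<in> alph q a (Suc n)"
      using div_less_q[OF step.prems(1) True] step by (auto simp: alph_Suc)
    ultimately show ?thesis using True by (simp add: good_def)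
  next
    case False
    then have "t mod zeros q N < zeros q N - 1"
      using mod_eq_last_iff[OF zeros_pos, of t q N] mod_less_divisor[OF zeros_pos, of t q N] by linarith
    from step.IH[OF this] show ?thesis using False d by (simp add: mod_mod_cancel)
  qed
qed

section \<open>Coding a sequence by the gaps between its zeros\<close>

text \<open>The numbering of the zeros has no distinguished origin: it can be shifted, and it is
  fixed once the zero numbered 0 is chosen (\<open>coding_unique\<close>).\<close>

definition coding :: "(int \<Rightarrow> nat) \<Rightarrow> (int \<Rightarrow> int) \<Rightarrow> (int \<Rightarrow> nat) \<Rightarrow> bool" where
  "coding x p y \<longleftrightarrow> (\<forall>k. x (p k) = 0 \<and> p (k + 1) = p k + 1 + int (y k) \<and>
     (\<forall>i. p k < i \<and> i < p (k + 1) \<longrightarrow> x i = 1))"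

lemma coding_zero: "coding x p y \<Longrightarrow> x (p k) = 0"
  and coding_Suc: "coding x p y \<Longrightarrow> p (k + 1) = p k + 1 + int (y k)"
  and coding_one: "coding x p y \<Longrightarrow> p k < i \<Longrightarrow> i < p (k + 1) \<Longrightarrow> x i = 1"
  by (auto simp: coding_def)

lemma coding_growth: "coding x p y \<Longrightarrow> p k + int n \<le> p (k + int n)"
proof (induction n)
  case (Suc n)
  have "p (k + int (Suc n)) = p (k + int n + 1)" by (simp add: add.commute add.left_commute)
  with coding_Suc[OF Suc.prems, of "k + int n"] Suc show ?case by simp
qed simp

lemma coding_less: "coding x p y \<Longrightarrow> k < l \<Longrightarrow> p k < p l"
  using coding_growth[of x p y k "nat (l - k)"] by simp

lemma coding_le: "coding x p y \<Longrightarrow> k \<le> l \<Longrightarrow> p k \<le> p l"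
  using coding_less[of x p y k l] by (cases "k = l") auto

lemma coding_cover:
  assumes "coding x p y"
  obtains k where "p k \<le> i" "i < p (k + 1)"
proof -
  \<comment> \<open>Consecutive zeros are at least 1 apart, so this far back in the numbering the
    zero lies at or to the left of \<open>i\<close>.\<close>
  define k0 where "k0 = - \<bar>i - p 0\<bar>"
  have lo: "p k0 \<le> i"
    using coding_growth[OF assms, of k0 "nat \<bar>i - p 0\<bar>"] by (simp add: k0_def)
  have hi: "i < p (k0 + int (nat (i - p k0 + 1)))"
    using coding_growth[OF assms, of k0 "nat (i - p k0 + 1)"] lo by simp
  define n where "n = (LEAST n. i < p (k0 + int n))"
  have n: "i < p (k0 + int n)" unfolding n_def using hi by (rule LeastI)
  then have "n \<noteq> 0" using lo by (intro notI) simp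
  then obtain m where m: "n = Suc m" by (cases n) auto
  have "\<not> i < p (k0 + int m)"
  proof
    assume "i < p (k0 + int m)"
    then have "n \<le> m" unfolding n_def by (rule Least_le)
    with m show False by simp
  qed
  moreover have "k0 + int m + 1 = k0 + int n" using m by simp
  with n have "i < p (k0 + int m + 1)" by metis
  ultimately show thesis by (intro that[of "k0 + int m"]) auto
qed

lemma coding_zero_iff:
  assumes "coding x p y"
  shows "x i = 0 \<longleftrightarrow> i \<in> range p"
proof
  assume i: "x i = 0"
  obtain k where k: "p k \<le> i" "i < p (k + 1)" using coding_cover[OF assms] by blast
  then have "i = p k" using coding_one[OF assms, of k i] i by (cases "p k = i") auto
  then show "i \<in> range p" by simp
qed (auto simp: coding_zero[OF assms])

lemma coding_shift: "coding x p y \<Longrightarrow> coding x (\<lambda>k. p (k + j)) (\<lambda>k. y (k + j))"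
  unfolding coding_def
proof
  fix k
  assume a: "\<forall>k. x (p k) = 0 \<and> p (k + 1) = p k + 1 + int (y k) \<and> (\<forall>i. p k < i \<and> i < p (k + 1) \<longrightarrow> x i = 1)"
  have "k + 1 + j = k + j + 1" by simp
  then show "x (p (k + j)) = 0 \<and> p (k + 1 + j) = p (k + j) + 1 + int (y (k + j)) \<and>
         (\<forall>i. p (k + j) < i \<and> i < p (k + 1 + j) \<longrightarrow> x i = 1)"
    using a[rule_format, of "k + j"] by metis
qed

lemma coding_sh: "coding x p y \<Longrightarrow> coding (sh j x) (\<lambda>k. p k - j) y"
  unfolding coding_def sh_def by (simp add: less_diff_eq diff_less_eq)

text \<open>If the next zeros differed, the smaller one would be a zero of one sequence inside a run
  of ones of the other, although the sequences agree up to \<open>p (k + 1)\<close>.\<close>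

lemma coding_step:
  assumes "coding x p y" "coding x' p' y'" "p k = p' k'"
    and "\<And>i. p k \<le> i \<Longrightarrow> i \<le> p (k + 1) \<Longrightarrow> x i = x' i"
  shows "p (k + 1) = p' (k' + 1)"
proof (rule ccontr)
  assume "p (k + 1) \<noteq> p' (k' + 1)"
  then consider "p (k + 1) < p' (k' + 1)" | "p' (k' + 1) < p (k + 1)" by linarith
  then show False
  proof cases
    case 1
    have "p k < p (k + 1)" using coding_less[OF assms(1)] by simp
    with 1 have "x' (p (k + 1)) = 1" using assms(3) by (intro coding_one[OF assms(2)]) auto
    then show False using assms(4)[of "p (k + 1)"] coding_zero[OF assms(1)] \<open>p k < p (k + 1)\<close> by simp
  next
    case 2
    have "p' k' < p' (k' + 1)" using coding_less[OF assms(2)] by simp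
    with 2 have "x (p' (k' + 1)) = 1" using assms(3) by (intro coding_one[OF assms(1)]) auto
    then show False
      using assms(4)[of "p' (k' + 1)"] coding_zero[OF assms(2)] \<open>p' k' < p' (k' + 1)\<close> assms(3) 2 by simp
  qed
qed

lemma coding_step_back:
  assumes "coding x p y" "coding x' p' y'" "p k = p' k'"
    and "\<And>i. p (k - 1) \<le> i \<Longrightarrow> i \<le> p k \<Longrightarrow> x i = x' i"
  shows "p (k - 1) = p' (k' - 1)"
proof (rule ccontr)
  have l: "p (k - 1) < p k" "p' (k' - 1) < p' k'"
    using coding_less[OF assms(1)] coding_less[OF assms(2)] by simp_all
  assume "p (k - 1) \<noteq> p' (k' - 1)"
  then consider "p (k - 1) < p' (k' - 1)" | "p' (k' - 1) < p (k - 1)" by linarith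
  then show False
  proof cases
    case 1
    have "x (p' (k' - 1)) = 1" using coding_one[OF assms(1), of "k - 1"] 1 l assms(3) by simp
    then show False
      using assms(4)[of "p' (k' - 1)"] coding_zero[OF assms(2), of "k' - 1"] 1 l assms(3) by simp
  next
    case 2
    have "x' (p (k - 1)) = 1" using coding_one[OF assms(2), of "k' - 1"] 2 l assms(3) by simp
    then show False
      using assms(4)[of "p (k - 1)"] coding_zero[OF assms(1), of "k - 1"] 2 l by simp
  qed
qed

lemma coding_local:
  assumes "coding x p y" "coding x' p' y'" "p 0 = p' 0"
    and "\<And>i. p (- int m) \<le> i \<Longrightarrow> i \<le> p (int m) \<Longrightarrow> x i = x' i"
  shows "n \<le> m \<Longrightarrow> p (int n) = p' (int n) \<and> p (- int n) = p' (- int n)"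
proof (induction n)
  case 0
  then show ?case using assms(3) by simp
next
  case (Suc n)
  then have IH: "p (int n) = p' (int n)" "p (- int n) = p' (- int n)" by auto
  have "p (int n + 1) = p' (int n + 1)"
  proof (rule coding_step[OF assms(1,2) IH(1)])
    fix i assume i: "p (int n) \<le> i" "i \<le> p (int n + 1)"
    have "p (- int m) \<le> p (int n)" "p (int n + 1) \<le> p (int m)"
      using Suc.prems by (auto intro: coding_le[OF assms(1)])
    with i show "x i = x' i" by (intro assms(4)) auto
  qed
  moreover have "p (- int n - 1) = p' (- int n - 1)"
  proof (rule coding_step_back[OF assms(1,2) IH(2)])
    fix i assume i: "p (- int n - 1) \<le> i" "i \<le> p (- int n)"
    have "p (- int m) \<le> p (- int n - 1)" "p (- int n) \<le> p (int m)"
      using Suc.prems by (auto intro: coding_le[OF assms(1)])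
    with i show "x i = x' i" by (intro assms(4)) auto
  qed
  moreover have "int (Suc n) = int n + 1" "- int (Suc n) = - int n - 1" by simp_all
  ultimately show ?case by metis
qed

lemma coding_local':
  assumes "coding x p y" "coding x' p' y'" "p 0 = p' 0"
    and "\<And>i. p (- int m) \<le> i \<Longrightarrow> i \<le> p (int m) \<Longrightarrow> x i = x' i"
    and "\<bar>k\<bar> < int m"
  shows "p k = p' k \<and> y k = y' k"
proof -
  have *: "p j = p' j" if "\<bar>j\<bar> \<le> int m" for j
  proof -
    have "nat \<bar>j\<bar> \<le> m" using that by simp
    from coding_local[OF assms(1-4) this] show ?thesis by (cases "j \<ge> 0") auto
  qed
  have "p k = p' k" "p (k + 1) = p' (k + 1)" using *[of k] *[of "k + 1"] assms(5) by auto
  then show ?thesis using coding_Suc[OF assms(1), of k] coding_Suc[OF assms(2), of k] by simp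
qed

lemma coding_unique:
  assumes "coding x p y" "coding x p' y'" "p 0 = p' 0"
  shows "p = p'" "y = y'"
proof -
  have "p k = p' k \<and> y k = y' k" for k
    by (rule coding_local'[OF assms, of "nat \<bar>k\<bar> + 1"]) auto
  then show "p = p'" "y = y'" by auto
qed

lemma coding_exists:
  assumes bin: "\<And>i. x i = 0 \<or> x i = (1::nat)"
    and ex: "\<And>i. \<exists>d\<ge>0. x (i + d) = 0" "\<And>i. \<exists>d\<ge>0. x (i - d) = 0"
    and i0: "x i0 = 0"
  obtains p y where "coding x p y" "p 0 = i0"
proof -
  define up where "up i = (LEAST d::nat. x (i + 1 + int d) = 0)" for i
  define dn where "dn i = (LEAST d::nat. x (i - 1 - int d) = 0)" for i
  define nxt where "nxt i = i + 1 + int (up i)" for i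
  define prv where "prv i = i - 1 - int (dn i)" for i
  have exup: "\<exists>d::nat. x (i + 1 + int d) = 0" for i
    using ex(1)[of "i + 1"] by (metis nonneg_int_cases)
  have exdn: "\<exists>d::nat. x (i - 1 - int d) = 0" for i
    using ex(2)[of "i - 1"] by (metis nonneg_int_cases)
  have nxt0: "x (nxt i) = 0" for i
    unfolding nxt_def up_def using exup by (rule LeastI_ex)
  have prv0: "x (prv i) = 0" for i
    unfolding prv_def dn_def using exdn by (rule LeastI_ex)
  have nxt1: "x j = 1" if "i < j" "j < nxt i" for i j
  proof -
    have "nat (j - i - 1) < up i" using that by (simp add: nxt_def)
    then have "x (i + 1 + int (nat (j - i - 1))) \<noteq> 0" unfolding up_def by (rule not_less_Least)
    then show ?thesis using that bin[of j] by simp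
  qed
  have prv1: "x j = 1" if "prv i < j" "j < i" for i j
  proof -
    have "nat (i - 1 - j) < dn i" using that by (simp add: prv_def)
    then have "x (i - 1 - int (nat (i - 1 - j))) \<noteq> 0" unfolding dn_def by (rule not_less_Least)
    then show ?thesis using that bin[of j] by simp
  qed
  \<comment> \<open>\<open>coding\<close> is stated by forward steps only, so to the left of
    \<open>i0\<close> each step of \<open>prv\<close> has to be undone by
    \<open>nxt\<close>.\<close>
  have nxt_prv: "nxt (prv z) = z" if z: "x z = 0" for z
  proof -
    have "prv z < z" by (simp add: prv_def)
    moreover have "prv z < nxt (prv z)" by (simp add: nxt_def)
    ultimately show ?thesis
      using nxt1[of "prv z" z] prv1[of z "nxt (prv z)"] z nxt0[of "prv z"]
      by (metis linorder_neqE zero_neq_one)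
  qed
  define p where "p k = (if k \<ge> 0 then (nxt ^^ nat k) i0 else (prv ^^ nat (- k)) i0)" for k
  have p0: "x (p k) = 0" for k
  proof -
    have "x ((nxt ^^ n) i0) = 0" "x ((prv ^^ n) i0) = 0" for n
      by (cases n; simp add: i0 nxt0 prv0)+
    then show ?thesis by (simp add: p_def)
  qed
  have pS: "p (k + 1) = nxt (p k)" for k
  proof (cases "k \<ge> 0")
    case True
    then show ?thesis by (simp add: p_def nat_add_distrib)
  next
    case False
    then obtain n where n: "nat (- k) = Suc n" by (cases "nat (- k)") auto
    then have "nat (- (k + 1)) = n" by simp
    then have e: "p (k + 1) = (prv ^^ n) i0"
      using False n by (cases n) (auto simp: p_def)
    have "p k = prv (p (k + 1))" using False n e by (simp add: p_def)
    then show ?thesis using nxt_prv[OF p0] by simp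
  qed
  have "coding x p (\<lambda>k. up (p k))"
    unfolding coding_def using p0 pS nxt1 by (auto simp: nxt_def)
  moreover have "p 0 = i0" by (simp add: p_def)
  ultimately show thesis by (rule that)
qed

section \<open>Parsing the points of a Ferenczi subshift\<close>

locale ferenczi =
  fixes q :: "nat \<Rightarrow> nat" and a :: "nat \<Rightarrow> nat \<Rightarrow> nat"
  assumes standard: "standard_params q"
    and bounded: "bounded_spacers q a"
    and aperiodic: "aperiodic_subshift (ferenczi_subshift q a)"
begin

abbreviation "X \<equiv> ferenczi_subshift q a"
abbreviation "Z \<equiv> zeros q"
abbreviation "sp \<equiv> spacers q a"
abbreviation "w \<equiv> gen_word q a"
abbreviation "h n \<equiv> length (w n)"
abbreviation "gd \<equiv> good q a"

lemma q_ge_2: "2 \<le> q n"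
  using standard by (simp add: standard_params_def)

lemma binary: "x \<in> X \<Longrightarrow> x i = 0 \<or> x i = 1"
  by (auto simp: ferenczi_subshift_def dest: range_subsetD[of _ _ i])

lemma Z_gt: "n < Z n"
proof (induction n)
  case 0
  then show ?case by (simp add: zeros_def)
next
  case (Suc n)
  have "Suc n * 2 \<le> Z n * Suc (q n)" using Suc q_ge_2[of n] by (intro mult_mono) auto
  then show ?case by (simp add: zeros_Suc)
qed

text \<open>A crude bound, used to make blocks longer than a given window.\<close>

lemma h_gt: "n < h n"
  using le_pos[of "Z n - 1" "sp n"] Z_gt[of n] by (simp add: length_gen_word)

lemma alph_bounded: obtains K where "\<And>n c. c \<in> alph q a (Suc n) \<Longrightarrow> c \<le> K"
  using bounded unfolding bounded_spacers_def alph_Suc by blast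

lemma spacers_bounded: obtains K where "\<And>n k. k < Z n - 1 \<Longrightarrow> sp n k \<le> K"
proof -
  obtain K where K: "\<And>n c. c \<in> alph q a (Suc n) \<Longrightarrow> c \<le> K" using alph_bounded by blast
  have "sp n k \<le> K" if "k < Z n - 1" for n k
  proof -
    \<comment> \<open>A block of level 0 has a single zero, so every position is a hole and
      \<open>gd 0\<close> says no more than membership in the alphabet.\<close>
    have "gd 0 (k mod Z 0) (sp n k)" by (rule good_spacers) (use that in auto)
    then have "sp n k \<in> alph q a (Suc 0)" by (simp add: good_def zeros_def)
    then show ?thesis by (rule K)
  qed
  then show thesis by (rule that)
qed

lemma zeros_syndetic:
  obtains K where "\<And>x i. x \<in> X \<Longrightarrow> \<exists>j. i \<le> j \<and> j \<le> i + int K \<and> x j = 0"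
proof -
  obtain K where K: "\<And>n k. k < Z n - 1 \<Longrightarrow> sp n k \<le> K" using spacers_bounded by blast
  have "\<exists>j. i \<le> j \<and> j \<le> i + int K \<and> x j = 0" if x: "x \<in> X" for x i
  proof (rule ccontr)
    assume "\<nexists>j. i \<le> j \<and> j \<le> i + int K \<and> x j = 0"
    then have one: "x j = 1" if "i \<le> j" "j \<le> i + int K" for j using binary[OF x, of j] that by auto
    have "factor_of (map x [i..i + int K]) x" unfolding factor_of_def by blast
    then obtain n where "sublist (map x [i..i + int K]) (w n)" using x by (auto simp: ferenczi_subshift_def)
    then obtain ps ss where e: "w n = ps @ map x [i..i + int K] @ ss" by (auto simp: sublist_def)
    define j where "j = length ps"
    have one': "w n ! (j + d) = 1" if "d \<le> K" for d
    proof -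
      have "d < nat (int K + 1)" using that by linarith
      then show ?thesis using that by (simp add: e j_def nth_append one)
    qed
    have len: "j + K < h n" by (simp add: e j_def)
    let ?m = "Z n - 1"
    have wn: "w n = code_word (sp n) ?m @ [0]" by (rule gen_word_eq_code_word)
    have "h n = Suc (pos (sp n) ?m)" by (rule length_gen_word)
    have "j \<noteq> pos (sp n) ?m" using one'[of 0] nth_code_word_end[of ?m ?m "sp n"] by (auto simp: wn)
    with len have "j < pos (sp n) ?m" by (simp add: length_gen_word)
    from pos_cover[OF this] obtain t d where t: "t < ?m" "d \<le> sp n t" "j = pos (sp n) t + d" by blast
    \<comment> \<open>The distance from \<open>j\<close> to the next zero. As \<open>j\<close> is
      not a zero itself, this is at most the length of the run of ones, hence at most
      \<open>K\<close>; but the window has ones up to distance \<open>K\<close>.\<close>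
    define e where "e = pos (sp n) (Suc t) - j"
    have "pos (sp n) (Suc t) = j + e" using t by (simp add: e_def pos_Suc)
    moreover have "d \<noteq> 0"
    proof
      assume "d = 0"
      then have "w n ! j = 0" using nth_code_word_end[of t ?m "sp n"] t by (simp add: wn)
      with one'[of 0] show False by simp
    qed
    then have "e \<le> K" using t K[OF t(1)] by (simp add: e_def pos_Suc)
    ultimately show False
      using one'[of e] nth_code_word_end[of "Suc t" ?m "sp n"] t by (simp add: wn)
  qed
  then show thesis by (rule that)
qed

lemma ex_coding:
  assumes "x \<in> X" "x i = 0"
  obtains p y where "coding x p y" "p 0 = i"
proof -
  obtain K where K: "\<And>x i. x \<in> X \<Longrightarrow> \<exists>j. i \<le> j \<and> j \<le> i + int K \<and> x j = 0"
    using zeros_syndetic by blast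
  show thesis
  proof (rule coding_exists[of x i])
    fix i
    from K[OF assms(1), of i] obtain j where "i \<le> j" "x j = 0" by blast
    then show "\<exists>d\<ge>0. x (i + d) = 0" by (intro exI[of _ "j - i"]) auto
    from K[OF assms(1), of "i - int K"] obtain j where "j \<le> i" "x j = 0" by auto
    then show "\<exists>d\<ge>0. x (i - d) = 0" by (intro exI[of _ "i - j"]) auto
  qed (use assms binary that in auto)
qed

lemma ex_coding':
  assumes "x \<in> X"
  obtains p y where "coding x p y"
  using zeros_syndetic ex_coding[OF assms] assms by metis

text \<open>The factor between two zeros occurs in some generating word and in all later ones, so
  \<open>N\<close> can be taken large. Its first letter is a zero, hence the occurrence begins at a
  zero of \<open>w N\<close>, and from there the runs of ones are compared one by one.\<close>

lemma window:
  assumes x: "x \<in> X" and c: "coding x p y"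
  obtains N t0 where "n \<le> N" "t0 + L \<le> Z N - 1" "\<And>k. k < L \<Longrightarrow> y (k0 + int k) = sp N (t0 + k)"
proof -
  let ?u = "map x [p k0..p (k0 + int L)]"
  have "factor_of ?u x" unfolding factor_of_def by blast
  then obtain N' where "sublist ?u (w N')" using x by (auto simp: ferenczi_subshift_def)
  then have "sublist ?u (w (max n N'))"
    using sublist_gen_word[of N' "max n N'" q a] sublist_order.order.trans by (metis max.cobounded2)
  then obtain ps ss where e: "w (max n N') = ps @ ?u @ ss" by (auto simp: sublist_def)
  define N where "N = max n N'"
  define j where "j = length ps"
  let ?m = "Z N - 1" and ?P = "pos (sp N)"
  have wn: "w N = code_word (sp N) ?m @ [0]" by (rule gen_word_eq_code_word)
  have val: "w N ! (j + d) = x (p k0 + int d)" and len: "j + d \<le> ?P ?m"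
    if "p k0 + int d \<le> p (k0 + int L)" for d
  proof -
    have "d < nat (p (k0 + int L) - p k0 + 1)" using that by linarith
    then show "w N ! (j + d) = x (p k0 + int d)"
      by (simp add: j_def nth_append e[unfolded N_def[symmetric]])
    have "j + d < h N" using that by (simp add: e[unfolded N_def[symmetric]] j_def)
    then show "j + d \<le> ?P ?m" by (simp add: length_gen_word)
  qed
  have le: "p k0 \<le> p (k0 + int L)" by (rule coding_le[OF c]) simp
  have "\<exists>t0\<le>?m. j = ?P t0"
  proof (cases "j = ?P ?m")
    case False
    with len[of 0] le have "j < ?P ?m" by simp
    from pos_cover[OF this] obtain t d where t: "t < ?m" "d \<le> sp N t" "j = ?P t + d" by blast
    have "d = 0"
    proof (rule ccontr)
      assume "d \<noteq> 0"
      then have "w N ! j = 1" using nth_code_word_one[of t ?m d "sp N"] t by (simp add: wn)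
      then show False using val[of 0] le coding_zero[OF c, of k0] by simp
    qed
    with t show ?thesis by (intro exI[of _ t]) simp
  qed auto
  then obtain t0 where t0: "t0 \<le> ?m" "j = ?P t0" by blast
  have main: "k \<le> L \<Longrightarrow> t0 + k \<le> ?m \<and> p k0 + int (?P (t0 + k)) = p (k0 + int k) + int j \<and>
      (\<forall>k'<k. y (k0 + int k') = sp N (t0 + k'))" for k
  proof (induction k)
    case 0
    then show ?case using t0 by simp
  next
    case (Suc k)
    let ?t = "t0 + k" and ?v = "y (k0 + int k)"
    from Suc have IH: "?t \<le> ?m" "p k0 + int (?P ?t) = p (k0 + int k) + int j"
      "\<forall>k'<k. y (k0 + int k') = sp N (t0 + k')" by auto
    have s: "p (k0 + int k + 1) = p (k0 + int k) + 1 + int ?v" by (rule coding_Suc[OF c])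
    have jP: "j \<le> ?P ?t" using t0 pos_mono[of t0 ?t "sp N"] by simp
    have up: "p (k0 + int k + 1) \<le> p (k0 + int L)" using Suc.prems by (intro coding_le[OF c]) auto
    define d where "d = ?P ?t - j"
    have pd: "p (k0 + int k) = p k0 + int d" using IH(2) jP by (simp add: d_def)
    have jd: "j + d = ?P ?t" using jP by (simp add: d_def)
    have val': "w N ! (?P ?t + e) = x (p (k0 + int k) + int e)" if "e \<le> Suc ?v" for e
      using val[of "d + e"] that up s by (simp add: pd jd[symmetric] add.assoc)
    \<comment> \<open>The zero that ends the run still lies in \<open>w N\<close>, so zero number
      \<open>?t\<close> of \<open>w N\<close> is not its last one and has a spacer.\<close>
    have "?P ?t + Suc ?v \<le> ?P ?m" using len[of "d + Suc ?v"] up s by (simp add: pd jd[symmetric])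
    then have tm: "?t < ?m" using IH(1) by (cases "?t = ?m") auto
    have "sp N ?t = ?v"
    proof (rule ccontr)
      assume "sp N ?t \<noteq> ?v"
      then consider "sp N ?t < ?v" | "?v < sp N ?t" by linarith
      then show False
      proof cases
        case 1
        have "w N ! (?P ?t + Suc (sp N ?t)) = 0"
          using nth_code_word_end[of "Suc ?t" ?m "sp N"] tm by (simp add: wn pos_Suc)
        moreover have "x (p (k0 + int k) + int (Suc (sp N ?t))) = 1"
          by (rule coding_one[OF c, of "k0 + int k"]) (use 1 s in auto)
        ultimately show False using val'[of "Suc (sp N ?t)"] 1 by simp
      next
        case 2
        have "w N ! (?P ?t + Suc ?v) = 1"
          using nth_code_word_one[of ?t ?m "Suc ?v" "sp N"] tm 2 by (simp add: wn)
        moreover have "x (p (k0 + int k) + int (Suc ?v)) = 0"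
          using coding_zero[OF c, of "k0 + int k + 1"] s by (simp add: algebra_simps)
        ultimately show False using val'[of "Suc ?v"] by simp
      qed
    qed
    moreover have "p (k0 + int (Suc k)) = p (k0 + int k + 1)" by (simp add: algebra_simps)
    ultimately show ?case using IH tm s by (auto simp: pos_Suc less_Suc_eq)
  qed
  show thesis
  proof (rule that[of N t0])
    show "n \<le> N" by (simp add: N_def)
    show "t0 + L \<le> Z N - 1" using main[of L] by simp
    show "y (k0 + int k) = sp N (t0 + k)" if "k < L" for k using main[of L] that by simp
  qed
qed

text \<open>\<open>s\<close> is a phase: the zeros numbered \<open>s\<close> modulo
  \<open>Z n\<close> begin the blocks of level \<open>n\<close>, and the holes are the spacers after
  the zeros numbered \<open>s - 1\<close> modulo \<open>Z n\<close>.\<close>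

definition struct :: "nat \<Rightarrow> int \<Rightarrow> (int \<Rightarrow> nat) \<Rightarrow> bool" where
  "struct n s y \<longleftrightarrow> (\<forall>k. gd n (nat ((k - s) mod int (Z n))) (y k))"

text \<open>Every finite window has a phase, inherited from its occurrence in a generating word. A
  phase for a window is one for all smaller windows, and there are only \<open>Z n\<close>
  candidates, so one of them serves all windows.\<close>

lemma ex_phase:
  assumes x: "x \<in> X" and c: "coding x p y"
  obtains s where "0 \<le> s" "s < int (Z n)" "struct n s y"
proof -
  define P where "P L s \<longleftrightarrow> (\<forall>k. - int L \<le> k \<and> k < int L \<longrightarrow> gd n (nat ((k - s) mod int (Z n))) (y k))" for L s
  have Zp: "0 < int (Z n)" using zeros_pos by simp
  have ex: "\<exists>s\<in>{0..<int (Z n)}. P L s" for L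
  proof -
    obtain N t0 where N: "n \<le> N" "t0 + 2 * L \<le> Z N - 1"
      "\<And>k. k < 2 * L \<Longrightarrow> y (- int L + int k) = sp N (t0 + k)"
      using window[OF x c, of n "2 * L" "- int L"] by metis
    \<comment> \<open>Zero number \<open>- int L\<close> of the point is zero number
      \<open>t0\<close> of \<open>w N\<close>, so the occurrence of \<open>w N\<close> would begin
      at zero number \<open>- int L - int t0\<close>.\<close>
    define s where "s = (- int L - int t0) mod int (Z n)"
    have "gd n (nat ((k - s) mod int (Z n))) (y k)" if k: "- int L \<le> k" "k < int L" for k
    proof -
      define d where "d = nat (k + int L)"
      have d: "d < 2 * L" "k = - int L + int d" using k by (auto simp: d_def)
      have "(k - s) mod int (Z n) = (int t0 + int d) mod int (Z n)"
        unfolding s_def mod_diff_right_eq by (simp add: d(2) add.commute)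
      then have "nat ((k - s) mod int (Z n)) = (t0 + d) mod Z n"
        by (metis nat_int of_nat_add of_nat_mod)
      moreover have "t0 + d < Z N - 1" using N(2) d(1) by simp
      ultimately show ?thesis using good_spacers[OF N(1), of "t0 + d" q a] N(3)[OF d(1)] d(2) by simp
    qed
    then have "P L s" by (simp add: P_def)
    moreover have "s \<in> {0..<int (Z n)}" using Zp by (simp add: s_def)
    ultimately show ?thesis by blast
  qed
  have anti: "P L' s \<Longrightarrow> L \<le> L' \<Longrightarrow> P L s" for L L' s by (auto simp: P_def)
  have "\<exists>s\<in>{0..<int (Z n)}. \<forall>L. P L s"
  proof (rule ccontr)
    assume "\<not> ?thesis"
    then have "\<forall>s\<in>{0..<int (Z n)}. \<exists>L. \<not> P L s" by blast
    then obtain l where l: "\<forall>s\<in>{0..<int (Z n)}. \<not> P (l s) s" by (rule bchoice[THEN exE])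
    have "finite (l ` {0..<int (Z n)})" by simp
    then obtain L where "\<forall>j\<in>l ` {0..<int (Z n)}. j \<le> L"
      unfolding finite_nat_set_iff_bounded_le by blast
    then have L: "\<And>s. s \<in> {0..<int (Z n)} \<Longrightarrow> l s \<le> L" by blast
    from ex[of L] obtain s where "s \<in> {0..<int (Z n)}" "P L s" by blast
    with anti L l show False by blast
  qed
  then obtain s where s: "0 \<le> s" "s < int (Z n)" "\<And>L. P L s" by auto
  have "struct n s y" unfolding struct_def
  proof
    fix k
    show "gd n (nat ((k - s) mod int (Z n))) (y k)"
      by (rule s(3)[of "nat \<bar>k\<bar> + 1", unfolded P_def, rule_format]) auto
  qed
  with s show thesis using that by blast
qed

text \<open>A spacer sequence with two different phases has no hole left, hence is periodic.\<close>

lemma phase_unique: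
  assumes x: "x \<in> X" and c: "coding x p y" and s: "struct n s y" "struct n s' y"
  shows "(s - s') mod int (Z n) = 0"
proof (rule ccontr)
  let ?Z = "int (Z n)"
  have Zp: "0 < ?Z" using zeros_pos by simp
  assume ne: "(s - s') mod ?Z \<noteq> 0"
  have per: "y (k + ?Z) = y k" if "struct n r y" "(k - r) mod ?Z \<noteq> ?Z - 1" for k r
  proof -
    have "k + ?Z - r = (k - r) + ?Z" by simp
    then have e: "(k + ?Z - r) mod ?Z = (k - r) mod ?Z" by (simp only: mod_add_self2)
    have ne: "nat ((k - r) mod ?Z) \<noteq> Z n - 1"
      using that(2) Zp pos_mod_sign[OF Zp, of "k - r"] by linarith
    have "gd n (nat ((k - r) mod ?Z)) (y k)" "gd n (nat ((k + ?Z - r) mod ?Z)) (y (k + ?Z))"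
      using that(1) unfolding struct_def by blast+
    then show ?thesis unfolding e good_def using ne by simp
  qed
  \<comment> \<open>A position that is a hole for both phases would force the phases to be
    congruent, so at each position one of the two prescribes the spacer.\<close>
  have yper: "y (k + ?Z) = y k" for k
  proof (cases "(k - s) mod ?Z = ?Z - 1")
    case True
    have "(k - s') mod ?Z \<noteq> ?Z - 1"
    proof
      assume "(k - s') mod ?Z = ?Z - 1"
      with True have "((k - s') - (k - s)) mod ?Z = 0" by (metis mod_eq_dvd_iff mod_eq_0_iff_dvd)
      with ne show False by simp
    qed
    then show ?thesis using per s(2) by blast
  qed (use per s(1) in blast)
  \<comment> \<open>The period \<open>?Z\<close> of the spacer sequence, counted in zeros, becomes
    the period \<open>D\<close> of \<open>x\<close>, counted in letters.\<close>
  define D where "D = p ?Z - p 0"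
  have pper: "p (k + ?Z) = p k + D" for k
  proof (induction k rule: int_induct[where k = 0])
    case base
    then show ?case by (simp add: D_def)
  next
    case (step1 i)
    have "p (i + 1 + ?Z) = p (i + ?Z) + 1 + int (y (i + ?Z))"
      using coding_Suc[OF c, of "i + ?Z"] by (simp add: algebra_simps)
    then show ?case using step1 coding_Suc[OF c, of i] yper[of i] by simp
  next
    case (step2 i)
    have "p (i + ?Z) = p (i - 1 + ?Z) + 1 + int (y (i - 1 + ?Z))"
      using coding_Suc[OF c, of "i - 1 + ?Z"] by (simp add: algebra_simps)
    then show ?case using step2 coding_Suc[OF c, of "i - 1"] yper[of "i - 1"] by simp
  qed
  have Dp: "0 < D" using coding_less[OF c, of 0 ?Z] Zp by (simp add: D_def)
  have "x (i + D) = x i" for i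
  proof -
    obtain k where k: "p k \<le> i" "i < p (k + 1)" using coding_cover[OF c] by blast
    show ?thesis
    proof (cases "i = p k")
      case True
      then show ?thesis using pper[of k] coding_zero[OF c] by metis
    next
      case False
      have "x (i + D) = 1"
        by (rule coding_one[OF c, of "k + ?Z"])
          (use False k pper[of k] pper[of "k + 1"] in \<open>auto simp: algebra_simps\<close>)
      moreover have "x i = 1" by (rule coding_one[OF c, of k]) (use False k in auto)
      ultimately show ?thesis by simp
    qed
  qed
  then have "(shift ^^ nat D) x = x" using Dp by (simp add: shift_funpow sh_def)
  moreover have "0 < nat D" using Dp by simp
  ultimately show False using aperiodic x by (auto simp: aperiodic_subshift_def)
qed

lemma struct_shift: "struct n s y \<Longrightarrow> struct n (s - j) (\<lambda>k. y (k + j))"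
  unfolding struct_def
proof
  fix k
  assume "\<forall>k. gd n (nat ((k - s) mod int (Z n))) (y k)"
  then have "gd n (nat ((k + j - s) mod int (Z n))) (y (k + j))" by blast
  moreover have "k + j - s = k - (s - j)" by simp
  ultimately show "gd n (nat ((k - (s - j)) mod int (Z n))) (y (k + j))" by simp
qed

lemma struct_mod: "struct n (s mod int (Z n)) y \<longleftrightarrow> struct n s y"
  by (simp add: struct_def mod_diff_right_eq)

lemma alph_mono: "n \<le> N \<Longrightarrow> alph q a (Suc N) \<subseteq> alph q a (Suc n)"
  by (auto simp: alph_Suc intro: le_trans)

text \<open>Prescribed spacers of level \<open>Suc n\<close> fit the pattern of level
  \<open>n\<close> by \<open>good_spacers\<close>; a hole of level \<open>Suc n\<close> lies over a
  hole of level \<open>n\<close>, and the alphabets decrease with the level.\<close>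

lemma struct_lower:
  assumes "struct (Suc n) s y"
  shows "struct n s y"
  unfolding struct_def
proof
  fix k
  define T where "T = nat ((k - s) mod int (Z (Suc n)))"
  have g: "gd (Suc n) T (y k)" using assms by (simp add: struct_def T_def)
  have d: "Z n dvd Z (Suc n)" by (simp add: zeros_Suc)
  have "int T = (k - s) mod int (Z (Suc n))" using zeros_pos[of q "Suc n"] by (simp add: T_def)
  then have "int (T mod Z n) = (k - s) mod int (Z n)"
    using d by (simp add: zmod_int mod_mod_cancel)
  then have T: "T mod Z n = nat ((k - s) mod int (Z n))" by linarith
  have "T < Z (Suc n)"
    using zeros_pos[of q "Suc n"] by (simp add: T_def nat_less_iff)
  show "gd n (nat ((k - s) mod int (Z n))) (y k)"
  proof (cases "T = Z (Suc n) - 1")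
    case True
    then have "Suc T mod Z n = 0" using zeros_pos[of q "Suc n"] by (simp add: zeros_Suc)
    then have "T mod Z n = Z n - 1" using mod_eq_last_iff[OF zeros_pos] by simp
    with g True T alph_mono[of n "Suc n"] show ?thesis by (auto simp: good_def)
  next
    case False
    with \<open>T < Z (Suc n)\<close> have "T < Z (Suc n) - 1" by simp
    from good_spacers[OF _ this, of n a] g False show ?thesis by (simp add: good_def T)
  qed
qed

end

section \<open>Cutting points and the decomposition into blocks of level \<open>n\<close>\<close>

context ferenczi
begin

text \<open>The coding numbered from the zero at \<open>i\<close> is unique, so this asks whether
  its phase is 0, that is, whether \<open>i\<close> begins a block of level
  \<open>n\<close>.\<close>

definition cut :: "nat \<Rightarrow> (int \<Rightarrow> nat) \<Rightarrow> int \<Rightarrow> bool" where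
  "cut n x i \<longleftrightarrow> (\<exists>p y. coding x p y \<and> p 0 = i \<and> struct n 0 y)"

text \<open>Meaningful at cutting points only: there it is the number of ones between
  \<open>w n\<close> and the next block.\<close>

definition spacer_at :: "nat \<Rightarrow> (int \<Rightarrow> nat) \<Rightarrow> int \<Rightarrow> nat" where
  "spacer_at n x i = (LEAST c. cut n x (i + int (h n) + int c))"

text \<open>\<open>P\<close> lists the first letters of the blocks and \<open>Y\<close> the spacers
  that fill the holes; the last zero of block \<open>t\<close> has number
  \<open>t * Z n + Z n - 1\<close>.\<close>

definition parse :: "nat \<Rightarrow> (int \<Rightarrow> nat) \<Rightarrow> (int \<Rightarrow> int) \<Rightarrow> (int \<Rightarrow> nat) \<Rightarrow> bool" where
  "parse n x P Y \<longleftrightarrow> (\<exists>p y. coding x p y \<and> struct n 0 y \<and>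
     P = (\<lambda>t. p (t * int (Z n))) \<and> Y = (\<lambda>t. y (t * int (Z n) + int (Z n) - 1)))"

lemma struct_good:
  assumes "struct n 0 y" "k < Z n"
  shows "gd n k (y (t * int (Z n) + int k))"
proof -
  have "(t * int (Z n) + int k - 0) mod int (Z n) = int k" using assms(2) by simp
  then show ?thesis using assms(1) unfolding struct_def by (metis nat_int)
qed

lemma block_pos:
  assumes "coding x p y" "struct n 0 y"
  shows "k \<le> Z n - 1 \<Longrightarrow> p (t * int (Z n) + int k) = p (t * int (Z n)) + int (pos (sp n) k)"
proof (induction k)
  case (Suc k)
  have "gd n k (y (t * int (Z n) + int k))" using Suc.prems by (intro struct_good[OF assms(2)]) auto
  then have "y (t * int (Z n) + int k) = sp n k" using Suc.prems by (auto simp: good_def)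
  moreover have "p (t * int (Z n) + int (Suc k)) = p (t * int (Z n) + int k + 1)" by (simp add: algebra_simps)
  ultimately show ?case using Suc coding_Suc[OF assms(1), of "t * int (Z n) + int k"] by (simp add: pos_Suc)
qed simp

lemma block_end: "t * int (Z n) + int (Z n) - 1 = t * int (Z n) + int (Z n - 1)"
  using zeros_pos[of q n] by simp

lemma parse_Suc:
  assumes "parse n x P Y"
  shows "P (t + 1) = P t + int (h n) + int (Y t)"
proof -
  obtain p y where p: "coding x p y" "struct n 0 y" and P: "P = (\<lambda>t. p (t * int (Z n)))"
    and Y: "Y = (\<lambda>t. y (t * int (Z n) + int (Z n) - 1))"
    using assms unfolding parse_def by blast
  have "(t + 1) * int (Z n) = t * int (Z n) + int (Z n - 1) + 1"
    using zeros_pos[of q n] by (simp add: algebra_simps)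
  then have "P (t + 1) = p (t * int (Z n) + int (Z n - 1)) + 1 + int (Y t)"
    unfolding P Y block_end using coding_Suc[OF p(1)] by metis
  then show ?thesis using block_pos[OF p, of "Z n - 1" t] by (simp add: P length_gen_word)
qed

lemma parse_less: "parse n x P Y \<Longrightarrow> s < t \<Longrightarrow> P s < P t"
  unfolding parse_def using coding_less zeros_pos[of q n] by fastforce

lemma parse_alph:
  assumes "parse n x P Y"
  shows "Y t \<in> alph q a (Suc n)"
proof -
  obtain p y where p: "coding x p y" "struct n 0 y"
    and Y: "Y = (\<lambda>t. y (t * int (Z n) + int (Z n) - 1))"
    using assms unfolding parse_def by blast
  have "gd n (Z n - 1) (Y t)"
    unfolding Y block_end by (rule struct_good[OF p(2)]) (use zeros_pos[of q n] in auto)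
  then show ?thesis by (simp add: good_def)
qed

lemma parse_word:
  assumes "parse n x P Y"
  shows "d < h n \<Longrightarrow> x (P t + int d) = w n ! d"
    and "h n \<le> d \<Longrightarrow> d < h n + Y t \<Longrightarrow> x (P t + int d) = 1"
proof -
  obtain p y where p: "coding x p y" "struct n 0 y" and P: "P = (\<lambda>t. p (t * int (Z n)))"
    and Y: "Y = (\<lambda>t. y (t * int (Z n) + int (Z n) - 1))"
    using assms unfolding parse_def by blast
  let ?m = "Z n - 1"
  have wn: "w n = code_word (sp n) ?m @ [0]" by (rule gen_word_eq_code_word)
  have lst: "p (t * int (Z n) + int ?m) = P t + int (pos (sp n) ?m)"
    using block_pos[OF p, of ?m t] by (simp add: P)
  {
    assume d: "d < h n"
    show "x (P t + int d) = w n ! d"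
    proof (cases "d = pos (sp n) ?m")
      case True
      then have "w n ! d = 0" unfolding wn by (simp add: nth_code_word_end)
      moreover have "x (P t + int d) = 0" using lst coding_zero[OF p(1)] True by metis
      ultimately show ?thesis by simp
    next
      case False
      with d have "d < pos (sp n) ?m" by (simp add: length_gen_word)
      from pos_cover[OF this] obtain k e where k: "k < ?m" "e \<le> sp n k" "d = pos (sp n) k + e" by blast
      have pk: "p (t * int (Z n) + int k) = P t + int (pos (sp n) k)"
        using block_pos[OF p, of k t] k by (simp add: P)
      have pk': "p (t * int (Z n) + int k + 1) = P t + int (pos (sp n) (Suc k))"
        using block_pos[OF p, of "Suc k" t] k by (simp add: P algebra_simps)
      show ?thesis
      proof (cases "e = 0")
        case True
        then have "w n ! d = 0" unfolding wn using nth_code_word_end[of k ?m] k by simp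
        moreover have "x (P t + int d) = 0" using pk coding_zero[OF p(1)] k True by (metis add_0_right)
        ultimately show ?thesis by simp
      next
        case False
        then have "w n ! d = 1" unfolding wn using nth_code_word_one[of k ?m e] k by simp
        moreover have "x (P t + int d) = 1"
          by (rule coding_one[OF p(1), of "t * int (Z n) + int k"]) (use pk pk' k False in \<open>auto simp: pos_Suc\<close>)
        ultimately show ?thesis by simp
      qed
    qed
  }
  {
    assume d: "h n \<le> d" "d < h n + Y t"
    have s: "p (t * int (Z n) + int ?m + 1) = P t + int (h n) + int (Y t)"
      using coding_Suc[OF p(1), of "t * int (Z n) + int ?m"] lst
      unfolding Y block_end by (simp add: length_gen_word)
    show "x (P t + int d) = 1"
      by (rule coding_one[OF p(1), of "t * int (Z n) + int ?m"]) (use s lst d in \<open>auto simp: length_gen_word\<close>)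
  }
qed

text \<open>Renumbering from zero \<open>j\<close> turns the phase \<open>s\<close> into
  \<open>s - j\<close>; since phases are unique modulo \<open>Z n\<close>, 0 is a phase only if it
  is congruent to \<open>s - j\<close>.\<close>

lemma cut_iff_dvd:
  assumes x: "x \<in> X" and c: "coding x p y" "struct n s y"
  shows "cut n x (p j) \<longleftrightarrow> int (Z n) dvd (s - j)"
proof
  assume "cut n x (p j)"
  then obtain p' y' where c': "coding x p' y'" "p' 0 = p j" "struct n 0 y'" unfolding cut_def by blast
  have "(\<lambda>k. y (k + j)) = y'"
    by (rule coding_unique(2)[OF coding_shift[OF c(1)] c'(1)]) (simp add: c'(2))
  with struct_shift[OF c(2), of j] have "struct n (s - j) y'" by simp
  from phase_unique[OF x c'(1) this c'(3)] show "int (Z n) dvd (s - j)" by (simp add: mod_eq_0_iff_dvd)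
next
  assume "int (Z n) dvd (s - j)"
  then have "(s - j) mod int (Z n) = 0" by (simp add: mod_eq_0_iff_dvd)
  with struct_shift[OF c(2), of j] have "struct n 0 (\<lambda>k. y (k + j))" by (metis struct_mod)
  with coding_shift[OF c(1), of j] show "cut n x (p j)" unfolding cut_def by (metis add_0)
qed

lemma cut_zero: "cut n x i \<Longrightarrow> x i = 0"
  unfolding cut_def using coding_zero by metis

lemma parse_cut:
  assumes "x \<in> X" "parse n x P Y"
  shows "cut n x i \<longleftrightarrow> i \<in> range P"
proof -
  obtain p y where p: "coding x p y" "struct n 0 y" and P: "P = (\<lambda>t. p (t * int (Z n)))"
    using assms(2) unfolding parse_def by blast
  have *: "cut n x (p j) \<longleftrightarrow> int (Z n) dvd j" for j
    using cut_iff_dvd[OF assms(1) p, of j] by simp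
  show ?thesis
  proof
    assume i: "cut n x i"
    then have "i \<in> range p" using cut_zero[OF i] coding_zero_iff[OF p(1)] by simp
    then obtain j where j: "i = p j" by auto
    with *[of j] i have "int (Z n) dvd j" by simp
    then obtain t where "j = int (Z n) * t" by (rule dvdE)
    with j have "i = P t" by (simp add: P mult.commute)
    then show "i \<in> range P" by (rule range_eqI)
  next
    assume "i \<in> range P"
    then obtain t where "i = p (t * int (Z n))" by (auto simp: P)
    with *[of "t * int (Z n)"] show "cut n x i" by simp
  qed
qed

lemma parse_spc:
  assumes "x \<in> X" "parse n x P Y"
  shows "spacer_at n x (P t) = Y t"
  unfolding spacer_at_def
proof (rule Least_equality)
  show "cut n x (P t + int (h n) + int (Y t))"
    unfolding parse_cut[OF assms] parse_Suc[OF assms(2), symmetric] by (rule rangeI)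
next
  fix c assume "cut n x (P t + int (h n) + int c)"
  then obtain s where s: "P t + int (h n) + int c = P s" unfolding parse_cut[OF assms] by (rule rangeE)
  have "0 < h n" using h_gt[of n] by linarith
  with s have "P t < P s" by linarith
  then have "t < s" using parse_less[OF assms(2)] by (metis less_asym linorder_neqE)
  then have "P (t + 1) \<le> P s" using parse_less[OF assms(2), of "t + 1" s] by (cases "t + 1 = s") auto
  then show "Y t \<le> c" using s parse_Suc[OF assms(2), of t] by simp
qed

lemma cut_parse:
  assumes "cut n x i"
  obtains P Y where "parse n x P Y" "P 0 = i"
proof -
  obtain p y where p: "coding x p y" "p 0 = i" "struct n 0 y" using assms unfolding cut_def by blast
  show thesis
    by (rule that[of "\<lambda>t. p (t * int (Z n))" "\<lambda>t. y (t * int (Z n) + int (Z n) - 1)"])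
      (use p in \<open>auto simp: parse_def\<close>)
qed

lemma cut_sh: "cut n (sh j x) i \<longleftrightarrow> cut n x (i + j)"
proof -
  have "cut n (sh j x) (i - j)" if "cut n x i" for x i j
    using that coding_sh[of x _ _ j] unfolding cut_def by fastforce
  from this[of x "i + j" j] this[of "sh j x" i "- j"] show ?thesis by auto
qed

lemma spc_sh: "spacer_at n (sh j x) i = spacer_at n x (i + j)"
  by (simp add: spacer_at_def cut_sh algebra_simps)

text \<open>Groups of \<open>Z (Suc n)\<close> zeros split into groups of \<open>Z n\<close>. The
  holes of level \<open>n\<close> inside a larger group are prescribed on level
  \<open>Suc n\<close>, except the last, which stays open.\<close>

lemma parse_refine:
  assumes "parse (Suc n) x P' Y'"
  obtains P Y where "parse n x P Y" "\<And>t. P' t = P (t * int (Suc (q n)))"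
    "\<And>t i. i < q n \<Longrightarrow> Y (t * int (Suc (q n)) + int i) = a n i"
    "\<And>t. Y' t = Y (t * int (Suc (q n)) + int (q n))"
proof -
  obtain p y where p: "coding x p y" "struct (Suc n) 0 y" and P': "P' = (\<lambda>t. p (t * int (Z (Suc n))))"
    and Y': "Y' = (\<lambda>t. y (t * int (Z (Suc n)) + int (Z (Suc n)) - 1))"
    using assms unfolding parse_def by blast
  define P where "P = (\<lambda>t. p (t * int (Z n)))"
  define Y where "Y = (\<lambda>t. y (t * int (Z n) + int (Z n) - 1))"
  show thesis
  proof (rule that[of P Y])
    show "parse n x P Y" unfolding parse_def P_def Y_def using p(1) struct_lower[OF p(2)] by blast
    show "P' t = P (t * int (Suc (q n)))" for t by (simp add: P_def P' zeros_Suc algebra_simps)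
    show "Y' t = Y (t * int (Suc (q n)) + int (q n))" for t
      by (simp add: Y_def Y' zeros_Suc algebra_simps)
    fix t i assume i: "i < q n"
    \<comment> \<open>The last zero of the \<open>i\<close>-th smaller block, counted within the
      larger one.\<close>
    define k where "k = i * Z n + (Z n - 1)"
    have Zp: "0 < Z n" by (rule zeros_pos)
    have Sk: "Suc k = Suc i * Z n" using Zp by (simp add: k_def)
    have "Suc k \<le> q n * Z n" unfolding Sk using i by (intro mult_le_mono1) simp
    then have k: "k < Z (Suc n) - 1" using Zp by (simp add: zeros_Suc algebra_simps)
    then have "gd (Suc n) k (y (t * int (Z (Suc n)) + int k))" by (intro struct_good[OF p(2)]) simp
    moreover have "Suc k mod Z n = 0" unfolding Sk by (rule mod_mult_self2_is_0)
    moreover have "k div Z n = i" unfolding k_def by (subst div_mult_self3) (use Zp in simp_all)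
    ultimately have "y (t * int (Z (Suc n)) + int k) = a n i" using k by (simp add: good_def)
    moreover have "(t * int (Suc (q n)) + int i) * int (Z n) + int (Z n) - 1 = t * int (Z (Suc n)) + int k"
      using Zp by (simp add: k_def zeros_Suc algebra_simps of_nat_diff)
    ultimately show "Y (t * int (Suc (q n)) + int i) = a n i" unfolding Y_def by metis
  qed
qed

lemma parse_refines:
  assumes "n \<le> N" "parse N x P' Y'"
  obtains P Y where "parse n x P Y" "\<And>t. \<exists>s. Y' t = Y s" "\<And>t. \<exists>s. P' t = P s"
proof -
  have "\<exists>P Y. parse n x P Y \<and> (\<forall>t. \<exists>s. Y' t = Y s) \<and> (\<forall>t. \<exists>s. P' t = P s)"
    using assms
  proof (induction N arbitrary: P' Y' rule: dec_induct)
    case base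
    then show ?case by blast
  next
    case (step N)
    obtain P1 Y1 where "parse N x P1 Y1" "\<And>t. P' t = P1 (t * int (Suc (q N)))"
      "\<And>t. Y' t = Y1 (t * int (Suc (q N)) + int (q N))"
      using parse_refine[OF step.prems] by metis
    with step.IH[of P1 Y1] show ?case by metis
  qed
  then show thesis using that by blast
qed

lemma ex_parse:
  assumes "x \<in> X"
  obtains P Y where "parse n x P Y"
proof -
  obtain p y where c: "coding x p y" using ex_coding'[OF assms] by blast
  obtain s where s: "struct n s y" using ex_phase[OF assms c] by blast
  have "cut n x (p s)" using cut_iff_dvd[OF assms c s, of s] by simp
  then show thesis using cut_parse that by metis
qed

lemma X_nonempty: "X \<noteq> {}"
  using aperiodic by (simp add: aperiodic_subshift_def)

text \<open>A letter has the form \<open>a N i\<close> with \<open>N\<close> at least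
  \<open>n\<close>. Every block of level \<open>Suc N\<close> contains it as the spacer after its
  \<open>i\<close>-th part, and refining down to level \<open>n\<close> preserves this.\<close>

lemma letter_occurs:
  assumes "c \<in> alph q a (Suc n)"
  obtains x where "x \<in> X" "cut n x 0" "spacer_at n x 0 = c"
proof -
  obtain N i where N: "n \<le> N" "i < q N" "c = a N i" using assms by (auto simp: alph_Suc)
  obtain x where x: "x \<in> X" using X_nonempty by blast
  obtain P' Y' where 1: "parse (Suc N) x P' Y'" using ex_parse[OF x] by blast
  obtain P1 Y1 where 2: "parse N x P1 Y1" and Y1: "\<And>t i. i < q N \<Longrightarrow> Y1 (t * int (Suc (q N)) + int i) = a N i"
    using parse_refine[OF 1] by metis
  obtain P Y where 3: "parse n x P Y" and Y: "\<And>t. \<exists>s. Y1 t = Y s"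
    using parse_refines[OF N(1) 2] by metis
  from Y1[OF N(2)] Y N(3) obtain s where s: "c = Y s" by metis
  show thesis
  proof (rule that[of "sh (P s) x"])
    show "sh (P s) x \<in> X" using x by (rule sh_ferenczi)
    show "cut n (sh (P s) x) 0" using parse_cut[OF x 3] by (simp add: cut_sh)
    show "spacer_at n (sh (P s) x) 0 = c" using parse_spc[OF x 3] s by (simp add: spc_sh)
  qed
qed

text \<open>Each of the finitely many wrong phases of \<open>x\<close> is violated at some zero. A
  window containing these zeros excludes the same phases for every point that agrees with
  \<open>x\<close> there, so that point has the phase of \<open>x\<close>.\<close>

lemma loc_const_cut_0: "loc_const X (\<lambda>x. cut n x 0)"
  unfolding loc_const_def
proof
  fix x assume x: "x \<in> X"
  show "\<exists>r. \<forall>x'\<in>X. agree r x x' \<longrightarrow> cut n x' 0 = cut n x 0"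
  proof (cases "x 0 = 0")
    case False
    have "\<not> cut n x' 0" if "agree 0 x x'" for x'
      using that False cut_zero[of n x' 0] by (auto simp: agree_def)
    moreover have "\<not> cut n x 0" using False cut_zero[of n x 0] by auto
    ultimately show ?thesis by blast
  next
    case True
    obtain p y where c: "coding x p y" "p 0 = 0" using ex_coding[OF x True] by blast
    obtain s where s: "0 \<le> s" "s < int (Z n)" "struct n s y" using ex_phase[OF x c(1)] by blast
    have "\<forall>t\<in>{0..<int (Z n)} - {s}. \<exists>k. \<not> gd n (nat ((k - t) mod int (Z n))) (y k)"
    proof
      fix t assume t: "t \<in> {0..<int (Z n)} - {s}"
      have "\<not> struct n t y"
      proof
        assume "struct n t y"
        from phase_unique[OF x c(1) s(3) this] have "s mod int (Z n) = t mod int (Z n)"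
          by (metis mod_eq_dvd_iff mod_eq_0_iff_dvd)
        with s t show False by simp
      qed
      then show "\<exists>k. \<not> gd n (nat ((k - t) mod int (Z n))) (y k)" by (simp add: struct_def)
    qed
    then obtain \<kappa> where \<kappa>: "\<forall>t\<in>{0..<int (Z n)} - {s}. \<not> gd n (nat ((\<kappa> t - t) mod int (Z n))) (y (\<kappa> t))"
      by (rule bchoice[THEN exE])
    have "finite ((\<lambda>t. nat \<bar>\<kappa> t\<bar>) ` {0..<int (Z n)})" by simp
    then obtain m where m: "\<forall>j\<in>(\<lambda>t. nat \<bar>\<kappa> t\<bar>) ` {0..<int (Z n)}. j < m"
      unfolding finite_nat_set_iff_bounded by blast
    define r where "r = nat (max \<bar>p (- int m)\<bar> \<bar>p (int m)\<bar>)"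
    have "cut n x' 0 = cut n x 0" if x': "x' \<in> X" and ag: "agree r x x'" for x'
    proof -
      have r: "x i = x' i" if "p (- int m) \<le> i" "i \<le> p (int m)" for i
      proof -
        have "\<bar>i\<bar> \<le> max \<bar>p (- int m)\<bar> \<bar>p (int m)\<bar>" using that by linarith
        also have "\<dots> = int r" by (simp add: r_def)
        finally have "\<bar>i\<bar> \<le> int r" .
        then show ?thesis using ag by (simp add: agree_def)
      qed
      have "x' 0 = 0" using ag True by (auto simp: agree_def)
      then obtain p' y' where c': "coding x' p' y'" "p' 0 = 0" using ex_coding[OF x'] by blast
      obtain s' where s': "0 \<le> s'" "s' < int (Z n)" "struct n s' y'" using ex_phase[OF x' c'(1)] by blast
      have "s' = s"
      proof (rule ccontr)
        assume "s' \<noteq> s"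
        with s' have s'in: "s' \<in> {0..<int (Z n)} - {s}" by simp
        then have "nat \<bar>\<kappa> s'\<bar> < m" using m by auto
        then have "\<bar>\<kappa> s'\<bar> < int m" by linarith
        moreover have "p 0 = p' 0" using c(2) c'(2) by simp
        ultimately have "y (\<kappa> s') = y' (\<kappa> s')"
          using coding_local'[where k = "\<kappa> s'", OF c(1) c'(1) _ r] by blast
        moreover have "gd n (nat ((\<kappa> s' - s') mod int (Z n))) (y' (\<kappa> s'))"
          using s'(3) by (simp add: struct_def)
        ultimately show False using bspec[OF \<kappa> s'in] by metis
      qed
      then show ?thesis
        using cut_iff_dvd[OF x c(1) s(3), of 0] cut_iff_dvd[OF x' c'(1) s'(3), of 0] c(2) c'(2) by simp
    qed
    then show ?thesis by blast
  qed
qed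

lemma loc_const_cut: "loc_const X (\<lambda>x. cut n x i)"
  using loc_const_sh[OF loc_const_cut_0 sh_ferenczi, where k = i] by (simp add: cut_sh)

end

section \<open>Tower sums and coboundaries\<close>

lemma sum_orbit_shift:
  "(\<Sum>j\<in>{i..<i + T}. f (sh j x)) = (\<Sum>j\<in>{0..<T}. f (sh j (sh i x)))"
  by (rule sum.reindex_bij_witness[of _ "\<lambda>j. j + i" "\<lambda>j. j - i"]) auto

lemma sum_int_ivl_concat:
  fixes i j k :: int
  assumes "i \<le> j" "j \<le> k"
  shows "sum f {i..<k} = sum f {i..<j} + sum f {j..<k}"
  by (subst sum.union_disjoint[symmetric]) (use assms in \<open>auto simp: ivl_disj_un\<close>)

context ferenczi
begin

definition tower_height :: "nat \<Rightarrow> (int \<Rightarrow> nat) \<Rightarrow> int" where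
  "tower_height n x = int (h n) + int (spacer_at n x 0)"

definition tower_sum :: "nat \<Rightarrow> ((int \<Rightarrow> nat) \<Rightarrow> int) \<Rightarrow> (int \<Rightarrow> nat) \<Rightarrow> int" where
  "tower_sum n f x = (\<Sum>j\<in>{0..<tower_height n x}. f (sh j x))"

text \<open>Two towers over the same spacer must have equal sums, which in general fails before
  shifting the function and raising the level. Only the values of \<open>v\<close> on
  \<open>alph q a (Suc n)\<close> matter.\<close>

definition has_tower_sum :: "nat \<Rightarrow> ((int \<Rightarrow> nat) \<Rightarrow> int) \<Rightarrow> (nat \<Rightarrow> int) \<Rightarrow> bool" where
  "has_tower_sum n f v \<longleftrightarrow> (\<forall>x\<in>X. cut n x 0 \<longrightarrow> tower_sum n f x = v (spacer_at n x 0))"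

definition is_coboundary :: "((int \<Rightarrow> nat) \<Rightarrow> int) \<Rightarrow> bool" where
  "is_coboundary f \<longleftrightarrow> (\<exists>u. loc_const X u \<and> (\<forall>x\<in>X. f x = u (sh 1 x) - u x))"

text \<open>A right inverse to taking tower sums: the whole sum \<open>v c\<close> is placed on the
  base of the tower over \<open>c\<close>.\<close>

definition chi :: "nat \<Rightarrow> (nat \<Rightarrow> int) \<Rightarrow> (int \<Rightarrow> nat) \<Rightarrow> int" where
  "chi n v x = (if cut n x 0 then v (spacer_at n x 0) else 0)"

lemma h_pos: "0 < int (h n)"
  using h_gt[of n] by linarith

lemma tow_pos: "0 < tower_height n x"
  unfolding tower_height_def using h_pos[of n] by linarith

lemma parse_0_cut:
  assumes "x \<in> X" "parse n x P Y" "P 0 = 0"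
  shows "cut n x 0" "spacer_at n x 0 = Y 0" "P 1 = tower_height n x"
  using parse_cut[OF assms(1,2), of 0] parse_spc[OF assms(1,2), of 0] parse_Suc[OF assms(2), of 0] assms(3)
  by (auto simp: tower_height_def image_iff intro: exI[of _ 0])

lemma cut_next:
  assumes "x \<in> X" "cut n x i"
  shows "cut n x (i + tower_height n (sh i x))"
    and "i < j \<Longrightarrow> j < i + tower_height n (sh i x) \<Longrightarrow> \<not> cut n x j"
proof -
  obtain P Y where p: "parse n x P Y" "P 0 = i" using cut_parse[OF assms(2)] by blast
  have t: "i + tower_height n (sh i x) = P 1"
    using parse_Suc[OF p(1), of 0] parse_spc[OF assms(1) p(1), of 0] p(2) by (simp add: tower_height_def spc_sh)
  show "cut n x (i + tower_height n (sh i x))" unfolding t using parse_cut[OF assms(1) p(1)] by simp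
  show "\<not> cut n x j" if "i < j" "j < i + tower_height n (sh i x)"
  proof
    assume "cut n x j"
    then obtain s where s: "j = P s" using parse_cut[OF assms(1) p(1)] by auto
    have "0 < s" using s p(2) that(1) parse_less[OF p(1), of s 0] by (cases "s = 0") force+
    then have "P 1 \<le> P s" using parse_less[OF p(1), of 1 s] by (cases "s = 1") auto
    with that s t show False by simp
  qed
qed

lemma ex_cut_before:
  assumes "x \<in> X"
  shows "\<exists>s. cut n x (- int s)"
proof -
  obtain P Y where p: "parse n x P Y" using ex_parse[OF assms] by blast
  have "P (- int t) \<le> P 0 - int t" for t
  proof (induction t)
    case (Suc t)
    have "P (- int (Suc t)) < P (- int t)" by (rule parse_less[OF p]) simp
    with Suc show ?case by simp
  qed simp
  from this[of "nat \<bar>P 0\<bar>"] have "P (- int (nat \<bar>P 0\<bar>)) \<le> 0" by linarith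
  then have "P (- int (nat \<bar>P 0\<bar>)) = - int (nat (- P (- int (nat \<bar>P 0\<bar>))))" by linarith
  then have "cut n x (- int (nat (- P (- int (nat \<bar>P 0\<bar>)))))"
    using parse_cut[OF assms p] by (metis rangeI)
  then show ?thesis by blast
qed

lemma loc_const_spc: "loc_const X (\<lambda>x. if cut n x 0 then spacer_at n x 0 else 0)"
proof -
  \<comment> \<open>Away from cutting points a next cut at this distance need not exist; there the
    predicate is made true for all \<open>c\<close>, so that the least one is 0.\<close>
  have "loc_const X (\<lambda>x. LEAST c. \<not> cut n x 0 \<or> cut n x (int (h n) + int c))"
  proof (rule loc_const_Least)
    show "loc_const X (\<lambda>x. \<not> cut n x 0 \<or> cut n x (int (h n) + int s))" for s
      by (rule loc_const_comp2[where H = "\<lambda>a b. \<not> a \<or> b", OF loc_const_cut loc_const_cut])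
    show "\<exists>s. \<not> cut n x 0 \<or> cut n x (int (h n) + int s)" if "x \<in> X" for x
      using cut_next(1)[OF that, of n 0] by (auto simp: tower_height_def)
  qed
  moreover have "(LEAST c. \<not> cut n x 0 \<or> cut n x (int (h n) + int c)) = (if cut n x 0 then spacer_at n x 0 else 0)" for x
    by (simp add: spacer_at_def Least_eq_0)
  ultimately show ?thesis by simp
qed

lemma loc_const_chi: "loc_const X (chi n v)"
proof -
  have "loc_const X (\<lambda>x. if cut n x 0 then v (if cut n x 0 then spacer_at n x 0 else 0) else 0)"
    by (rule loc_const_comp2[where H = "\<lambda>a b. if a then v b else 0", OF loc_const_cut loc_const_spc])
  moreover have "(\<lambda>x. if cut n x 0 then v (if cut n x 0 then spacer_at n x 0 else 0) else 0) = chi n v"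
    by (auto simp: chi_def)
  ultimately show ?thesis by simp
qed

lemma has_tsum_chi: "has_tower_sum n (chi n v) v"
  unfolding has_tower_sum_def
proof (intro ballI impI)
  fix x assume x: "x \<in> X" "cut n x 0"
  have "tower_sum n (chi n v) x = (\<Sum>j\<in>{0}. chi n v (sh j x))"
    unfolding tower_sum_def
  proof (rule sum.mono_neutral_right)
    show "\<forall>i\<in>{0..<tower_height n x} - {0}. chi n v (sh i x) = 0"
      using cut_next(2)[OF x] by (auto simp: chi_def cut_sh)
  qed (use tow_pos in auto)
  then show "tower_sum n (chi n v) x = v (spacer_at n x 0)" using x by (simp add: chi_def)
qed

text \<open>The transition map of tower sums: the tower over \<open>c\<close> on level
  \<open>Suc n\<close> is the stack of the towers over \<open>a n 0\<close>, ...,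
  \<open>a n (q n - 1)\<close> and \<open>c\<close> on level \<open>n\<close>.\<close>

definition push :: "nat \<Rightarrow> (nat \<Rightarrow> int) \<Rightarrow> nat \<Rightarrow> int" where
  "push n v c = v c + (\<Sum>i<q n. v (a n i))"

lemma cut_Suc:
  assumes "x \<in> X" "cut (Suc n) x 0"
  obtains P Y where "parse n x P Y" "P 0 = 0" "P (int (Suc (q n))) = tower_height (Suc n) x"
    "\<And>i. i < q n \<Longrightarrow> Y (int i) = a n i" "Y (int (q n)) = spacer_at (Suc n) x 0"
proof -
  obtain P' Y' where p': "parse (Suc n) x P' Y'" "P' 0 = 0" using cut_parse[OF assms(2)] by blast
  obtain P Y where p: "parse n x P Y" "\<And>t. P' t = P (t * int (Suc (q n)))"
    "\<And>t i. i < q n \<Longrightarrow> Y (t * int (Suc (q n)) + int i) = a n i"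
    "\<And>t. Y' t = Y (t * int (Suc (q n)) + int (q n))"
    using parse_refine[OF p'(1)] by blast
  show thesis
  proof (rule that[OF p(1)])
    show "P 0 = 0" using p(2)[of 0] p'(2) by simp
    show "P (int (Suc (q n))) = tower_height (Suc n) x"
      using p(2)[of 1] parse_0_cut(3)[OF assms(1) p'] by simp
    show "Y (int i) = a n i" if "i < q n" for i using p(3)[OF that, of 0] by simp
    show "Y (int (q n)) = spacer_at (Suc n) x 0" using p(4)[of 0] parse_0_cut(2)[OF assms(1) p'] by simp
  qed
qed

lemma has_tsum_push:
  assumes "has_tower_sum n f v"
  shows "has_tower_sum (Suc n) f (push n v)"
  unfolding has_tower_sum_def
proof (intro ballI impI)
  fix x assume x: "x \<in> X" "cut (Suc n) x 0"
  obtain P Y where p: "parse n x P Y" "P 0 = 0" "P (int (Suc (q n))) = tower_height (Suc n) x"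
    "\<And>i. i < q n \<Longrightarrow> Y (int i) = a n i" "Y (int (q n)) = spacer_at (Suc n) x 0"
    using cut_Suc[OF x] by metis
  have "0 \<le> P (int t) \<and> (\<Sum>j\<in>{0..<P (int t)}. f (sh j x)) = (\<Sum>i<t. v (Y (int i)))" for t
  proof (induction t)
    case 0
    then show ?case using p(2) by simp
  next
    case (Suc t)
    let ?y = "sh (P (int t)) x"
    have y: "?y \<in> X" "cut n ?y 0" "spacer_at n ?y 0 = Y (int t)"
      using x(1) parse_cut[OF x(1) p(1)] parse_spc[OF x(1) p(1)] by (auto simp: sh_ferenczi cut_sh spc_sh)
    have s: "P (int (Suc t)) = P (int t) + tower_height n ?y"
      using parse_Suc[OF p(1), of "int t"] y(3) by (simp add: tower_height_def add.commute)
    have "tower_sum n f ?y = v (Y (int t))"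
      using assms y(1,2) unfolding has_tower_sum_def y(3)[symmetric] by blast
    then have "(\<Sum>j\<in>{P (int t)..<P (int t) + tower_height n ?y}. f (sh j x)) = v (Y (int t))"
      unfolding sum_orbit_shift tower_sum_def .
    moreover have "(\<Sum>j\<in>{0..<P (int t) + tower_height n ?y}. f (sh j x)) =
        (\<Sum>j\<in>{0..<P (int t)}. f (sh j x)) + (\<Sum>j\<in>{P (int t)..<P (int t) + tower_height n ?y}. f (sh j x))"
      by (rule sum_int_ivl_concat) (use Suc tow_pos[of n ?y] in auto)
    ultimately show ?case using Suc s tow_pos[of n ?y] by simp
  qed
  from this[of "Suc (q n)"] have "tower_sum (Suc n) f x = (\<Sum>i<Suc (q n). v (Y (int i)))"
    unfolding tower_sum_def p(3)[symmetric] by blast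
  also have "\<dots> = (\<Sum>i<q n. v (a n i)) + v (spacer_at (Suc n) x 0)" using p(4,5) by simp
  finally show "tower_sum (Suc n) f x = push n v (spacer_at (Suc n) x 0)" by (simp add: push_def)
qed

lemma has_tsum_diff: "has_tower_sum n f v \<Longrightarrow> has_tower_sum n g v' \<Longrightarrow> has_tower_sum n (\<lambda>x. f x - g x) (\<lambda>c. v c - v' c)"
  by (simp add: has_tower_sum_def tower_sum_def sum_subtractf)

lemma has_tsum_add: "has_tower_sum n f v \<Longrightarrow> has_tower_sum n g v' \<Longrightarrow> has_tower_sum n (\<lambda>x. f x + g x) (\<lambda>c. v c + v' c)"
  by (simp add: has_tower_sum_def tower_sum_def sum.distrib)

lemma has_tsum_cong:
  "has_tower_sum n f v \<Longrightarrow> (\<And>c. c \<in> alph q a (Suc n) \<Longrightarrow> v c = v' c) \<Longrightarrow> has_tower_sum n f v'"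
  unfolding has_tower_sum_def using cut_parse parse_alph parse_spc by metis

lemma spc_alph: "x \<in> X \<Longrightarrow> cut n x 0 \<Longrightarrow> spacer_at n x 0 \<in> alph q a (Suc n)"
  using cut_parse parse_alph parse_spc by metis

lemma cob_0: "is_coboundary (\<lambda>x. 0)"
  unfolding is_coboundary_def by (rule exI[of _ "\<lambda>x. 0"]) simp

lemma cob_add: "is_coboundary f \<Longrightarrow> is_coboundary g \<Longrightarrow> is_coboundary (\<lambda>x. f x + g x)"
proof -
  assume "is_coboundary f" "is_coboundary g"
  then obtain u u' where "loc_const X u" "loc_const X u'" "\<And>x. x \<in> X \<Longrightarrow> f x = u (sh 1 x) - u x"
    "\<And>x. x \<in> X \<Longrightarrow> g x = u' (sh 1 x) - u' x" unfolding is_coboundary_def by blast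
  then show ?thesis unfolding is_coboundary_def
    by (intro exI[of _ "\<lambda>x. u x + u' x"]) (auto intro: loc_const_comp2[where H = "(+)"])
qed

lemma cob_minus: "is_coboundary f \<Longrightarrow> is_coboundary (\<lambda>x. - f x)"
proof -
  assume "is_coboundary f"
  then obtain u where "loc_const X u" "\<And>x. x \<in> X \<Longrightarrow> f x = u (sh 1 x) - u x"
    unfolding is_coboundary_def by blast
  then show ?thesis unfolding is_coboundary_def
    by (intro exI[of _ "\<lambda>x. - u x"]) (auto intro: loc_const_comp[where H = uminus])
qed

lemma cob_diff: "is_coboundary f \<Longrightarrow> is_coboundary g \<Longrightarrow> is_coboundary (\<lambda>x. f x - g x)"
  using cob_add[of f "\<lambda>x. - g x"] cob_minus[of g] by simp

lemma cob_cong: "(\<And>x. x \<in> X \<Longrightarrow> f x = g x) \<Longrightarrow> is_coboundary f \<longleftrightarrow> is_coboundary g"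
  by (simp add: is_coboundary_def)

text \<open>The transfer function \<open>u\<close> sums \<open>f\<close> from the bottom of the
  current tower to just below the point. It grows by \<open>f x\<close> at each step, and at the top
  it returns to 0 because the tower sum vanishes.\<close>

lemma cob_of_zero_tsum:
  assumes f: "loc_const X f" and zero: "has_tower_sum n f (\<lambda>_. 0)"
  shows "is_coboundary f"
proof -
  define age where "age x = (LEAST s. cut n x (- int s))" for x
  define u where "u x = (\<Sum>j\<in>{- int (age x)..<0}. f (sh j x))" for x
  have "loc_const X age" unfolding age_def by (rule loc_const_Least[OF loc_const_cut ex_cut_before])
  moreover have "loc_const X (\<lambda>x. \<Sum>j\<in>{- int s..<0}. f (sh j x))" for s
    by (rule loc_const_sum) (auto intro: loc_const_sh[OF f sh_ferenczi])
  ultimately have "loc_const X u" unfolding u_def by (rule loc_const_bind)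
  moreover have "f x = u (sh 1 x) - u x" if x: "x \<in> X" for x
  proof -
    let ?b = "age x"
    have cb: "cut n x (- int ?b)" unfolding age_def using ex_cut_before[OF x] by (rule LeastI_ex)
    have nb: "\<not> cut n x (- int s)" if "s < ?b" for s using that unfolding age_def by (rule not_less_Least)
    have s1: "(\<Sum>j\<in>{- int ?b..<1}. f (sh j x)) = u x + f x"
    proof -
      have "{0..<1::int} = {0}" by auto
      then show ?thesis using sum_int_ivl_concat[of "- int ?b" 0 1 "\<lambda>j. f (sh j x)"] by (simp add: u_def)
    qed
    show ?thesis
    proof (cases "cut n x 1")
      case True
      then have "age (sh 1 x) = 0" unfolding age_def by (intro Least_eq_0) (simp add: cut_sh)
      then have "u (sh 1 x) = 0" by (simp add: u_def)
      \<comment> \<open>By minimality of \<open>age\<close> no cut lies after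
        \<open>- int ?b\<close> and up to 0, and 1 is a cut; so the tower through \<open>x\<close>
        ends exactly at 1.\<close>
      moreover have "tower_height n (sh (- int ?b) x) = int ?b + 1"
      proof (rule ccontr)
        let ?T = "tower_height n (sh (- int ?b) x)"
        assume "?T \<noteq> int ?b + 1"
        then consider "?T < int ?b + 1" | "int ?b + 1 < ?T" by linarith
        then show False
        proof cases
          case 1
          have "cut n x (- int ?b + ?T)" by (rule cut_next(1)[OF x cb])
          moreover have "- int ?b + ?T = - int (nat (int ?b - ?T))" using 1 by simp
          moreover have "nat (int ?b - ?T) < ?b" using 1 tow_pos[of n "sh (- int ?b) x"] by linarith
          ultimately show False using nb by metis
        next
          case 2
          then show False using cut_next(2)[OF x cb, of 1] True by simp
        qed
      qed
      moreover have "tower_sum n f (sh (- int ?b) x) = 0"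
        using zero cb x by (simp add: has_tower_sum_def cut_sh sh_ferenczi)
      ultimately have "(\<Sum>j\<in>{- int ?b..<- int ?b + (int ?b + 1)}. f (sh j x)) = 0"
        unfolding sum_orbit_shift tower_sum_def by simp
      then show ?thesis using s1 \<open>u (sh 1 x) = 0\<close> by simp
    next
      case False
      have "age (sh 1 x) = Suc ?b"
        unfolding age_def[of "sh 1 x"]
      proof (rule Least_equality)
        show "cut n (sh 1 x) (- int (Suc ?b))" using cb by (simp add: cut_sh)
      next
        fix s assume "cut n (sh 1 x) (- int s)"
        then have s: "cut n x (- int s + 1)" by (simp add: cut_sh)
        then have "s \<noteq> 0" using False by (intro notI) simp
        then obtain s' where s': "s = Suc s'" by (cases s) auto
        with s have "cut n x (- int s')" by simp
        with nb have "\<not> s' < ?b" by blast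
        with s' show "Suc ?b \<le> s" by simp
      qed
      moreover have "- int (Suc ?b) = - int ?b - 1" by simp
      ultimately have "u (sh 1 x) = (\<Sum>j\<in>{- int ?b - 1..<0}. f (sh (j + 1) x))"
        unfolding u_def sh_sh by metis
      also have "\<dots> = (\<Sum>j\<in>{- int ?b..<1}. f (sh j x))"
        by (rule sum.reindex_bij_witness[of _ "\<lambda>j. j - 1" "\<lambda>j. j + 1"]) auto
      finally show ?thesis using s1 by simp
    qed
  qed
  ultimately show ?thesis unfolding is_coboundary_def by blast
qed

text \<open>Whatever the spacer of the next block, that block begins with \<open>w n\<close>; so the
  letters are known up to \<open>h n\<close> places beyond the top of the tower.\<close>

lemma future_eq:
  assumes x: "x \<in> X" "cut n x 0" and x': "x' \<in> X" "cut n x' 0" and e: "spacer_at n x 0 = spacer_at n x' 0"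
    and i: "0 \<le> i" "i < tower_height n x + int (h n)"
  shows "x i = x' i"
proof -
  obtain P Y where p: "parse n x P Y" "P 0 = 0" using cut_parse[OF x(2)] by blast
  obtain P' Y' where p': "parse n x' P' Y'" "P' 0 = 0" using cut_parse[OF x'(2)] by blast
  note c = parse_0_cut[OF x(1) p] and c' = parse_0_cut[OF x'(1) p']
  have t: "tower_height n x' = tower_height n x" using e by (simp add: tower_height_def)
  consider "i < int (h n)" | "int (h n) \<le> i" "i < tower_height n x" | "tower_height n x \<le> i" by linarith
  then show ?thesis
  proof cases
    case 1
    then show ?thesis
      using parse_word(1)[OF p(1), of "nat i" 0] parse_word(1)[OF p'(1), of "nat i" 0] p(2) p'(2) i
      by (simp add: nat_less_iff)
  next
    case 2
    then have "h n \<le> nat i" "nat i < h n + Y 0" "nat i < h n + Y' 0"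
      using c(2) c'(2) e by (auto simp: tower_height_def)
    then show ?thesis
      using parse_word(2)[OF p(1), of "nat i" 0] parse_word(2)[OF p'(1), of "nat i" 0] p(2) p'(2) i by simp
  next
    case 3
    define d where "d = nat (i - tower_height n x)"
    have d: "d < h n" "i = tower_height n x + int d" using 3 i by (auto simp: d_def)
    show ?thesis
      using parse_word(1)[OF p(1) d(1), of 1] parse_word(1)[OF p'(1) d(1), of 1] c(3) c'(3) t d(2) by simp
  qed
qed

text \<open>Shifting \<open>f\<close> by the radius \<open>r\<close> of its window gives a function
  of the future only, which differs from \<open>f\<close> by a coboundary and is nonnegative if
  \<open>f\<close> is. On a high level its tower sums are determined by
  \<open>future_eq\<close>.\<close>

lemma ex_has_tsum:
  assumes f: "loc_const X f"
  obtains g N v where "loc_const X g" "is_coboundary (\<lambda>x. f x - g x)" "m \<le> N" "has_tower_sum N g v"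
    "(\<forall>x\<in>X. 0 \<le> f x) \<longrightarrow> (\<forall>c\<in>alph q a (Suc N). 0 \<le> v c)"
proof -
  obtain r where r: "\<And>x y. x \<in> X \<Longrightarrow> y \<in> X \<Longrightarrow> agree r x y \<Longrightarrow> f x = f y"
    using loc_const_uniform[OF compact_ferenczi f] by blast
  define g where "g x = f (sh (int r) x)" for x
  \<comment> \<open>The shifted windows reach fewer than \<open>2 * r\<close> letters past the top
    of a tower when its last point is counted in, which \<open>h N\<close> covers.\<close>
  define N where "N = max m (2 * r)"
  define v where "v c = tower_sum N g (SOME x. x \<in> X \<and> cut N x 0 \<and> spacer_at N x 0 = c)" for c
  have hN: "2 * int r < int (h N)" using h_gt[of N] by (simp add: N_def)
  have same: "tower_sum N g x = tower_sum N g x'"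
    if x: "x \<in> X" "cut N x 0" and x': "x' \<in> X" "cut N x' 0" and e: "spacer_at N x 0 = spacer_at N x' 0" for x x'
  proof -
    have t: "tower_height N x' = tower_height N x" using e by (simp add: tower_height_def)
    show ?thesis unfolding tower_sum_def t
    proof (rule sum.cong)
      fix j assume j: "j \<in> {0..<tower_height N x}"
      have "agree r (sh (int r + j) x) (sh (int r + j) x')"
        unfolding agree_def sh_apply
      proof (intro allI impI)
        fix i assume "\<bar>i\<bar> \<le> int r"
        with j hN have "0 \<le> i + (int r + j)" "i + (int r + j) < tower_height N x + int (h N)" by auto
        then show "x (i + (int r + j)) = x' (i + (int r + j))" by (rule future_eq[OF x x' e])
      qed
      then show "g (sh j x) = g (sh j x')"
        unfolding g_def using r[OF sh_ferenczi[OF x(1)] sh_ferenczi[OF x'(1)]] by simp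
    qed simp
  qed
  show thesis
  proof (rule that[of g N v])
    show "loc_const X g" unfolding g_def by (rule loc_const_sh[OF f sh_ferenczi])
    show "m \<le> N" by (simp add: N_def)
    show "has_tower_sum N g v" unfolding has_tower_sum_def
    proof (intro ballI impI)
      fix x assume x: "x \<in> X" "cut N x 0"
      let ?P = "\<lambda>y. y \<in> X \<and> cut N y 0 \<and> spacer_at N y 0 = spacer_at N x 0"
      have "?P (SOME y. ?P y)" by (rule someI[of ?P x]) (use x in simp)
      then show "tower_sum N g x = v (spacer_at N x 0)" unfolding v_def by (intro same[OF x]) auto
    qed
    show "(\<forall>x\<in>X. 0 \<le> f x) \<longrightarrow> (\<forall>c\<in>alph q a (Suc N). 0 \<le> v c)"
    proof (intro impI ballI)
      fix c assume pos: "\<forall>x\<in>X. 0 \<le> f x" and c: "c \<in> alph q a (Suc N)"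
      let ?P = "\<lambda>y. y \<in> X \<and> cut N y 0 \<and> spacer_at N y 0 = c"
      obtain x where "?P x" using letter_occurs[OF c] by blast
      then have "?P (SOME y. ?P y)" by (rule someI[of ?P])
      then show "0 \<le> v c"
        unfolding v_def tower_sum_def g_def by (intro sum_nonneg pos[rule_format] sh_ferenczi) simp
    qed
    have "is_coboundary (\<lambda>x. f (sh (int k) x) - f x)" for k
    proof (induction k)
      case 0
      then show ?case using cob_0 by simp
    next
      case (Suc k)
      have "is_coboundary (\<lambda>x. f (sh (int (Suc k)) x) - f (sh (int k) x))"
        unfolding is_coboundary_def using loc_const_sh[OF f sh_ferenczi, where k = "int k"]
        by (intro exI[of _ "\<lambda>x. f (sh (int k) x)"]) (simp add: add.commute)
      from cob_add[OF this Suc] show ?case by simp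
    qed
    from cob_minus[OF this[of r]] show "is_coboundary (\<lambda>x. f x - g x)" by (simp add: g_def)
  qed
qed

lemma tsum_coboundary:
  assumes "x \<in> X" "\<And>x. x \<in> X \<Longrightarrow> f x = u (sh 1 x) - u x"
  shows "tower_sum n f x = u (sh (tower_height n x) x) - u x"
proof -
  have "(\<Sum>j\<in>{0..<int t}. f (sh j x)) = u (sh (int t) x) - u x" for t
  proof (induction t)
    case (Suc t)
    have "{int t..<int (Suc t)} = {int t}" by auto
    then have "(\<Sum>j\<in>{0..<int (Suc t)}. f (sh j x)) = (\<Sum>j\<in>{0..<int t}. f (sh j x)) + f (sh (int t) x)"
      using sum_int_ivl_concat[of 0 "int t" "int (Suc t)" "\<lambda>j. f (sh j x)"] by simp
    also have "f (sh (int t) x) = u (sh (int (Suc t)) x) - u (sh (int t) x)"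
      using assms(2)[OF sh_ferenczi[OF assms(1)], of "int t"] by simp
    finally show ?case using Suc by simp
  qed simp
  from this[of "nat (tower_height n x)"] show ?thesis using tow_pos[of n x] by (simp add: tower_sum_def)
qed

text \<open>A transfer function \<open>u\<close> only sees a bounded window, and the window around the bottom of the
  second block of a higher block is always the same; so \<open>u\<close> is constant on the bases of the
  higher towers.\<close>

lemma coboundary_has_tsum_zero:
  assumes f: "is_coboundary f" and v0: "has_tower_sum N0 f v0"
  shows "\<exists>N\<ge>N0. \<forall>v. has_tower_sum N f v \<longrightarrow> (\<forall>c\<in>alph q a (Suc N). v c = 0)"
proof -
  obtain u where u: "loc_const X u" "\<And>x. x \<in> X \<Longrightarrow> f x = u (sh 1 x) - u x" using f unfolding is_coboundary_def by blast
  obtain r where r: "\<And>x y. x \<in> X \<Longrightarrow> y \<in> X \<Longrightarrow> agree r x y \<Longrightarrow> u x = u y"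
    using loc_const_uniform[OF compact_ferenczi u(1)] by blast
  define n where "n = max N0 r"
  have hn: "int r < int (h n)" using h_gt[of n] by (simp add: n_def)
  have "\<exists>v'. has_tower_sum n f v'"
  proof -
    have "N0 \<le> n" by (simp add: n_def)
    then show ?thesis
      by (induction n rule: dec_induct) (use v0 has_tsum_push in blast)+
  qed
  then obtain v' where v': "has_tower_sum n f v'" by blast
  have const: "u x = u x'" if x: "x \<in> X" "cut (Suc n) x 0" and x': "x' \<in> X" "cut (Suc n) x' 0" for x x'
  proof -
    have *: "cut n x 0 \<and> spacer_at n x 0 = a n 0" if xx: "x \<in> X" "cut (Suc n) x 0" for x
    proof -
      obtain P Y where p: "parse n x P Y" "P 0 = 0" "\<And>i. i < q n \<Longrightarrow> Y (int i) = a n i"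
        using cut_Suc[OF xx] by metis
      show ?thesis using parse_0_cut[OF xx(1) p(1,2)] p(3)[of 0] q_ge_2[of n] by simp
    qed
    note c = *[OF x] and c' = *[OF x']
    have t: "tower_height n x' = tower_height n x" using c c' by (simp add: tower_height_def)
    \<comment> \<open>The point \<open>sh (tower_height n x) x\<close> sits at the bottom of the
      second block; its window lies within \<open>w n\<close>, the \<open>a n 0\<close> ones and the
      next \<open>w n\<close>. Equality there is carried back to the base by the tower sum of the
      first block, which is \<open>v' (a n 0)\<close> for both points.\<close>
    have "u (sh (tower_height n x) x) = u (sh (tower_height n x) x')"
    proof (rule r)
      show "agree r (sh (tower_height n x) x) (sh (tower_height n x) x')"
        unfolding agree_def sh_apply
      proof (intro allI impI)
        fix i assume "\<bar>i\<bar> \<le> int r"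
        with hn have "0 \<le> i + tower_height n x" "i + tower_height n x < tower_height n x + int (h n)" by (auto simp: tower_height_def)
        note i = this
        show "x (i + tower_height n x) = x' (i + tower_height n x)"
          by (rule future_eq[OF x(1) conjunct1[OF c] x'(1) conjunct1[OF c'] _ i]) (use c c' in simp)
      qed
    qed (use x x' in \<open>auto simp: sh_ferenczi\<close>)
    moreover have "tower_sum n f x = tower_sum n f x'" using v' c c' x x' by (simp add: has_tower_sum_def)
    ultimately show ?thesis
      using tsum_coboundary[where f = f and u = u, OF x(1) u(2), of n] tsum_coboundary[where f = f and u = u, OF x'(1) u(2), of n] t by simp
  qed
  have "v c = 0" if v: "has_tower_sum (Suc n) f v" and c: "c \<in> alph q a (Suc (Suc n))" for v c
  proof -
    obtain x where x: "x \<in> X" "cut (Suc n) x 0" "spacer_at (Suc n) x 0 = c" using letter_occurs[OF c] by blast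
    \<comment> \<open>The orbit arrives at a base of level \<open>Suc n\<close> again, so the
      telescoping sum compares two equal values of \<open>u\<close>.\<close>
    have "cut (Suc n) (sh (tower_height (Suc n) x) x) 0"
      using cut_next(1)[OF x(1,2)] by (simp add: cut_sh)
    then have "u (sh (tower_height (Suc n) x) x) = u x" using x by (intro const) (auto simp: sh_ferenczi)
    then have "tower_sum (Suc n) f x = 0" using tsum_coboundary[where f = f and u = u, OF x(1) u(2)] by simp
    then show ?thesis using v x by (simp add: has_tower_sum_def)
  qed
  then show ?thesis by (intro exI[of _ "Suc n"]) (auto simp: n_def)
qed

end

section \<open>From tower sums to the group \<open>GW\<close>\<close>

locale ferenczi_level = ferenczi +
  fixes n0 :: nat
  assumes stable: "stable_level q a n0"
begin

abbreviation "m \<equiv> n0 - 1"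
abbreviation "A \<equiv> alph q a n0"
abbreviation "B \<equiv> alphB q a n0"
abbreviation "a' \<equiv> min_letter q a n0"

lemma alph_eq:
  assumes "m \<le> n"
  shows "alph q a (Suc n) = A"
proof -
  have "n0 \<le> Suc n" using assms by simp
  with stable show ?thesis unfolding stable_level_def by blast
qed

lemma A_def': "A = {a N i | N i. m \<le> N \<and> i < q N}"
  unfolding alph_eq[OF order_refl, symmetric] by (rule alph_Suc)

lemma finite_A: "finite A"
proof -
  obtain K where "\<And>n c. c \<in> alph q a (Suc n) \<Longrightarrow> c \<le> K" using alph_bounded by blast
  from this[of _ m] have "\<forall>c\<in>A. c \<le> K" unfolding alph_eq[OF order_refl] by blast
  then show ?thesis unfolding finite_nat_set_iff_bounded_le by blast
qed

lemma letter_in: "m \<le> n \<Longrightarrow> i < q n \<Longrightarrow> a n i \<in> A"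
  by (auto simp: A_def')

lemma min_in: "a' \<in> A"
proof -
  have "a m 0 \<in> A" using q_ge_2[of m] by (intro letter_in) auto
  then show ?thesis unfolding min_letter_def using finite_A Min_in by blast
qed

lemma A_insert: "A = insert a' B" "a' \<notin> B" "finite B"
  using min_in finite_A by (auto simp: alphB_def)

text \<open>The coefficient of \<open>v b\<close> in the sum that \<open>push n\<close>
  adds.\<close>

definition spacer_count :: "nat \<Rightarrow> nat \<Rightarrow> nat" where
  "spacer_count n b = card {i. i < q n \<and> a n i = b}"

text \<open>For \<open>b \<noteq> a'\<close> and \<open>n \<ge> m\<close>, \<open>block_count n b\<close> is the number of letters \<open>b\<close> in the image of \<open>a'\<close>
  under \<open>\<tau>\<^bsub>n0\<^esub> \<circ> \<dots> \<circ> \<tau>\<^sub>n\<close>.\<close>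

primrec block_count :: "nat \<Rightarrow> nat \<Rightarrow> nat" where
  "block_count 0 b = 0"
| "block_count (Suc n) b = (if n < m then 0 else Suc (q n) * block_count n b + spacer_count n b)"

text \<open>For \<open>n\<close> at least \<open>m\<close>, the number of blocks of level
  \<open>m\<close> in a block of level \<open>n\<close>.\<close>

definition Qn :: "nat \<Rightarrow> nat" where
  "Qn n = (\<Prod>j\<in>{m..<n}. Suc (q j))"

text \<open>\<open>push n\<close> multiplies \<open>v a'\<close> by \<open>q n + 1\<close> only up
  to a combination of the differences. The correction absorbs this, by the recursion for
  \<open>block_count\<close>, and it is 0 on level \<open>m\<close>.\<close>

definition num :: "nat \<Rightarrow> (nat \<Rightarrow> int) \<Rightarrow> int" where
  "num n v = v a' - (\<Sum>b\<in>B. int (block_count n b) * (v b - v a'))"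

definition proj :: "nat \<Rightarrow> (nat \<Rightarrow> int) \<Rightarrow> (nat \<Rightarrow> int) \<times> rat" where
  "proj n v = (\<lambda>b\<in>B. v b - v a', of_int (num n v) / of_nat (Qn n))"

lemma kap_m: "block_count m b = 0"
  by (cases m) auto

lemma Qn_pos: "0 < Qn n"
  by (simp add: Qn_def prod_pos)

lemma Qn_Suc: "m \<le> n \<Longrightarrow> Qn (Suc n) = Suc (q n) * Qn n"
  by (simp add: Qn_def)

lemma Qn_m: "Qn m = 1"
  by (simp add: Qn_def)

lemma Qn_gt: "m \<le> n \<Longrightarrow> n - m < Qn n"
proof (induction n rule: dec_induct)
  case base
  then show ?case by (simp add: Qn_pos)
next
  case (step n)
  have e: "Qn (Suc n) = Suc (q n) * Qn n" using step.hyps by (intro Qn_Suc) simp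
  have "2 * Qn n \<le> Qn (Suc n)" unfolding e using q_ge_2[of n] by (intro mult_le_mono1) simp
  with step.IH show ?case by linarith
qed

lemma sum_spacers:
  assumes "m \<le> n"
  shows "(\<Sum>i<q n. v (a n i)) = int (q n) * v a' + (\<Sum>b\<in>B. int (spacer_count n b) * (v b - v a'))"
proof -
  have "(\<Sum>i<q n. v (a n i) - v a') = (\<Sum>b\<in>A. \<Sum>i\<in>{i. i \<in> {..<q n} \<and> a n i = b}. v (a n i) - v a')"
    by (rule sum.group[symmetric]) (use finite_A letter_in[OF assms] in auto)
  also have "\<dots> = (\<Sum>b\<in>A. int (spacer_count n b) * (v b - v a'))"
    by (rule sum.cong) (auto simp: spacer_count_def)
  also have "\<dots> = (\<Sum>b\<in>B. int (spacer_count n b) * (v b - v a'))"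
    unfolding A_insert(1) using A_insert(2,3) by simp
  finally show ?thesis by (simp add: sum_subtractf)
qed

lemma push_diff: "push n v b - push n v c = v b - v c"
  by (simp add: push_def)

lemma num_push:
  assumes "m \<le> n"
  shows "num (Suc n) (push n v) = int (Suc (q n)) * num n v"
proof -
  have "num (Suc n) (push n v) = push n v a' - (\<Sum>b\<in>B. int (Suc (q n) * block_count n b + spacer_count n b) * (v b - v a'))"
    using assms by (simp add: num_def push_diff)
  also have "(\<Sum>b\<in>B. int (Suc (q n) * block_count n b + spacer_count n b) * (v b - v a')) =
      int (Suc (q n)) * (\<Sum>b\<in>B. int (block_count n b) * (v b - v a')) + (\<Sum>b\<in>B. int (spacer_count n b) * (v b - v a'))"
    unfolding sum_distrib_left sum.distrib[symmetric] by (rule sum.cong) (auto simp: algebra_simps)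
  finally show ?thesis
    unfolding push_def sum_spacers[OF assms] num_def by (simp add: algebra_simps)
qed

lemma proj_push: "m \<le> n \<Longrightarrow> proj (Suc n) (push n v) = proj n v"
  unfolding proj_def num_push Qn_Suc push_diff by (simp del: of_nat_Suc mult_Suc)

lemma proj_lift:
  assumes "m \<le> n" "n \<le> N"
  shows "\<exists>v'. proj N v' = proj n v \<and> (\<forall>f. has_tower_sum n f v \<longrightarrow> has_tower_sum N f v')"
  using assms(2)
proof (induction N rule: dec_induct)
  case (step N)
  then obtain v' where v': "proj N v' = proj n v" "\<forall>f. has_tower_sum n f v \<longrightarrow> has_tower_sum N f v'" by blast
  have "proj (Suc N) (push N v') = proj n v" using proj_push[of N v'] v' step assms by simp
  with v' has_tsum_push show ?case by blast
qed blast

lemma proj_cong: "(\<And>c. c \<in> A \<Longrightarrow> v c = v' c) \<Longrightarrow> proj n v = proj n v'"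
  unfolding proj_def num_def using A_insert by (auto intro!: restrict_ext sum.cong)

text \<open>The system is triangular: the correction in \<open>num\<close> involves only the
  differences, which \<open>proj\<close> shows directly, so \<open>v a'\<close> can be
  recovered.\<close>

lemma proj_inj:
  assumes "proj n v = proj n v'" "c \<in> A"
  shows "v c = v' c"
proof -
  have 1: "v b - v a' = v' b - v' a'" if "b \<in> B" for b
    using assms(1) that unfolding proj_def by (metis (no_types, lifting) Pair_inject restrict_apply')
  have "num n v = num n v'" using assms(1) Qn_pos[of n] by (simp add: proj_def)
  moreover have "(\<Sum>b\<in>B. int (block_count n b) * (v b - v a')) = (\<Sum>b\<in>B. int (block_count n b) * (v' b - v' a'))"
    by (rule sum.cong) (auto simp: 1)
  ultimately have "v a' = v' a'" by (simp add: num_def)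
  then show ?thesis using 1[of c] assms(2) A_insert(1) by auto
qed

lemma proj_0: "proj n (\<lambda>_. 0) = (\<lambda>b\<in>B. 0, 0)"
  by (simp add: proj_def num_def)

lemma proj_add: "proj n (\<lambda>c. v c + v' c) = (\<lambda>b\<in>B. fst (proj n v) b + fst (proj n v') b, snd (proj n v) + snd (proj n v'))"
proof -
  have "num n (\<lambda>c. v c + v' c) = num n v + num n v'"
    by (simp add: num_def sum.distrib[symmetric] algebra_simps)
  then show ?thesis by (auto simp: proj_def add_divide_distrib restrict_def fun_eq_iff)
qed

section \<open>Carrier and group laws of \<open>GW\<close>\<close>

lemma frac_carrier: "carrier (frac_group (\<lambda>n. q n + 1) m) = {of_int k / of_nat (Qn (Suc n)) | k n. m \<le> n}"
  by (simp add: frac_group_def Qn_def atLeastLessThanSuc_atLeastAtMost)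

lemma carrier_GW: "carrier (GW q a n0) = (\<Pi>\<^sub>E b\<in>B. UNIV) \<times> {of_int k / of_nat (Qn (Suc n)) | k n. m \<le> n}"
  unfolding GW_def carrier_DirProd frac_carrier by simp

lemma proj_in_GW: "m \<le> n \<Longrightarrow> proj n v \<in> carrier (GW q a n0)"
  \<comment> \<open>Denominators in \<open>frac_group\<close> have at least one factor, so they are
    \<open>Qn (Suc n)\<close>; one push brings the vector into this form even on level
    \<open>m\<close>, where \<open>Qn\<close> is 1.\<close>
  unfolding carrier_GW proj_push[symmetric, of n v] by (subst proj_def) (auto simp del: of_nat_Suc)

lemma proj_surj:
  assumes "g \<in> carrier (GW q a n0)"
  obtains n v where "m \<le> n" "g = proj n v"
proof -
  obtain x k n where g: "g = (x, of_int k / of_nat (Qn (Suc n)))" "x \<in> extensional B" "m \<le> n"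
    using assms unfolding carrier_GW by (auto simp: PiE_def)
  \<comment> \<open>The required entry at \<open>a'\<close>, found by solving the equation that
    defines \<open>num\<close> for it.\<close>
  define t where "t = k + (\<Sum>b\<in>B. int (block_count (Suc n) b) * x b)"
  define v where "v c = t + (if c \<in> B then x c else 0)" for c
  have d: "v b - v a' = x b" if "b \<in> B" for b using that A_insert(2) by (simp add: v_def)
  have "(\<Sum>b\<in>B. int (block_count (Suc n) b) * (v b - v a')) = (\<Sum>b\<in>B. int (block_count (Suc n) b) * x b)"
    by (rule sum.cong) (auto simp: d)
  then have "num (Suc n) v = k" using A_insert(2) by (simp add: num_def v_def t_def)
  moreover have "(\<lambda>b\<in>B. v b - v a') = x"
    using g(2) d by (auto simp: extensional_def restrict_def fun_eq_iff)
  ultimately have "proj (Suc n) v = g" by (simp add: proj_def g(1))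
  then show thesis using g(3) by (intro that[of "Suc n" v]) auto
qed

lemma Qn_dvd: "m \<le> n \<Longrightarrow> n \<le> N \<Longrightarrow> Qn n dvd Qn N"
  unfolding Qn_def by (intro prod_dvd_prod_subset) auto

lemma frac_common:
  assumes "g \<in> {of_int k / of_nat (Qn (Suc n)) | k n. m \<le> n}"
  shows "\<exists>n\<ge>m. \<forall>N\<ge>n. \<exists>k. g = (of_int k / of_nat (Qn (Suc N)) :: rat)"
proof -
  obtain k n where g: "g = of_int k / of_nat (Qn (Suc n))" "m \<le> n" using assms by blast
  have "\<exists>k. g = of_int k / of_nat (Qn (Suc N))" if "n \<le> N" for N
  proof -
    have "Qn (Suc n) dvd Qn (Suc N)" using g(2) that by (intro Qn_dvd) auto
    then obtain d where d: "Qn (Suc N) = Qn (Suc n) * d" by (rule dvdE)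
    then have "d \<noteq> 0" using Qn_pos[of "Suc N"] by (intro notI) simp
    then have "g = of_int (k * int d) / of_nat (Qn (Suc N))" by (simp add: g(1) d)
    then show ?thesis by blast
  qed
  with g(2) show ?thesis by blast
qed

lemma group_frac: "group (frac_group (\<lambda>n. q n + 1) m)"
proof (rule groupI)
  let ?G = "frac_group (\<lambda>n. q n + 1) m"
  have one: "\<one>\<^bsub>?G\<^esub> = 0" and mult: "x \<otimes>\<^bsub>?G\<^esub> y = x + y" for x y by (simp_all add: frac_group_def)
  show "\<one>\<^bsub>?G\<^esub> \<in> carrier ?G"
    unfolding frac_carrier one by (auto intro!: exI[of _ 0] exI[of _ m])
  fix x y assume x: "x \<in> carrier ?G" and y: "y \<in> carrier ?G"
  obtain n where n: "m \<le> n" "\<forall>N\<ge>n. \<exists>k. x = of_int k / of_nat (Qn (Suc N))"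
    using frac_common[OF x[unfolded frac_carrier]] by blast
  obtain n' where n': "\<forall>N\<ge>n'. \<exists>k. y = of_int k / of_nat (Qn (Suc N))"
    using frac_common[OF y[unfolded frac_carrier]] by blast
  obtain k where "x = of_int k / of_nat (Qn (Suc (max n n')))"
    using n(2)[rule_format, of "max n n'"] by auto
  moreover obtain k' where "y = of_int k' / of_nat (Qn (Suc (max n n')))"
    using n'[rule_format, of "max n n'"] by auto
  ultimately have "x + y = of_int (k + k') / of_nat (Qn (Suc (max n n')))" by (simp add: add_divide_distrib)
  moreover have "m \<le> max n n'" using n(1) by simp
  ultimately show "x \<otimes>\<^bsub>?G\<^esub> y \<in> carrier ?G" unfolding frac_carrier mult by blast
next
  let ?G = "frac_group (\<lambda>n. q n + 1) m"
  have one: "\<one>\<^bsub>?G\<^esub> = 0" and mult: "x \<otimes>\<^bsub>?G\<^esub> y = x + y" for x y by (simp_all add: frac_group_def)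
  fix x assume x: "x \<in> carrier ?G"
  show "\<one>\<^bsub>?G\<^esub> \<otimes>\<^bsub>?G\<^esub> x = x" unfolding one mult by simp
  from x obtain k n where k: "x = of_int k / of_nat (Qn (Suc n))" "m \<le> n" unfolding frac_carrier by blast
  have "of_int (- k) / of_nat (Qn (Suc n)) \<in> carrier ?G" unfolding frac_carrier using k(2) by blast
  moreover have "of_int (- k) / of_nat (Qn (Suc n)) \<otimes>\<^bsub>?G\<^esub> x = \<one>\<^bsub>?G\<^esub>" unfolding one mult k(1) by simp
  ultimately show "\<exists>y\<in>carrier ?G. y \<otimes>\<^bsub>?G\<^esub> x = \<one>\<^bsub>?G\<^esub>" by blast
  fix y z
  show "x \<otimes>\<^bsub>?G\<^esub> y \<otimes>\<^bsub>?G\<^esub> z = x \<otimes>\<^bsub>?G\<^esub> (y \<otimes>\<^bsub>?G\<^esub> z)" unfolding mult by simp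
qed

lemma group_GW: "group (GW q a n0)"
  unfolding GW_def by (rule DirProd_group[OF _ group_frac]) simp

lemma mult_GW: "g \<otimes>\<^bsub>GW q a n0\<^esub> g' = (\<lambda>b\<in>B. fst g b + fst g' b, snd g + snd g')"
  by (simp add: GW_def mult_DirProd' frac_group_def)

lemma one_GW: "\<one>\<^bsub>GW q a n0\<^esub> = (\<lambda>b\<in>B. 0, 0)"
  by (simp add: GW_def frac_group_def)

text \<open>Coordinates of a cohomology class, free of choices: representative, level and vector are
  quantified away, and \<open>rel_unique\<close> shows that they do not matter.\<close>

definition rel :: "((int \<Rightarrow> nat) \<Rightarrow> int) \<Rightarrow> (nat \<Rightarrow> int) \<times> rat \<Rightarrow> bool" where
  "rel f g \<longleftrightarrow> (\<exists>\<phi> n v. loc_const X \<phi> \<and> is_coboundary (\<lambda>x. f x - \<phi> x) \<and> m \<le> n \<and> has_tower_sum n \<phi> v \<and> g = proj n v)"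

lemma rel_ex:
  assumes "loc_const X f"
  shows "\<exists>g. rel f g"
proof (rule ex_has_tsum[OF assms, of m])
  fix \<phi> n v
  assume "loc_const X \<phi>" "is_coboundary (\<lambda>x. f x - \<phi> x)" "m \<le> n" "has_tower_sum n \<phi> v"
  then have "rel f (proj n v)" unfolding rel_def by blast
  then show ?thesis by blast
qed

text \<open>The two representatives differ by a coboundary that has tower sums on a common level, so
  these vanish on some higher level \<open>M\<close>; there both vectors agree on
  \<open>A\<close>.\<close>

lemma rel_unique:
  assumes "rel f g" "rel f g'"
  shows "g = g'"
proof -
  obtain \<phi> n v where 1: "loc_const X \<phi>" "is_coboundary (\<lambda>x. f x - \<phi> x)" "m \<le> n" "has_tower_sum n \<phi> v" "g = proj n v"
    using assms(1) unfolding rel_def by blast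
  obtain \<phi>' n' v' where 2: "loc_const X \<phi>'" "is_coboundary (\<lambda>x. f x - \<phi>' x)" "m \<le> n'" "has_tower_sum n' \<phi>' v'" "g' = proj n' v'"
    using assms(2) unfolding rel_def by blast
  define N where "N = max n n'"
  have N: "n \<le> N" "n' \<le> N" by (auto simp: N_def)
  obtain w where w: "proj N w = g" "has_tower_sum N \<phi> w" using proj_lift[OF 1(3) N(1)] 1(4,5) by blast
  obtain w' where w': "proj N w' = g'" "has_tower_sum N \<phi>' w'" using proj_lift[OF 2(3) N(2)] 2(4,5) by blast
  have "is_coboundary (\<lambda>x. (f x - \<phi>' x) - (f x - \<phi> x))" by (rule cob_diff[OF 2(2) 1(2)])
  then have c: "is_coboundary (\<lambda>x. \<phi> x - \<phi>' x)" by simp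
  from coboundary_has_tsum_zero[OF c has_tsum_diff[OF w(2) w'(2)]]
  obtain M where M: "N \<le> M" "\<And>v c. has_tower_sum M (\<lambda>x. \<phi> x - \<phi>' x) v \<Longrightarrow> c \<in> alph q a (Suc M) \<Longrightarrow> v c = 0"
    by blast
  have mN: "m \<le> N" using 1(3) N by simp
  obtain z where z: "proj M z = g" "has_tower_sum M \<phi> z" using proj_lift[OF mN M(1), of w] w by metis
  obtain z' where z': "proj M z' = g'" "has_tower_sum M \<phi>' z'" using proj_lift[OF mN M(1), of w'] w' by metis
  have "z c = z' c" if "c \<in> A" for c
    using M(2)[OF has_tsum_diff[OF z(2) z'(2)], of c] alph_eq[of M] that mN M(1) by simp
  then have "proj M z = proj M z'" by (rule proj_cong)
  with z z' show ?thesis by simp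
qed

lemma rel_add:
  assumes "rel f g" "rel f' g'"
  shows "rel (\<lambda>x. f x + f' x) (g \<otimes>\<^bsub>GW q a n0\<^esub> g')"
proof -
  obtain \<phi> n v where 1: "loc_const X \<phi>" "is_coboundary (\<lambda>x. f x - \<phi> x)" "m \<le> n" "has_tower_sum n \<phi> v" "g = proj n v"
    using assms(1) unfolding rel_def by blast
  obtain \<phi>' n' v' where 2: "loc_const X \<phi>'" "is_coboundary (\<lambda>x. f' x - \<phi>' x)" "m \<le> n'" "has_tower_sum n' \<phi>' v'" "g' = proj n' v'"
    using assms(2) unfolding rel_def by blast
  define N where "N = max n n'"
  have N: "n \<le> N" "n' \<le> N" by (auto simp: N_def)
  obtain w where w: "proj N w = g" "has_tower_sum N \<phi> w" using proj_lift[OF 1(3) N(1)] 1(4,5) by blast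
  obtain w' where w': "proj N w' = g'" "has_tower_sum N \<phi>' w'" using proj_lift[OF 2(3) N(2)] 2(4,5) by blast
  have "is_coboundary (\<lambda>x. (f x - \<phi> x) + (f' x - \<phi>' x))" by (rule cob_add[OF 1(2) 2(2)])
  then have "is_coboundary (\<lambda>x. (f x + f' x) - (\<phi> x + \<phi>' x))" by (simp add: algebra_simps)
  moreover have "loc_const X (\<lambda>x. \<phi> x + \<phi>' x)" by (rule loc_const_comp2[where H = "(+)", OF 1(1) 2(1)])
  moreover have "g \<otimes>\<^bsub>GW q a n0\<^esub> g' = proj N (\<lambda>c. w c + w' c)"
    unfolding mult_GW proj_add w w' ..
  moreover have "m \<le> N" using 1(3) N by simp
  ultimately show ?thesis unfolding rel_def using has_tsum_add[OF w(2) w'(2)] by blast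
qed

text \<open>Coordinates 0 force the vector to vanish on \<open>A\<close> by \<open>proj_inj\<close>,
  and a function with zero tower sums is a coboundary.\<close>

lemma rel_0_iff:
  assumes "loc_const X f"
  shows "rel f (\<lambda>b\<in>B. 0, 0) \<longleftrightarrow> is_coboundary f"
proof
  assume "rel f (\<lambda>b\<in>B. 0, 0)"
  then obtain \<phi> n v where 1: "loc_const X \<phi>" "is_coboundary (\<lambda>x. f x - \<phi> x)" "m \<le> n" "has_tower_sum n \<phi> v"
    "proj n v = (\<lambda>b\<in>B. 0, 0)"
    unfolding rel_def by metis
  then have "proj n v = proj n (\<lambda>_. 0)" by (simp add: proj_0)
  from proj_inj[OF this] have "has_tower_sum n \<phi> (\<lambda>_. 0)"
    using has_tsum_cong[OF 1(4)] alph_eq[OF 1(3)] by simp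
  from cob_of_zero_tsum[OF 1(1) this] have "is_coboundary \<phi>" .
  from cob_add[OF 1(2) this] show "is_coboundary f" by simp
next
  assume "is_coboundary f"
  then have "is_coboundary (\<lambda>x. f x - 0)" by simp
  moreover have "has_tower_sum m (\<lambda>x. 0) (\<lambda>_. 0)" by (simp add: has_tower_sum_def tower_sum_def)
  ultimately show "rel f (\<lambda>b\<in>B. 0, 0)"
    unfolding rel_def by (intro exI[of _ "\<lambda>x. 0"] exI[of _ m] exI[of _ "\<lambda>_. 0"]) (simp add: proj_0)
qed

lemma rel_cong:
  assumes "\<And>x. x \<in> X \<Longrightarrow> f x = f' x" "rel f g"
  shows "rel f' g"
proof -
  have "is_coboundary (\<lambda>x. f x - \<phi> x) \<longleftrightarrow> is_coboundary (\<lambda>x. f' x - \<phi> x)" for \<phi>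
    by (rule cob_cong) (simp add: assms(1))
  with assms(2) show ?thesis by (simp add: rel_def)
qed

lemma rel_chi: "m \<le> n \<Longrightarrow> rel (chi n v) (proj n v)"
  unfolding rel_def
  by (intro exI[of _ "chi n v"] exI[of _ n] exI[of _ v]) (simp add: loc_const_chi has_tsum_chi cob_0)

lemma rel_in_GW: "rel f g \<Longrightarrow> g \<in> carrier (GW q a n0)"
  unfolding rel_def using proj_in_GW by blast

end

section \<open>Letter frequencies in the subshift generated by the directive sequence\<close>

text \<open>A factor consists of a suffix of one word, complete words and a prefix of another, or
  lies inside one word. Complete words satisfy both estimates without error; each of the at most two
  incomplete ones costs one multiple of \<open>Q\<close>.\<close>

lemma count_list_sublist_concat:
  assumes "\<And>w. w \<in> set ws \<Longrightarrow> length w = Q \<and> K \<le> count_list w b \<and> count_list w b \<le> Suc K"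
    and "sublist u (concat ws)"
  shows "K * length u \<le> Q * count_list u b + 2 * Q * K"
    and "Q * count_list u b \<le> Suc K * length u + 2 * Q * Suc K"
proof -
  \<comment> \<open>\<open>e\<close> counts the incomplete words allowed at the ends of
    \<open>u\<close>.\<close>
  define P where "P e u \<longleftrightarrow> K * length u \<le> Q * count_list u b + e * (Q * K) \<and>
    Q * count_list u b \<le> Suc K * length u + e * (Q * Suc K)" for e u
  have piece: "P 1 xs" if w: "w \<in> set ws" "sublist xs w"
    and h: "\<And>w. w \<in> set ws \<Longrightarrow> length w = Q \<and> K \<le> count_list w b \<and> count_list w b \<le> Suc K"
    for ws w xs
  proof -
    obtain ps ss where e: "w = ps @ xs @ ss" using w(2) by (auto simp: sublist_def)
    have "length xs \<le> length w" "count_list xs b \<le> count_list w b" by (auto simp: e)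
    then have l: "length xs \<le> Q" "count_list xs b \<le> Suc K" using h[OF w(1)] by auto
    have "K * length xs \<le> K * Q" by (rule mult_le_mono2[OF l(1)])
    moreover have "Q * count_list xs b \<le> Q * Suc K" by (rule mult_le_mono2[OF l(2)])
    ultimately show ?thesis unfolding P_def mult_1 mult.commute[of K Q] by linarith
  qed
  have pre: "P 1 u" if "\<And>w. w \<in> set ws \<Longrightarrow> length w = Q \<and> K \<le> count_list w b \<and> count_list w b \<le> Suc K"
    "prefix u (concat ws)" for ws u
    using that
  proof (induction ws arbitrary: u)
    case Nil
    then show ?case by (simp add: P_def)
  next
    case (Cons w ws)
    from Cons.prems(2) consider "prefix u w" | u' where "u = w @ u'" "prefix u' (concat ws)"
      by (auto simp: prefix_append)
    then show ?case
    proof cases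
      case 1
      then have "sublist u w" by (rule prefix_imp_sublist)
      then show ?thesis by (intro piece[of w "w # ws"]) (use Cons.prems(1) in auto)
    next
      case 2
      have w: "length w = Q" "K \<le> count_list w b" "count_list w b \<le> Suc K" using Cons.prems(1)[of w] by auto
      have "P 1 u'" using Cons.prems(1) 2(2) by (intro Cons.IH) auto
      moreover have "Q * K \<le> Q * count_list w b" by (rule mult_le_mono2[OF w(2)])
      moreover have "Q * count_list w b \<le> Q * Suc K" by (rule mult_le_mono2[OF w(3)])
      ultimately show ?thesis unfolding P_def 2(1)
          length_append count_list_append w(1) mult_1 add_mult_distrib2 mult_Suc mult_Suc_right mult.commute[of K Q]
        by linarith
    qed
  qed
  have "P 2 u" using assms
  proof (induction ws arbitrary: u)
    case Nil
    then show ?case by (simp add: P_def)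
  next
    case (Cons w ws)
    from Cons.prems(2) consider "sublist u w" | "sublist u (concat ws)"
      | xs ys where "u = xs @ ys" "suffix xs w" "prefix ys (concat ws)"
      by (auto simp: sublist_append)
    then show ?case
    proof cases
      case 1
      then have "P 1 u" by (intro piece[of w "w # ws"]) (use Cons.prems(1) in auto)
      then show ?thesis unfolding P_def by linarith
    next
      case 2
      then show ?thesis using Cons.prems(1) by (intro Cons.IH) auto
    next
      case 3
      have "P 1 xs" by (rule piece[of w "w # ws"]) (use Cons.prems(1) suffix_imp_sublist[OF 3(2)] in auto)
      moreover have "P 1 ys" using Cons.prems(1) 3(3) by (intro pre[of ws]) auto
      ultimately show ?thesis unfolding P_def 3(1)
          length_append count_list_append mult_1 add_mult_distrib2 mult_Suc mult_Suc_right mult.commute[of K Q]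
        by linarith
    qed
  qed
  then show "K * length u \<le> Q * count_list u b + 2 * Q * K"
    "Q * count_list u b \<le> Suc K * length u + 2 * Q * Suc K"
    by (simp_all add: P_def mult.assoc)
qed

lemma foldr_extend_append:
  "foldr (\<lambda>n. extend_morphism (\<tau> n)) ns (u @ v) =
   foldr (\<lambda>n. extend_morphism (\<tau> n)) ns u @ foldr (\<lambda>n. extend_morphism (\<tau> n)) ns v"
  by (induction ns) (auto simp: extend_morphism_def)

lemma foldr_extend_Nil: "foldr (\<lambda>n. extend_morphism (\<tau> n)) ns [] = []"
  by (induction ns) (auto simp: extend_morphism_def)

lemma tau_comp_concat: "tau_comp q a k n u = concat (map (\<lambda>c. tau_comp q a k n [c]) u)"
proof (induction u)
  case Nil
  then show ?case by (simp add: tau_comp_def foldr_extend_Nil)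
next
  case (Cons c u)
  have "tau_comp q a k n (c # u) = tau_comp q a k n [c] @ tau_comp q a k n u"
    unfolding tau_comp_def using foldr_extend_append[of "tau q a" "[k..<n]" "[c]" u] by simp
  with Cons show ?case by simp
qed

lemma tau_comp_split:
  assumes "k \<le> n" "n \<le> N"
  shows "tau_comp q a k N u = tau_comp q a k n (tau_comp q a n N u)"
proof -
  have "[k..<N] = [k..<n] @ [n..<N]" using upt_add_eq_append[of k n "N - n"] assms by simp
  then show ?thesis by (simp add: tau_comp_def)
qed

lemma le_0_if_linear_bounded:
  assumes "\<And>L::nat. L0 < L \<Longrightarrow> e * real L \<le> C"
  shows "e \<le> (0::real)"
proof (rule ccontr)
  assume "\<not> e \<le> 0"
  then have e: "0 < e" by simp
  obtain L :: nat where L: "\<bar>C\<bar> / e < real L" using reals_Archimedean2 by blast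
  define L' where "L' = max L (Suc L0)"
  have "\<bar>C\<bar> / e < real L'" using L by (simp add: L'_def)
  then have "\<bar>C\<bar> < e * real L'" using e by (simp add: field_simps)
  moreover have "e * real L' \<le> C" by (rule assms) (simp add: L'_def)
  ultimately show False by simp
qed

lemma count_list_upto:
  "count_list (map x [0..int L - 1]) b = (\<Sum>j<L. if x (int j) = b then 1 else 0)"
proof (induction L)
  case (Suc L)
  have "[0..int (Suc L) - 1] = [0..int L - 1] @ [int L]" using upto_rec2[of 0 "int L"] by simp
  with Suc show ?case by simp
qed simp

lemma open_coord: "open {x :: int \<Rightarrow> nat. x j = b}"
proof (subst open_subopen, intro ballI)
  fix x assume x: "x \<in> {x :: int \<Rightarrow> nat. x j = b}"
  show "\<exists>T. open T \<and> x \<in> T \<and> T \<subseteq> {x. x j = b}"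
    using x by (intro exI[of _ "{y. agree (nat \<bar>j\<bar>) x y}"] conjI open_agree) (auto simp: agree_def)
qed

text \<open>Integrating the number of occurrences of \<open>b\<close> in a long window turns uniform bounds for that
  number into bounds for the measure of the cylinder.\<close>

lemma cylinder_measure_bounds:
  assumes inv: "invariant_probability T shift M"
    and lo: "\<And>x L. x \<in> T \<Longrightarrow> L0 < L \<Longrightarrow> c * real L - d \<le> real (count_list (map x [0..int L - 1]) b)"
    and hi: "\<And>x L. x \<in> T \<Longrightarrow> L0 < L \<Longrightarrow> real (count_list (map x [0..int L - 1]) b) \<le> c' * real L + d'"
  shows "c \<le> measure M {x \<in> T. x 0 = b}" "measure M {x \<in> T. x 0 = b} \<le> c'"
proof -
  interpret prob_space M using inv by (simp add: invariant_probability_def)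
  have sets: "sets M = sets (restrict_space borel T)" and sh: "shift \<in> measurable M M"
    and dis: "distr M M shift = M"
    using inv by (auto simp: invariant_probability_def)
  have sp: "space M = T" using sets_eq_imp_space_eq[OF sets] by (simp add: space_restrict_space)
  have meas: "{x \<in> T. x j = b} \<in> sets M" for j
  proof -
    have "{x \<in> T. x j = b} = T \<inter> {x. x j = b}" by auto
    moreover have "{x :: int \<Rightarrow> nat. x j = b} \<in> sets borel" using open_coord by simp
    ultimately show ?thesis unfolding sets sets_restrict_space by blast
  qed
  define \<mu> where "\<mu> = measure M {x \<in> T. x 0 = b}"
  \<comment> \<open>By invariance, the position of the prescribed letter does not affect the measure
    of the cylinder.\<close>
  have eq: "measure M {x \<in> T. x (int j) = b} = \<mu>" for j
  proof (induction j)
    case 0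
    then show ?case by (simp add: \<mu>_def)
  next
    case (Suc j)
    have "measure M {x \<in> T. x (int j) = b} = measure (distr M M shift) {x \<in> T. x (int j) = b}"
      unfolding dis ..
    also have "\<dots> = measure M (shift -` {x \<in> T. x (int j) = b} \<inter> space M)"
      by (rule measure_distr[OF sh meas])
    also have "shift -` {x \<in> T. x (int j) = b} \<inter> space M = {x \<in> T. x (int (Suc j)) = b}"
      using measurable_space[OF sh] unfolding sp by (auto simp: shift_def add.commute)
    finally show ?case using Suc by simp
  qed
  have int: "integrable M (indicat_real {x \<in> T. x (int j) = b})" for j
    by (intro integrable_real_indicator meas) (simp add: emeasure_eq_measure)
  have exp: "expectation (\<lambda>x. \<Sum>j<L. indicat_real {x \<in> T. x (int j) = b} x) = real L * \<mu>" for L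
  proof -
    have "expectation (\<lambda>x. \<Sum>j<L. indicat_real {x \<in> T. x (int j) = b} x) =
        (\<Sum>j<L. expectation (indicat_real {x \<in> T. x (int j) = b}))"
      by (rule Bochner_Integration.integral_sum) (rule int)
    also have "\<dots> = (\<Sum>j<L. \<mu>)"
      using meas by (intro sum.cong) (simp_all add: eq)
    finally show ?thesis by simp
  qed
  have isum: "integrable M (\<lambda>x. \<Sum>j<L. indicat_real {x \<in> T. x (int j) = b} x)" for L
    by (rule Bochner_Integration.integrable_sum) (rule int)
  have cnt: "(\<Sum>j<L. indicat_real {x \<in> T. x (int j) = b} x) = real (count_list (map x [0..int L - 1]) b)"
    if "x \<in> T" for x L
    unfolding count_list_upto of_nat_sum using that by (intro sum.cong) (auto simp: indicator_def)
  have "c * real L - d \<le> real L * \<mu>" "real L * \<mu> \<le> c' * real L + d'" if "L0 < L" for L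
  proof -
    show "c * real L - d \<le> real L * \<mu>"
      unfolding exp[symmetric]
      by (rule integral_ge_const[OF isum], rule AE_I2) (use lo[OF _ that] cnt sp in auto)
    show "real L * \<mu> \<le> c' * real L + d'"
      unfolding exp[symmetric]
      by (rule integral_le_const[OF isum], rule AE_I2) (use hi[OF _ that] cnt sp in auto)
  qed
  note bd = this
  \<comment> \<open>The bounds hold for all large \<open>L\<close>, so the constants
    \<open>d\<close> and \<open>d'\<close> disappear in the limit.\<close>
  have "c - \<mu> \<le> 0" by (rule le_0_if_linear_bounded[of L0 _ d]) (use bd(1) in \<open>force simp: algebra_simps\<close>)
  moreover have "\<mu> - c' \<le> 0" by (rule le_0_if_linear_bounded[of L0 _ d']) (use bd(2) in \<open>force simp: algebra_simps\<close>)
  ultimately show "c \<le> measure M {x \<in> T. x 0 = b}" "measure M {x \<in> T. x 0 = b} \<le> c'"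
    by (simp_all add: \<mu>_def)
qed

context ferenczi_level
begin

lemma n0_Suc: "n0 = Suc m"
  using stable by (simp add: stable_level_def)

text \<open>Up to order, the image of \<open>c\<close> consists of the spacers \<open>a n 0\<close>,
  ..., \<open>a n (q n - 1)\<close> and of \<open>c\<close> itself; the first spacer is merely moved
  to the end.\<close>

lemma count_list_tau:
  "count_list (tau q a (Suc n) c) b = spacer_count n b + (if c = b then 1 else 0)"
proof -
  have "[0..<q n] = 0 # [1..<q n]" using q_ge_2[of n] upt_conv_Cons[of 0 "q n"] by simp
  moreover have "spacer_count n b = count_list (map (a n) [0..<q n]) b"
    unfolding spacer_count_def count_list_eq_length_filter length_filter_conv_card
    by (rule arg_cong[where f = card]) auto
  ultimately have "spacer_count n b = (if a n 0 = b then 1 else 0) + count_list (map (a n) [1..<q n]) b" by simp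
  then show ?thesis by (simp add: tau_def)
qed

lemma length_tau: "length (tau q a (Suc n) c) = Suc (q n)"
  using q_ge_2[of n] by (simp add: tau_def)

text \<open>Substituting the words of one level into the image under \<open>tau q a (Suc n)\<close>
  yields the recursions of \<open>Qn\<close> and \<open>block_count\<close>; the letter
  \<open>c\<close> survives as one extra occurrence.\<close>

lemma tau_comp_letter:
  assumes "m \<le> n"
  shows "length (tau_comp q a n0 (Suc n) [c]) = Qn n"
    "count_list (tau_comp q a n0 (Suc n) [c]) b = block_count n b + (if c = b then 1 else 0)"
proof -
  have "\<forall>c. length (tau_comp q a n0 (Suc n) [c]) = Qn n \<and>
    count_list (tau_comp q a n0 (Suc n) [c]) b = block_count n b + (if c = b then 1 else 0)"
    using assms
  proof (induction n rule: dec_induct)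
    case base
    show ?case unfolding n0_Suc[symmetric] Qn_m kap_m by (simp add: tau_comp_def)
  next
    case (step n)
    show ?case
    proof
      fix c
      let ?t = "\<lambda>c. tau_comp q a n0 (Suc n) [c]"
      have "tau_comp q a n0 (Suc (Suc n)) [c] = tau_comp q a n0 (Suc n) (tau q a (Suc n) c)"
      proof -
        have "n0 \<le> Suc n" using step.hyps n0_Suc by linarith
        then have "tau_comp q a n0 (Suc (Suc n)) [c] =
            tau_comp q a n0 (Suc n) (tau_comp q a (Suc n) (Suc (Suc n)) [c])"
          by (rule tau_comp_split) simp
        also have "tau_comp q a (Suc n) (Suc (Suc n)) [c] = tau q a (Suc n) c"
          by (simp add: tau_comp_def extend_morphism_def)
        finally show ?thesis .
      qed
      then have e: "tau_comp q a n0 (Suc (Suc n)) [c] = concat (map ?t (tau q a (Suc n) c))"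
        by (subst (asm) tau_comp_concat)
      have len: "length (concat (map ?t u)) = length u * Qn n" for u
        using step.IH by (induction u) auto
      have cnt: "count_list (concat (map ?t u)) b = length u * block_count n b + count_list u b" for u
        using step.IH by (induction u) auto
      have "block_count (Suc n) b = Suc (q n) * block_count n b + spacer_count n b" using step.hyps by simp
      then show "length (tau_comp q a n0 (Suc (Suc n)) [c]) = Qn (Suc n) \<and>
        count_list (tau_comp q a n0 (Suc (Suc n)) [c]) b = block_count (Suc n) b + (if c = b then 1 else 0)"
        unfolding e len cnt length_tau count_list_tau using Qn_Suc[of n] step.hyps by simp
    qed
  qed
  then show "length (tau_comp q a n0 (Suc n) [c]) = Qn n"
    "count_list (tau_comp q a n0 (Suc n) [c]) b = block_count n b + (if c = b then 1 else 0)" by auto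
qed

text \<open>The window lies in a concatenation of images of letters under one and the same
  composition. All of these have length \<open>Qn n\<close> and contain \<open>b\<close> either
  \<open>block_count n b\<close> times or once more.\<close>

lemma window_count:
  assumes n: "m \<le> n" and x: "x \<in> tau_hat_subshift q a n0" and L: "Qn n < L"
  shows "block_count n b * L \<le> Qn n * count_list (map x [0..int L - 1]) b + 2 * Qn n * block_count n b"
    and "Qn n * count_list (map x [0..int L - 1]) b \<le> Suc (block_count n b) * L + 2 * Qn n * Suc (block_count n b)"
proof -
  let ?u = "map x [0..int L - 1]"
  have "factor_of ?u x" unfolding factor_of_def by blast
  then obtain N c where N: "n0 < N" "sublist ?u (tau_comp q a n0 N [c])"
    using x unfolding tau_hat_subshift_def by blast
  have lu: "length ?u = L" by simp
  have "N = Suc (N - 1)" "m \<le> N - 1" using N(1) by linarith+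
  then obtain k where k: "N = Suc k" "m \<le> k" by blast
  have "L \<le> Qn k" using sublist_length_le[OF N(2)] tau_comp_letter(1)[OF k(2)] k(1) by simp
  \<comment> \<open>A window longer than \<open>Qn n\<close> fits only into a word of level at least
    \<open>n\<close>, which can then be cut into words of length \<open>Qn n\<close>.\<close>
  have "n \<le> k"
  proof (rule ccontr)
    assume "\<not> n \<le> k"
    then have "Qn k dvd Qn n" using k(2) by (intro Qn_dvd) auto
    then have "Qn k \<le> Qn n" using Qn_pos by (intro dvd_imp_le)
    with L \<open>L \<le> Qn k\<close> show False by simp
  qed
  let ?ws = "map (\<lambda>c. tau_comp q a n0 (Suc n) [c]) (tau_comp q a (Suc n) N [c])"
  have "tau_comp q a n0 N [c] = tau_comp q a n0 (Suc n) (tau_comp q a (Suc n) N [c])"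
    using n n0_Suc \<open>n \<le> k\<close> k(1) by (intro tau_comp_split) linarith+
  also have "\<dots> = concat ?ws" by (rule tau_comp_concat)
  finally have s: "sublist ?u (concat ?ws)" using N(2) by simp
  have h: "length w = Qn n \<and> block_count n b \<le> count_list w b \<and> count_list w b \<le> Suc (block_count n b)"
    if "w \<in> set ?ws" for w
    using that tau_comp_letter[OF n] by auto
  show "block_count n b * L \<le> Qn n * count_list ?u b + 2 * Qn n * block_count n b"
    using count_list_sublist_concat(1)[OF h s] unfolding lu .
  show "Qn n * count_list ?u b \<le> Suc (block_count n b) * L + 2 * Qn n * Suc (block_count n b)"
    using count_list_sublist_concat(2)[OF h s] unfolding lu .
qed

text \<open>Obtained by dividing \<open>window_count\<close> by \<open>Qn n\<close> and integrating.
  As the level is arbitrary, these bounds determine the measure of the cylinder.\<close>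

lemma kap_frequency:
  assumes inv: "invariant_probability (tau_hat_subshift q a n0) shift M" and n: "m \<le> n"
  shows "real (block_count n b) \<le> real (Qn n) * measure M {x \<in> tau_hat_subshift q a n0. x 0 = b}"
    and "real (Qn n) * measure M {x \<in> tau_hat_subshift q a n0. x 0 = b} \<le> real (block_count n b) + 1"
proof -
  let ?T = "tau_hat_subshift q a n0" and ?Q = "real (Qn n)" and ?K = "real (block_count n b)"
  have Q: "0 < ?Q" using Qn_pos by simp
  have lo: "?K / ?Q * real L - 2 * ?K \<le> real (count_list (map x [0..int L - 1]) b)"
    if "x \<in> ?T" "Qn n < L" for x L
  proof -
    have "real (block_count n b * L) \<le> real (Qn n * count_list (map x [0..int L - 1]) b + 2 * Qn n * block_count n b)"
      using window_count(1)[OF n that, of b] by (rule of_nat_mono)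
    then show ?thesis using Q by (simp add: field_simps)
  qed
  have hi: "real (count_list (map x [0..int L - 1]) b) \<le> (?K + 1) / ?Q * real L + 2 * (?K + 1)"
    if "x \<in> ?T" "Qn n < L" for x L
  proof -
    have "real (Qn n * count_list (map x [0..int L - 1]) b) \<le> real (Suc (block_count n b) * L + 2 * Qn n * Suc (block_count n b))"
      using window_count(2)[OF n that, of b] by (rule of_nat_mono)
    then show ?thesis using Q by (simp add: field_simps)
  qed
  from cylinder_measure_bounds[OF inv lo hi]
  have "?K / ?Q \<le> measure M {x \<in> ?T. x 0 = b}" "measure M {x \<in> ?T. x 0 = b} \<le> (?K + 1) / ?Q" by blast+
  then show "?K \<le> ?Q * measure M {x \<in> ?T. x 0 = b}" "?Q * measure M {x \<in> ?T. x 0 = b} \<le> ?K + 1"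
    using Q by (simp_all add: field_simps)
qed

end

section \<open>The isomorphism\<close>

context ferenczi_level
begin

abbreviation "C \<equiv> cont_int X"
abbreviation "GG \<equiv> GW q a n0"

lemma shift_in: "x \<in> X \<Longrightarrow> shift x \<in> X"
  by (simp add: shift_eq_sh sh_ferenczi)

lemma carrier_C: "f \<in> carrier C \<longleftrightarrow> f \<in> extensional X \<and> loc_const X f"
  by (simp add: cont_int_def continuous_on_iff_loc_const)

lemma mult_C: "f \<otimes>\<^bsub>C\<^esub> g = (\<lambda>x\<in>X. f x + g x)"
  by (simp add: cont_int_def)

lemma one_C: "\<one>\<^bsub>C\<^esub> = (\<lambda>x\<in>X. 0)"
  by (simp add: cont_int_def)

lemma restrict_in_C: "loc_const X f \<Longrightarrow> (\<lambda>x\<in>X. f x) \<in> carrier C"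
  by (simp add: carrier_C loc_const_def)

lemma group_C: "group C"
proof (rule groupI)
  show "\<one>\<^bsub>C\<^esub> \<in> carrier C" unfolding one_C by (rule restrict_in_C) simp
  fix f g assume f: "f \<in> carrier C" and g: "g \<in> carrier C"
  show "f \<otimes>\<^bsub>C\<^esub> g \<in> carrier C"
    unfolding mult_C using f g by (intro restrict_in_C loc_const_comp2[where H = "(+)"]) (auto simp: carrier_C)
next
  fix f assume f: "f \<in> carrier C"
  then have fe: "f \<in> extensional X" "loc_const X f" by (auto simp: carrier_C)
  show "\<one>\<^bsub>C\<^esub> \<otimes>\<^bsub>C\<^esub> f = f"
    using fe(1) by (auto simp: one_C mult_C extensional_def)
  have "(\<lambda>x\<in>X. - f x) \<in> carrier C" by (intro restrict_in_C loc_const_comp[where H = uminus] fe(2))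
  moreover have "(\<lambda>x\<in>X. - f x) \<otimes>\<^bsub>C\<^esub> f = \<one>\<^bsub>C\<^esub>" by (auto simp: one_C mult_C)
  ultimately show "\<exists>g\<in>carrier C. g \<otimes>\<^bsub>C\<^esub> f = \<one>\<^bsub>C\<^esub>" by blast
  fix g k
  show "f \<otimes>\<^bsub>C\<^esub> g \<otimes>\<^bsub>C\<^esub> k = f \<otimes>\<^bsub>C\<^esub> (g \<otimes>\<^bsub>C\<^esub> k)" by (auto simp: mult_C)
qed

definition hom_GW :: "((int \<Rightarrow> nat) \<Rightarrow> int) \<Rightarrow> (nat \<Rightarrow> int) \<times> rat" where
  "hom_GW f = (THE g. rel f g)"

lemma hom_GW_eq: "rel f g \<Longrightarrow> hom_GW f = g"
  unfolding hom_GW_def using rel_unique by blast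

lemma rel_hom_GW: "loc_const X f \<Longrightarrow> rel f (hom_GW f)"
  using rel_ex hom_GW_eq by metis

lemma hom_GW_in: "loc_const X f \<Longrightarrow> hom_GW f \<in> carrier GG"
  by (rule rel_in_GW[OF rel_hom_GW])

lemma hom_GW_add: "loc_const X f \<Longrightarrow> loc_const X g \<Longrightarrow> hom_GW (\<lambda>x\<in>X. f x + g x) = hom_GW f \<otimes>\<^bsub>GG\<^esub> hom_GW g"
  by (rule hom_GW_eq, rule rel_cong[OF _ rel_add[OF rel_hom_GW rel_hom_GW]]) auto

lemma group_hom_GW: "group_hom C GG hom_GW"
proof -
  have "hom_GW \<in> hom C GG"
    unfolding hom_def by (auto simp: carrier_C mult_C hom_GW_add hom_GW_in)
  then show ?thesis
    by (intro group_hom.intro group_C group_GW) (simp add: group_hom_axioms_def)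
qed

text \<open>\<open>coboundaries\<close> asks for an extensional transfer function; restricting to
  \<open>X\<close> supplies it, because \<open>X\<close> is invariant under
  \<open>shift\<close>.\<close>

lemma kernel_eq: "kernel C GG hom_GW = coboundaries X shift"
proof -
  have "f \<in> kernel C GG hom_GW \<longleftrightarrow> f \<in> carrier C \<and> is_coboundary f" for f
  proof (cases "f \<in> carrier C")
    case True
    then have l: "loc_const X f" by (simp add: carrier_C)
    have "hom_GW f = (\<lambda>b\<in>B. 0, 0) \<longleftrightarrow> is_coboundary f"
      using rel_hom_GW[OF l] rel_0_iff[OF l] hom_GW_eq by metis
    then show ?thesis using True by (simp add: kernel_def one_GW)
  qed (simp add: kernel_def)
  moreover have "f \<in> coboundaries X shift \<longleftrightarrow> f \<in> carrier C \<and> is_coboundary f" for f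
  proof
    assume "f \<in> coboundaries X shift"
    then obtain u where u: "u \<in> carrier C" "f = (\<lambda>x\<in>X. u (shift x) - u x)"
      unfolding coboundaries_def by blast
    have lu: "loc_const X u" using u(1) by (simp add: carrier_C)
    have "loc_const X (\<lambda>x. u (sh 1 x) - u x)"
      by (rule loc_const_comp2[where H = "(-)", OF loc_const_sh[OF lu sh_ferenczi] lu])
    then have "f \<in> carrier C" unfolding u(2) shift_eq_sh by (rule restrict_in_C)
    moreover have "is_coboundary f" unfolding is_coboundary_def using lu u(2) by (intro exI[of _ u]) (simp add: shift_eq_sh)
    ultimately show "f \<in> carrier C \<and> is_coboundary f" by blast
  next
    assume f: "f \<in> carrier C \<and> is_coboundary f"
    then obtain u where u: "loc_const X u" "\<And>x. x \<in> X \<Longrightarrow> f x = u (sh 1 x) - u x" unfolding is_coboundary_def by blast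
    let ?u = "\<lambda>x\<in>X. u x"
    have "f = (\<lambda>x\<in>X. ?u (shift x) - ?u x)"
    proof
      fix x
      show "f x = (\<lambda>x\<in>X. ?u (shift x) - ?u x) x"
        using u(2)[of x] f shift_in[of x] by (cases "x \<in> X") (auto simp: carrier_C extensional_def shift_eq_sh)
    qed
    then show "f \<in> coboundaries X shift"
      unfolding coboundaries_def using restrict_in_C[OF u(1)] by blast
  qed
  ultimately show ?thesis by blast
qed

lemma hom_GW_surj: "hom_GW ` carrier C = carrier GG"
proof
  show "hom_GW ` carrier C \<subseteq> carrier GG"
    using hom_GW_in carrier_C by blast
  show "carrier GG \<subseteq> hom_GW ` carrier C"
  proof
    fix g assume "g \<in> carrier GG"
    then obtain n v where n: "m \<le> n" "g = proj n v" using proj_surj by blast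
    have "rel (\<lambda>x\<in>X. chi n v x) g" unfolding n(2) by (rule rel_cong[OF _ rel_chi[OF n(1)]]) simp
    then have "hom_GW (\<lambda>x\<in>X. chi n v x) = g" by (rule hom_GW_eq)
    moreover have "(\<lambda>x\<in>X. chi n v x) \<in> carrier C" by (rule restrict_in_C[OF loc_const_chi])
    ultimately show "g \<in> hom_GW ` carrier C" by (metis image_eqI)
  qed
qed

section \<open>The order: nonnegative tower sums against positive scalar product\<close>

lemma proj_lift_nonneg:
  assumes "m \<le> n" "n \<le> N" "\<And>c. c \<in> A \<Longrightarrow> 0 \<le> v c"
  shows "\<exists>v'. proj N v' = proj n v \<and> (\<forall>c\<in>A. v c \<le> v' c)"
  using assms(2)
proof (induction N rule: dec_induct)
  case (step N)
  then obtain v' where v': "proj N v' = proj n v" "\<forall>c\<in>A. v c \<le> v' c" by blast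
  have N: "m \<le> N" using step assms(1) by simp
  have "v c \<le> push N v' c" if "c \<in> A" for c
  proof -
    have "0 \<le> v' (a N i)" if "i < q N" for i
      using v'(2) letter_in[OF N that] assms(3)[of "a N i"] by force
    then have "0 \<le> (\<Sum>i<q N. v' (a N i))" by (intro sum_nonneg) simp
    moreover have "v c \<le> v' c" using v'(2) that by blast
    ultimately show ?thesis by (simp add: push_def)
  qed
  then show ?case using proj_push[OF N, of v'] v'(1) by metis
qed blast

text \<open>A push adds \<open>q N\<close> further entries to each entry, so a lower bound common to
  all entries is multiplied by \<open>q N + 1\<close>, just as \<open>Qn\<close> is.\<close>

lemma proj_lift_growth:
  assumes "m \<le> n" "n \<le> N" "\<And>c. c \<in> A \<Longrightarrow> 1 \<le> v c"
  shows "\<exists>v'. proj N v' = proj n v \<and> (\<forall>c\<in>A. int (Qn N) \<le> v' c * int (Qn n))"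
  using assms(2)
proof (induction N rule: dec_induct)
  case base
  have "int (Qn n) \<le> v c * int (Qn n)" if "c \<in> A" for c
    using mult_right_mono[OF assms(3)[OF that], of "int (Qn n)"] by simp
  then show ?case by blast
next
  case (step N)
  then obtain v' where v': "proj N v' = proj n v" "\<And>c. c \<in> A \<Longrightarrow> int (Qn N) \<le> v' c * int (Qn n)" by blast
  have N: "m \<le> N" using step assms(1) by simp
  have "int (Qn (Suc N)) \<le> push N v' c * int (Qn n)" if c: "c \<in> A" for c
  proof -
    have "(\<Sum>i<q N. int (Qn N)) \<le> (\<Sum>i<q N. v' (a N i) * int (Qn n))"
      by (rule sum_mono) (use v'(2) letter_in[OF N] in auto)
    then have "int (q N) * int (Qn N) \<le> (\<Sum>i<q N. v' (a N i)) * int (Qn n)"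
      by (simp add: sum_distrib_right)
    then show ?thesis using v'(2)[OF c] by (simp add: push_def Qn_Suc[OF N] distrib_right)
  qed
  then show ?case using proj_push[OF N, of v'] v'(1) by metis
qed

context
  fixes M :: "(int \<Rightarrow> nat) measure"
  assumes inv: "invariant_probability (tau_hat_subshift q a n0) shift M"
begin

abbreviation "z \<equiv> z_vec q a n0 M"

lemma z_bounds:
  assumes "m \<le> n" "b \<in> B"
  shows "\<bar>real (block_count n b) - real (Qn n) * fst z b\<bar> \<le> 1"
  using kap_frequency[OF inv assms(1), of b] assms(2) by (simp add: z_vec_def)

definition vnorm :: "(nat \<Rightarrow> int) \<times> rat \<Rightarrow> real" where
  "vnorm g = (\<Sum>b\<in>B. \<bar>real_of_int (fst g b)\<bar>)"

lemma vnorm_nonneg: "0 \<le> vnorm g"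
  unfolding vnorm_def by (rule sum_nonneg) simp

text \<open>The difference is exactly the sum over \<open>B\<close> of the coordinates times
  \<open>block_count n b - Qn n * z b\<close>, and each of these factors is at most 1 in absolute
  value.\<close>

lemma dot_approx:
  assumes "m \<le> n"
  shows "\<bar>real_of_int (v a') - real (Qn n) * dot B (proj n v) z\<bar> \<le> vnorm (proj n v)"
proof -
  let ?x = "\<lambda>b. real_of_int (v b - v a')" and ?Q = "real (Qn n)"
  have Q: "?Q \<noteq> 0" using Qn_pos[of n] by simp
  have r: "real_of_rat (of_int (num n v) / of_nat (Qn n)) = real_of_int (num n v) / ?Q"
    by (simp add: of_rat_divide)
  have "dot B (proj n v) z = (\<Sum>b\<in>B. ?x b * fst z b) + real_of_int (num n v) / ?Q"
    unfolding dot_def proj_def by (simp add: r z_vec_def)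
  then have "?Q * dot B (proj n v) z = (\<Sum>b\<in>B. ?x b * (?Q * fst z b)) + real_of_int (num n v)"
    using Q by (simp add: distrib_left sum_distrib_left mult.left_commute)
  moreover have "real_of_int (v a') = real_of_int (num n v) + (\<Sum>b\<in>B. ?x b * real (block_count n b))"
    by (simp add: num_def mult.commute)
  ultimately have e: "real_of_int (v a') - ?Q * dot B (proj n v) z =
      (\<Sum>b\<in>B. ?x b * (real (block_count n b) - ?Q * fst z b))"
    unfolding right_diff_distrib sum_subtractf by linarith
  have "\<bar>real_of_int (v a') - ?Q * dot B (proj n v) z\<bar> \<le> (\<Sum>b\<in>B. \<bar>?x b * (real (block_count n b) - ?Q * fst z b)\<bar>)"
    unfolding e by (rule sum_abs)
  also have "\<dots> \<le> (\<Sum>b\<in>B. \<bar>?x b\<bar> * 1)"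
  proof (rule sum_mono)
    fix b assume b: "b \<in> B"
    show "\<bar>?x b * (real (block_count n b) - ?Q * fst z b)\<bar> \<le> \<bar>?x b\<bar> * 1"
      unfolding abs_mult by (rule mult_left_mono[OF z_bounds[OF assms b]]) simp
  qed
  also have "\<dots> = vnorm (proj n v)" by (simp add: vnorm_def proj_def)
  finally show ?thesis .
qed

lemma dot_pos_imp_nonneg:
  assumes "g \<in> carrier GG" "0 < dot B g z"
  obtains n v where "m \<le> n" "g = proj n v" "\<And>c. c \<in> A \<Longrightarrow> 0 \<le> v c"
proof -
  obtain n v where n: "m \<le> n" "g = proj n v" using proj_surj[OF assms(1)] by blast
  \<comment> \<open>One \<open>vnorm g\<close> pays for the error in \<open>dot_approx\<close>, the
    other for the differences between \<open>v' a'\<close> and the remaining entries; hence the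
    factor 2.\<close>
  define N where "N = max n (m + nat \<lceil>2 * vnorm g / dot B g z\<rceil>)"
  have N: "m \<le> N" "n \<le> N" by (auto simp: N_def)
  obtain v' where v': "proj N v' = g" using proj_lift[OF n(1) N(2)] n(2) by metis
  have "2 * vnorm g / dot B g z \<le> real (nat \<lceil>2 * vnorm g / dot B g z\<rceil>)" by (rule real_nat_ceiling_ge)
  also have "nat \<lceil>2 * vnorm g / dot B g z\<rceil> \<le> Qn N"
  proof -
    have "nat \<lceil>2 * vnorm g / dot B g z\<rceil> \<le> N - m" unfolding N_def by linarith
    then show ?thesis using Qn_gt[OF N(1)] by linarith
  qed
  finally have "2 * vnorm g \<le> real (Qn N) * dot B g z"
    using assms(2) by (simp add: field_simps)
  then have va: "vnorm g \<le> real_of_int (v' a')" using dot_approx[OF N(1), of v'] unfolding v' by linarith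
  have "0 \<le> v' c" if c: "c \<in> A" for c
  proof (cases "c = a'")
    case True
    then show ?thesis using va vnorm_nonneg[of g] by simp
  next
    case False
    with c have cB: "c \<in> B" using A_insert(1) by simp
    have "\<bar>real_of_int (fst g c)\<bar> \<le> vnorm g"
      unfolding vnorm_def using A_insert(3) cB by (intro member_le_sum) auto
    moreover have "fst g c = v' c - v' a'" unfolding v'[symmetric] proj_def using cB by simp
    ultimately have "0 \<le> real_of_int (v' c)" using va by simp
    then show ?thesis by simp
  qed
  with N(1) v' show thesis by (intro that[of N v']) auto
qed

text \<open>The letter \<open>c\<close> returns as a spacer \<open>a N i\<close>, so one push on
  level \<open>N\<close> makes all entries positive. From then on they grow at the rate of
  \<open>Qn\<close>, which a scalar product at most 0 would forbid by
  \<open>dot_approx\<close>.\<close>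

lemma nonneg_imp_dot_pos:
  assumes n: "m \<le> n" and v: "\<And>c. c \<in> A \<Longrightarrow> 0 \<le> v c" and c: "c \<in> A" "0 < v c"
  shows "0 < dot B (proj n v) z"
proof -
  have "c \<in> alph q a (Suc n)" using c(1) alph_eq[OF n] by simp
  then obtain N i where N: "n \<le> N" "i < q N" "c = a N i" by (auto simp: alph_Suc)
  have mN: "m \<le> N" using n N(1) by simp
  obtain v1 where v1: "proj N v1 = proj n v" "\<And>c. c \<in> A \<Longrightarrow> v c \<le> v1 c"
    using proj_lift_nonneg[of n N v, OF n N(1) v] by blast
  have nn: "0 \<le> v1 d" if "d \<in> A" for d using v[OF that] v1(2)[OF that] by simp
  have "1 \<le> push N v1 d" if "d \<in> A" for d
  proof -
    have "v1 (a N i) \<le> (\<Sum>i<q N. v1 (a N i))"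
      using N(2) nn letter_in[OF mN] by (intro member_le_sum) auto
    moreover have "1 \<le> v1 (a N i)" using v1(2)[OF c(1)] c(2) N(3) by simp
    ultimately show ?thesis using nn[OF that] by (simp add: push_def)
  qed
  note big = this
  let ?g = "proj n v" and ?n = "Suc N" and ?w = "push N v1"
  have w: "proj ?n ?w = ?g" using proj_push[OF mN, of v1] v1(1) by simp
  have mn: "m \<le> ?n" using mN by simp
  \<comment> \<open>Chosen so that the lower bound \<open>Qn L / Qn ?n\<close> for
    \<open>u a'\<close> exceeds \<open>vnorm ?g\<close>, the error in
    \<open>dot_approx\<close>.\<close>
  define L where "L = max ?n (m + nat \<lceil>real (Qn ?n) * vnorm ?g\<rceil>)"
  have L: "m \<le> L" "?n \<le> L" using mn by (auto simp: L_def)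
  obtain u where u: "proj L u = ?g" "\<And>c. c \<in> A \<Longrightarrow> int (Qn L) \<le> u c * int (Qn ?n)"
    using proj_lift_growth[of ?n L ?w, OF mn L(2) big] unfolding w by blast
  have "real (Qn ?n) * vnorm ?g \<le> real (nat \<lceil>real (Qn ?n) * vnorm ?g\<rceil>)" by (rule real_nat_ceiling_ge)
  also have "real (nat \<lceil>real (Qn ?n) * vnorm ?g\<rceil>) < real (Qn L)"
  proof -
    have "nat \<lceil>real (Qn ?n) * vnorm ?g\<rceil> \<le> L - m" unfolding L_def by linarith
    then show ?thesis using Qn_gt[OF L(1)] by linarith
  qed
  finally have 1: "real (Qn ?n) * vnorm ?g < real (Qn L)" .
  have "real_of_int (int (Qn L)) \<le> real_of_int (u a' * int (Qn ?n))"
    using u(2)[OF min_in] by (rule of_int_le_iff[THEN iffD2])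
  then have 2: "real (Qn L) \<le> real_of_int (u a') * real (Qn ?n)" by simp
  have "real_of_int (u a') \<le> real (Qn L) * dot B ?g z + vnorm ?g"
    using dot_approx[OF L(1), of u] unfolding u(1) by linarith
  then have "real_of_int (u a') * real (Qn ?n) \<le> (real (Qn L) * dot B ?g z + vnorm ?g) * real (Qn ?n)"
    by (rule mult_right_mono) simp
  with 1 2 have "0 < real (Qn L) * dot B ?g z * real (Qn ?n)" by (simp add: algebra_simps)
  then show ?thesis using Qn_pos by (simp add: zero_less_mult_iff)
qed

text \<open>A nonnegative function has nonnegative tower sums, which either vanish or give a
  positive scalar product. Conversely an element of the cone is realized by a nonnegative vector,
  hence by a nonnegative \<open>chi\<close>.\<close>

lemma hom_GW_pos: "hom_GW ` {f \<in> carrier C. \<forall>x\<in>X. 0 \<le> f x} = GW_pos q a n0 M"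
proof
  show "hom_GW ` {f \<in> carrier C. \<forall>x\<in>X. 0 \<le> f x} \<subseteq> GW_pos q a n0 M"
  proof
    fix g assume "g \<in> hom_GW ` {f \<in> carrier C. \<forall>x\<in>X. 0 \<le> f x}"
    then obtain f where f: "loc_const X f" "\<And>x. x \<in> X \<Longrightarrow> 0 \<le> f x" "g = hom_GW f" by (auto simp: carrier_C)
    show "g \<in> GW_pos q a n0 M"
    proof (rule ex_has_tsum[OF f(1), of m])
      fix \<phi> n v
      assume p: "loc_const X \<phi>" "is_coboundary (\<lambda>x. f x - \<phi> x)" "m \<le> n" "has_tower_sum n \<phi> v"
      "(\<forall>x\<in>X. 0 \<le> f x) \<longrightarrow> (\<forall>c\<in>alph q a (Suc n). 0 \<le> v c)"
      have "rel f (proj n v)"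
        unfolding rel_def using p(1-4) by (intro exI[of _ \<phi>] exI[of _ n] exI[of _ v]) simp
      then have g: "g = proj n v" using f(3) hom_GW_eq by simp
      have nn: "0 \<le> v c" if "c \<in> A" for c using p(5) f(2) alph_eq[OF p(3)] that by simp
      show "g \<in> GW_pos q a n0 M"
      proof (cases "\<exists>c\<in>A. 0 < v c")
        case True
        then have "0 < dot B g z" unfolding g using nonneg_imp_dot_pos[of n v, OF p(3) nn] by blast
        then show ?thesis unfolding GW_pos_def using proj_in_GW[OF p(3)] g by simp
      next
        case False
        then have "v c = 0" if "c \<in> A" for c using nn[OF that] that by force
        then have "g = proj n (\<lambda>_. 0)" unfolding g by (rule proj_cong)
        then show ?thesis by (simp add: GW_pos_def proj_0 one_GW)
      qed
    qed
  qed
  show "GW_pos q a n0 M \<subseteq> hom_GW ` {f \<in> carrier C. \<forall>x\<in>X. 0 \<le> f x}"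
  proof
    fix g assume g: "g \<in> GW_pos q a n0 M"
    have "\<exists>n v. m \<le> n \<and> g = proj n v \<and> (\<forall>c\<in>A. 0 \<le> v c)"
    proof (cases "g = \<one>\<^bsub>GG\<^esub>")
      case True
      then show ?thesis using proj_0[of m] by (intro exI[of _ m] exI[of _ "\<lambda>_. 0"]) (simp add: one_GW)
    next
      case False
      with g have "g \<in> carrier GG" "0 < dot B g z" by (auto simp: GW_pos_def)
      then show ?thesis using dot_pos_imp_nonneg by metis
    qed
    then obtain n v where n: "m \<le> n" "g = proj n v" "\<And>c. c \<in> A \<Longrightarrow> 0 \<le> v c" by blast
    let ?f = "\<lambda>x\<in>X. chi n v x"
    have "rel ?f g" unfolding n(2) by (rule rel_cong[OF _ rel_chi[OF n(1)]]) simp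
    then have "hom_GW ?f = g" by (rule hom_GW_eq)
    moreover have "?f \<in> carrier C" by (rule restrict_in_C[OF loc_const_chi])
    moreover have "0 \<le> ?f x" if "x \<in> X" for x
      using that n(3) spc_alph[of x n] alph_eq[OF n(1)] by (auto simp: chi_def)
    ultimately show "g \<in> hom_GW ` {f \<in> carrier C. \<forall>x\<in>X. 0 \<le> f x}" by (intro image_eqI[of _ _ ?f]) auto
  qed
qed

text \<open>The tower sums of 1 are the heights \<open>h m + c\<close>. On level \<open>m\<close>
  the correction in \<open>num\<close> is 0 and \<open>Qn\<close> is 1, so the coordinates can be
  read off.\<close>

lemma hom_GW_unit: "hom_GW (\<lambda>x\<in>X. 1) = uW q a n0"
proof -
  define v where "v c = int (h m) + int c" for c
  have "has_tower_sum m (\<lambda>x. 1) v" by (auto simp: has_tower_sum_def tower_sum_def v_def tower_height_def)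
  then have "rel (\<lambda>x. 1) (proj m v)"
    unfolding rel_def by (intro exI[of _ "\<lambda>x. 1"] exI[of _ m] exI[of _ v]) (simp add: cob_0)
  then have "rel (\<lambda>x\<in>X. 1) (proj m v)" by (rule rel_cong[rotated]) simp
  then have "hom_GW (\<lambda>x\<in>X. 1) = proj m v" by (rule hom_GW_eq)
  also have "proj m v = uW q a n0"
    unfolding proj_def uW_def num_def kap_m Qn_m by (auto simp: v_def restrict_def fun_eq_iff)
  finally show ?thesis .
qed

lemma K0_isomorphic: "unital_order_isomorphic (K0 X shift) (GG, GW_pos q a n0 M, uW q a n0)"
proof -
  interpret group_hom C GG hom_GW by (rule group_hom_GW)
  let ?\<Phi> = "\<lambda>S. the_elem (hom_GW ` S)"
  have iso: "?\<Phi> \<in> iso (C Mod coboundaries X shift) GG"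
    using FactGroup_iso_set[OF hom_GW_surj] unfolding kernel_eq .
  \<comment> \<open>\<open>hom_GW\<close> is constant on a coset of its kernel, so the image of the
    coset is a singleton.\<close>
  have cls: "?\<Phi> (cohom_class X shift f) = hom_GW f" if f: "f \<in> carrier C" for f
  proof -
    have "hom_GW ` (coboundaries X shift #>\<^bsub>C\<^esub> f) = {hom_GW f}"
    proof -
      have "hom_GW (k \<otimes>\<^bsub>C\<^esub> f) = hom_GW f" if "k \<in> kernel C GG hom_GW" for k
        using that f by (simp add: kernel_def)
      moreover have "\<one>\<^bsub>C\<^esub> \<in> kernel C GG hom_GW" by (simp add: kernel_def)
      ultimately have "(\<lambda>k. hom_GW (k \<otimes>\<^bsub>C\<^esub> f)) ` kernel C GG hom_GW = {hom_GW f}"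
        by (simp only: image_constant cong: image_cong)
      moreover have "coboundaries X shift #>\<^bsub>C\<^esub> f = (\<lambda>k. k \<otimes>\<^bsub>C\<^esub> f) ` kernel C GG hom_GW"
        unfolding r_coset_def kernel_eq by (rule UNION_singleton_eq_range)
      ultimately show ?thesis by (simp only: image_image)
    qed
    then show ?thesis by (simp add: cohom_class_def)
  qed
  have "?\<Phi> ` cohom_class X shift ` {f \<in> carrier C. \<forall>x\<in>X. 0 \<le> f x} = GW_pos q a n0 M"
    unfolding hom_GW_pos[symmetric] image_image by (rule image_cong) (auto simp: cls)
  moreover have "?\<Phi> (cohom_class X shift (\<lambda>x\<in>X. 1)) = uW q a n0"
    using cls[OF restrict_in_C[of "\<lambda>x. 1"]] hom_GW_unit by simp
  ultimately show ?thesis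
    unfolding unital_order_isomorphic_def K0_def using iso by auto
qed

end

end

theorem proposition4p10:
  fixes q :: "nat \<Rightarrow> nat" and a :: "nat \<Rightarrow> nat \<Rightarrow> nat" and n0 :: nat
    and M :: "(int \<Rightarrow> nat) measure"
  assumes "standard_params q"
    and "bounded_spacers q a"
    and "aperiodic_subshift (ferenczi_subshift q a)"
    and "stable_level q a n0"
    and "invariant_probability (tau_hat_subshift q a n0) shift M"
  shows "unital_order_isomorphic
           (K0 (ferenczi_subshift q a) shift)
           (GW q a n0, GW_pos q a n0 M, uW q a n0)"
proof -
  interpret ferenczi_level q a n0
    by unfold_locales (rule assms)+
  show ?thesis by (rule K0_isomorphic[OF assms(5)])
qed

end
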